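(* Let $Y$ be a uniformly retract rational real affine variety and let $X$ be a real affine variety. Let $Z\subset X$ be a compact Zariski closed subvariety of $X$ and let $f,g:Z\rightarrow Y$ be two homotopic regular mappings. Suppose that $g$ extends to a regular mapping $G:X\rightarrow Y$. Then $f$ extends to a regular mapping $F:X\rightarrow Y$ as well.
   Context: A real affine variety is a space with a sheaf of real-valued functions isomorphic to a Zariski closed subset $X$ of some $\mathbb{R}^n$ with its sheaf of regular functions; a regular function on a Zariski open $U\subset X$ is a function of the form $P/Q$ with $P,Q$ polynomials and $Q$ nowhere zero on $U$. Varieties need not be irreducible. Zariski locally closed subsets of affine varieties are real affine varieties in this sense. Morphisms are called regular maps. Compactness and homotopy (through continuous maps) refer to the Euclidean topology. A real affine variety $V$ is globally retract rational if there exist, for some $n$, a Zariski open subset $W\subset\mathbb{R}^n$ and regular mappings $i:V\to W$, $r:W\to V$ with $r\circ i=\mathrm{id}_V$. A real affine variety $Y$ is uniformly retract rational if every point $y\in Y$ has a Zariski open neighbourhood $V$ in $Y$ which is globally retract rational. *)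

theory Defs
  imports "HOL-Analysis.Analysis"
begin

(* Conventions.  R^n is topspace (Euclidean_space n), i.e. the set of all x :: nat => real with
   x i = 0 for i >= n.  A function on a subset U of a type is represented by its extensional
   representative, so that restrict f U is "f as a function on U". *)

section \<open>Polynomial functions and the Zariski topology of real n-space\<close>

inductive polynomial_fun :: "nat \<Rightarrow> ((nat \<Rightarrow> real) \<Rightarrow> real) \<Rightarrow> bool" for n :: nat where
  const: "polynomial_fun n (\<lambda>x. c)"
| coord: "i < n \<Longrightarrow> polynomial_fun n (\<lambda>x. x i)"
| add: "polynomial_fun n P \<Longrightarrow> polynomial_fun n Q \<Longrightarrow> polynomial_fun n (\<lambda>x. P x + Q x)"
| mult: "polynomial_fun n P \<Longrightarrow> polynomial_fun n Q \<Longrightarrow> polynomial_fun n (\<lambda>x. P x * Q x)"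

definition zero_set :: "nat \<Rightarrow> ((nat \<Rightarrow> real) \<Rightarrow> real) set \<Rightarrow> (nat \<Rightarrow> real) set" where
  "zero_set n S = {x \<in> topspace (Euclidean_space n). \<forall>P\<in>S. P x = 0}"

lemma zero_setD: "x \<in> zero_set n S \<Longrightarrow> \<forall>P\<in>S. P x = 0"
  by (simp add: zero_set_def)

definition zariski_topology :: "nat \<Rightarrow> (nat \<Rightarrow> real) topology" where
  "zariski_topology n = topology (\<lambda>U. U \<subseteq> topspace (Euclidean_space n) \<and>
     (\<exists>S. (\<forall>P\<in>S. polynomial_fun n P) \<and> topspace (Euclidean_space n) - U = zero_set n S))"

lemma istopology_zariski:
  "istopology (\<lambda>U. U \<subseteq> topspace (Euclidean_space n) \<and>
     (\<exists>S. (\<forall>P\<in>S. polynomial_fun n P) \<and> topspace (Euclidean_space n) - U = zero_set n S))"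
  (is "istopology ?O")
proof -
  let ?E = "topspace (Euclidean_space n)"
  have int: "?O (U \<inter> V)" if U: "?O U" and V: "?O V" for U V
  proof -
    obtain S where S: "\<forall>P\<in>S. polynomial_fun n P" "?E - U = zero_set n S" using U by auto
    obtain T where T: "\<forall>P\<in>T. polynomial_fun n P" "?E - V = zero_set n T" using V by auto
    let ?ST = "{\<lambda>x. P x * Q x | P Q. P \<in> S \<and> Q \<in> T}"
    have "\<forall>P\<in>?ST. polynomial_fun n P"
      using S(1) T(1) by (auto intro: polynomial_fun.mult)
    moreover have "zero_set n ?ST = zero_set n S \<union> zero_set n T"
    proof
      show "zero_set n ?ST \<subseteq> zero_set n S \<union> zero_set n T"
      proof
        fix x assume x: "x \<in> zero_set n ?ST"
        show "x \<in> zero_set n S \<union> zero_set n T"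
        proof (rule ccontr)
          assume "x \<notin> zero_set n S \<union> zero_set n T"
          then obtain P Q where PQ: "P \<in> S" "Q \<in> T" "P x \<noteq> 0" "Q x \<noteq> 0"
            using x by (auto simp: zero_set_def)
          then have "(\<lambda>x. P x * Q x) \<in> ?ST" by blast
          moreover have "\<forall>R\<in>?ST. R x = 0"
            by (rule zero_setD[OF x])
          ultimately have "P x * Q x = 0" by (rule bspec[rotated])
          then show False using PQ by simp
        qed
      qed
    qed (auto simp: zero_set_def)
    then have "?E - U \<inter> V = zero_set n ?ST" using S(2) T(2) by auto
    ultimately show ?thesis using U by blast
  qed
  have un: "?O (\<Union>K)" if K: "\<forall>U\<in>K. ?O U" for K
  proof -
    from K have "\<exists>S. \<forall>U\<in>K. (\<forall>P\<in>S U. polynomial_fun n P) \<and> ?E - U = zero_set n (S U)"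
      by (intro bchoice) blast
    then obtain S where S: "\<And>U. U \<in> K \<Longrightarrow> (\<forall>P\<in>S U. polynomial_fun n P) \<and> ?E - U = zero_set n (S U)"
      by blast
    have "?E - \<Union>K = zero_set n (\<Union>U\<in>K. S U)"
    proof (rule set_eqI)
      fix x
      have "x \<in> ?E - \<Union>K \<longleftrightarrow> x \<in> ?E \<and> (\<forall>U\<in>K. x \<in> ?E - U)" by blast
      also have "\<dots> \<longleftrightarrow> x \<in> ?E \<and> (\<forall>U\<in>K. x \<in> zero_set n (S U))" using S by simp
      also have "\<dots> \<longleftrightarrow> x \<in> zero_set n (\<Union>U\<in>K. S U)" unfolding zero_set_def by blast
      finally show "x \<in> ?E - \<Union>K \<longleftrightarrow> x \<in> zero_set n (\<Union>U\<in>K. S U)" .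
    qed
    moreover have "\<forall>P\<in>(\<Union>U\<in>K. S U). polynomial_fun n P" using S by blast
    moreover have "\<Union>K \<subseteq> ?E" using K by blast
    ultimately show ?thesis by blast
  qed
  show ?thesis
    unfolding istopology_def using int un by blast
qed

lemma openin_zariski_topology:
  "openin (zariski_topology n) U \<longleftrightarrow> U \<subseteq> topspace (Euclidean_space n) \<and>
     (\<exists>S. (\<forall>P\<in>S. polynomial_fun n P) \<and> topspace (Euclidean_space n) - U = zero_set n S)"
  unfolding zariski_topology_def topology_inverse'[OF istopology_zariski] by (rule refl)

lemma topspace_zariski_topology [simp]:
  "topspace (zariski_topology n) = topspace (Euclidean_space n)"
proof -
  have "openin (zariski_topology n) (topspace (Euclidean_space n))"
    unfolding openin_zariski_topology
    by (auto intro!: exI[of _ "{\<lambda>x. 1}"] polynomial_fun.const simp: zero_set_def)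
  then show ?thesis
    by (metis openin_zariski_topology openin_subset openin_topspace subset_antisym)
qed

lemma closedin_zariski_topology:
  "closedin (zariski_topology n) A \<longleftrightarrow> (\<exists>S. (\<forall>P\<in>S. polynomial_fun n P) \<and> A = zero_set n S)"
  unfolding closedin_def openin_zariski_topology topspace_zariski_topology
  by (auto simp: double_diff) (auto simp: zero_set_def)

lemma openin_zariski_nonzero:
  assumes "polynomial_fun n Q"
  shows "openin (zariski_topology n) {x \<in> topspace (Euclidean_space n). Q x \<noteq> 0}"
  unfolding openin_zariski_topology
  using assms by (auto intro!: exI[of _ "{Q}"] simp: zero_set_def)

section \<open>Spaces with functions and real affine varieties\<close>

(* sections X U is only meaningful for Zariski open U.  The sheaf axioms need not be imposed
   separately: they follow from being isomorphic to a Zariski closed set. *)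
record 'a function_space =
  zariski :: "'a topology"
  sections :: "'a set \<Rightarrow> ('a \<Rightarrow> real) set"

definition affine_set :: "nat \<Rightarrow> (nat \<Rightarrow> real) set \<Rightarrow> (nat \<Rightarrow> real) function_space" where
  "affine_set n A =
     \<lparr>zariski = subtopology (zariski_topology n) A,
      sections = (\<lambda>U. {restrict (\<lambda>x. P x / Q x) U | P Q.
        openin (subtopology (zariski_topology n) A) U \<and>
        polynomial_fun n P \<and> polynomial_fun n Q \<and> (\<forall>x\<in>U. Q x \<noteq> 0)})\<rparr>"

definition regular_map :: "'a function_space \<Rightarrow> 'b function_space \<Rightarrow> ('a \<Rightarrow> 'b) \<Rightarrow> bool" where
  "regular_map X Y h \<longleftrightarrow> continuous_map (zariski X) (zariski Y) h \<and>
     (\<forall>U s. openin (zariski Y) U \<and> s \<in> sections Y U \<longrightarrow>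
        restrict (s \<circ> h) {x \<in> topspace (zariski X). h x \<in> U}
          \<in> sections X {x \<in> topspace (zariski X). h x \<in> U})"

definition regular_isomorphism ::
    "'a function_space \<Rightarrow> 'b function_space \<Rightarrow> ('a \<Rightarrow> 'b) \<Rightarrow> bool" where
  "regular_isomorphism X Y \<phi> \<longleftrightarrow> regular_map X Y \<phi> \<and>
     (\<exists>\<psi>. regular_map Y X \<psi> \<and> (\<forall>x\<in>topspace (zariski X). \<psi> (\<phi> x) = x) \<and>
          (\<forall>y\<in>topspace (zariski Y). \<phi> (\<psi> y) = y))"

definition real_affine_variety :: "'a function_space \<Rightarrow> bool" where
  "real_affine_variety X \<longleftrightarrow>
     (\<forall>U. openin (zariski X) U \<longrightarrow> sections X U \<subseteq> extensional U) \<and>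
     (\<exists>n A \<phi>. closedin (zariski_topology n) A \<and> regular_isomorphism X (affine_set n A) \<phi>)"

(* The structure induced on a subset B of X (used for B Zariski open or closed): a function is
   regular on a relatively open set if it extends to a regular function on an open subset of X.
   On affine varieties no sheafification is necessary; see induced_affine_set below. *)
definition induced :: "'a function_space \<Rightarrow> 'a set \<Rightarrow> 'a function_space" where
  "induced X B =
     \<lparr>zariski = subtopology (zariski X) B,
      sections = (\<lambda>U. {restrict s U | s U'.
        openin (zariski X) U' \<and> s \<in> sections X U' \<and> U = U' \<inter> B})\<rparr>"

lemma induced_affine_set:
  assumes "B \<subseteq> A"
  shows "induced (affine_set n A) B = affine_set n B"
proof -
  let ?T = "zariski_topology n"
  have top: "subtopology (subtopology ?T A) B = subtopology ?T B"
    using assms by (simp add: subtopology_subtopology Int_absorb1)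
  have sec: "sections (induced (affine_set n A) B) U = sections (affine_set n B) U" for U
  proof
    show "sections (induced (affine_set n A) B) U \<subseteq> sections (affine_set n B) U"
    proof
      fix f assume "f \<in> sections (induced (affine_set n A) B) U"
      then obtain U' P Q where *: "openin (subtopology ?T A) U'" "U = U' \<inter> B"
        "f = restrict (restrict (\<lambda>x. P x / Q x) U') U"
        "polynomial_fun n P" "polynomial_fun n Q" "\<forall>x\<in>U'. Q x \<noteq> 0"
        by (auto simp: induced_def affine_set_def)
      have "openin (subtopology ?T B) U"
        using *(1,2) unfolding top[symmetric] openin_subtopology[of _ B] by blast
      moreover have "f = restrict (\<lambda>x. P x / Q x) U"
        using *(2,3) by (auto simp: restrict_def)
      ultimately show "f \<in> sections (affine_set n B) U"
        using * by (auto simp: affine_set_def)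
    qed
  next
    show "sections (affine_set n B) U \<subseteq> sections (induced (affine_set n A) B) U"
    proof
      fix f assume "f \<in> sections (affine_set n B) U"
      then obtain P Q where *: "openin (subtopology ?T B) U"
        "f = restrict (\<lambda>x. P x / Q x) U"
        "polynomial_fun n P" "polynomial_fun n Q" "\<forall>x\<in>U. Q x \<noteq> 0"
        by (auto simp: affine_set_def)
      obtain O' where O': "openin ?T O'" "U = O' \<inter> B"
        using *(1) by (auto simp: openin_subtopology)
      let ?D = "{x \<in> topspace (Euclidean_space n). Q x \<noteq> 0}"
      let ?U' = "(O' \<inter> ?D) \<inter> A"
      have U': "openin (subtopology ?T A) ?U'"
        using O'(1) openin_zariski_nonzero[OF *(4)] by (meson openin_Int openin_subtopology)
      have "O' \<subseteq> topspace (Euclidean_space n)"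
        using O'(1) openin_subset by fastforce
      then have UU: "U = ?U' \<inter> B" using O'(2) *(5) assms by blast
      let ?s = "restrict (\<lambda>x. P x / Q x) ?U'"
      have "?s \<in> sections (affine_set n A) ?U'"
        unfolding affine_set_def using U' *(3,4) by auto
      moreover have "f = restrict ?s U"
        using *(2) UU by (auto simp: restrict_def)
      moreover have "openin (zariski (affine_set n A)) ?U'"
        using U' by (simp add: affine_set_def)
      ultimately show "f \<in> sections (induced (affine_set n A) B) U"
        unfolding induced_def function_space.simps mem_Collect_eq using UU by blast
    qed
  qed
  show ?thesis
  proof (rule function_space.equality)
    show "zariski (induced (affine_set n A) B) = zariski (affine_set n B)"
      using top by (simp add: induced_def affine_set_def)
    show "sections (induced (affine_set n A) B) = sections (affine_set n B)"
      using sec by (rule ext)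
  qed auto
qed

section \<open>The Euclidean topology of a real affine variety\<close>

(* The topology transported from R^n; by euclidean_topology_eq below it does not depend on
   the chosen model of X as a Zariski closed set. *)
definition euclidean_topology :: "'a function_space \<Rightarrow> 'a topology" where
  "euclidean_topology X =
     (THE T. \<exists>n A \<phi>. closedin (zariski_topology n) A \<and> regular_isomorphism X (affine_set n A) \<phi> \<and>
        T = pullback_topology (topspace (zariski X)) \<phi> (Euclidean_space n))"

lemma polynomial_fun_continuous:
  assumes "polynomial_fun n P"
  shows "continuous_map (Euclidean_space m) euclideanreal P"
  using assms
proof induction
  case (coord i)
  then show ?case
    unfolding Euclidean_space_def
    by (intro continuous_map_from_subtopology continuous_map_product_projection) auto
qed (auto intro: continuous_map_add continuous_map_real_mult)

lemma topspace_zariski_affine_set: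
  "topspace (zariski (affine_set n A)) = topspace (Euclidean_space n) \<inter> A"
  by (simp add: affine_set_def)

lemma regular_map_continuous: "regular_map X Y h \<Longrightarrow> continuous_map (zariski X) (zariski Y) h"
  by (simp add: regular_map_def)

lemma regular_map_into:
  assumes "regular_map X Y h" "x \<in> topspace (zariski X)"
  shows "h x \<in> topspace (zariski Y)"
  using continuous_map_funspace[OF regular_map_continuous[OF assms(1)]] assms(2) by (rule funcset_mem)

lemma regular_map_sections:
  assumes "regular_map X Y h" "openin (zariski Y) U" "s \<in> sections Y U"
  shows "restrict (s \<circ> h) {x \<in> topspace (zariski X). h x \<in> U}
    \<in> sections X {x \<in> topspace (zariski X). h x \<in> U}"
  using assms by (simp add: regular_map_def)

lemma regular_map_comp:
  assumes h: "regular_map X Y h" and k: "regular_map Y W k"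
  shows "regular_map X W (k \<circ> h)"
  unfolding regular_map_def
proof (intro conjI allI impI)
  show "continuous_map (zariski X) (zariski W) (k \<circ> h)"
    using h k by (blast intro: continuous_map_compose regular_map_continuous)
  fix U s assume *: "openin (zariski W) U \<and> s \<in> sections W U"
  let ?V = "{y \<in> topspace (zariski Y). k y \<in> U}"
  let ?V' = "{x \<in> topspace (zariski X). h x \<in> ?V}"
  have V_open: "openin (zariski Y) ?V"
    by (rule openin_continuous_map_preimage[OF regular_map_continuous[OF k]]) (use * in simp)
  have eqr: "restrict (restrict (s \<circ> k) ?V \<circ> h) ?V' = restrict (s \<circ> (k \<circ> h)) ?V'"
    by (rule ext) (simp add: restrict_def)
  have eqV: "{x \<in> topspace (zariski X). (k \<circ> h) x \<in> U} = ?V'"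
    using regular_map_into[OF h] by (simp cong: conj_cong)
  have "restrict (restrict (s \<circ> k) ?V \<circ> h) ?V' \<in> sections X ?V'"
    using * by (intro regular_map_sections[OF h V_open] regular_map_sections[OF k]) simp_all
  then show "restrict (s \<circ> (k \<circ> h)) {x \<in> topspace (zariski X). (k \<circ> h) x \<in> U}
      \<in> sections X {x \<in> topspace (zariski X). (k \<circ> h) x \<in> U}"
    unfolding eqV eqr .
qed

lemma regular_map_affine_set_continuous:
  assumes h: "regular_map (affine_set m A) (affine_set n B) h"
  shows "continuous_map (subtopology (Euclidean_space m) A) (Euclidean_space n) h"
proof -
  let ?X = "topspace (Euclidean_space m) \<inter> A" and ?Y = "topspace (Euclidean_space n) \<inter> B"
  have hXY: "h x \<in> ?Y" if "x \<in> ?X" for x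
    using regular_map_into[OF h, of x] that by (simp add: topspace_zariski_affine_set)
  have cont: "continuous_map (subtopology (Euclidean_space m) A) euclideanreal (\<lambda>x. h x i)"
    if i: "i < n" for i
  proof -
    have Y_open: "openin (zariski (affine_set n B)) ?Y"
      using openin_topspace[of "zariski (affine_set n B)"]
      unfolding topspace_zariski_affine_set .
    have "restrict (\<lambda>x. x i / 1) ?Y \<in> sections (affine_set n B) ?Y"
      using Y_open polynomial_fun.coord[OF i] polynomial_fun.const[of n 1]
      unfolding affine_set_def function_space.simps mem_Collect_eq
      by (intro exI[of _ "\<lambda>x. x i"] exI[of _ "\<lambda>x. 1"]) simp
    from regular_map_sections[OF h Y_open this]
    have "restrict (restrict (\<lambda>x. x i / 1) ?Y \<circ> h)
        {x \<in> topspace (zariski (affine_set m A)). h x \<in> ?Y}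
        \<in> sections (affine_set m A) {x \<in> topspace (zariski (affine_set m A)). h x \<in> ?Y}" .
    moreover have eqX: "{x \<in> topspace (zariski (affine_set m A)). h x \<in> ?Y} = ?X"
      using hXY unfolding topspace_zariski_affine_set by blast
    ultimately have "restrict (restrict (\<lambda>x. x i / 1) ?Y \<circ> h) ?X \<in> sections (affine_set m A) ?X"
      unfolding eqX by simp
    then obtain P Q where PQ: "polynomial_fun m P" "polynomial_fun m Q" "\<forall>x\<in>?X. Q x \<noteq> 0"
      "restrict (restrict (\<lambda>x. x i / 1) ?Y \<circ> h) ?X = restrict (\<lambda>x. P x / Q x) ?X"
      unfolding affine_set_def by auto
    have eq: "P x / Q x = h x i" if "x \<in> ?X" for x
      using fun_cong[OF PQ(4), of x] hXY[OF that] that by (simp add: restrict_def split: if_splits)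
    have "continuous_map (subtopology (Euclidean_space m) A) euclideanreal (\<lambda>x. P x / Q x)"
      using PQ(1-3)
      by (intro continuous_map_real_divide continuous_map_from_subtopology
          polynomial_fun_continuous) auto
    then show ?thesis
      by (rule continuous_map_eq) (use eq in auto)
  qed
  have "continuous_map (subtopology (Euclidean_space m) A) (Euclidean_space n)
      (\<lambda>x i. if i < n then h x i else 0)"
    using cont by (simp add: continuous_map_componentwise_Euclidean_space)
  then show ?thesis
  proof (rule continuous_map_eq)
    fix x assume "x \<in> topspace (subtopology (Euclidean_space m) A)"
    then have "h x \<in> topspace (Euclidean_space n)" using hXY by auto
    then show "(\<lambda>i. if i < n then h x i else 0) = h x"
      by (auto simp: topspace_Euclidean_space)
  qed
qed

lemma pullback_le:
  assumes \<phi>: "regular_isomorphism X (affine_set m A) \<phi>"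
    and \<phi>': "regular_isomorphism X (affine_set n B) \<phi>'"
    and S: "openin (pullback_topology (topspace (zariski X)) \<phi>' (Euclidean_space n)) S"
  shows "openin (pullback_topology (topspace (zariski X)) \<phi> (Euclidean_space m)) S"
proof -
  let ?X = "topspace (zariski X)"
  obtain \<psi> where \<psi>: "regular_map (affine_set m A) X \<psi>" "\<forall>x\<in>?X. \<psi> (\<phi> x) = x"
    using \<phi> unfolding regular_isomorphism_def by blast
  have \<phi>A: "\<phi> x \<in> topspace (Euclidean_space m) \<inter> A" if "x \<in> ?X" for x
    using regular_map_into[of X "affine_set m A" \<phi> x] \<phi> that
    by (simp add: regular_isomorphism_def topspace_zariski_affine_set)
  have "regular_map (affine_set m A) (affine_set n B) (\<phi>' \<circ> \<psi>)"
    using \<psi>(1) \<phi>' regular_map_comp unfolding regular_isomorphism_def by blast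
  then have cont: "continuous_map (subtopology (Euclidean_space m) A) (Euclidean_space n) (\<phi>' \<circ> \<psi>)"
    by (rule regular_map_affine_set_continuous)
  obtain V where V: "openin (Euclidean_space n) V" "S = \<phi>' -` V \<inter> ?X"
    using S unfolding openin_pullback_topology by blast
  obtain O' where O': "openin (Euclidean_space m) O'"
    "{y \<in> topspace (Euclidean_space m) \<inter> A. (\<phi>' \<circ> \<psi>) y \<in> V} = O' \<inter> A"
    using openin_continuous_map_preimage[OF cont V(1)]
    unfolding openin_subtopology topspace_subtopology by blast
  have "x \<in> S \<longleftrightarrow> x \<in> \<phi> -` O' \<inter> ?X" for x
  proof (cases "x \<in> ?X")
    case True
    have "x \<in> S \<longleftrightarrow> \<phi> x \<in> {y \<in> topspace (Euclidean_space m) \<inter> A. (\<phi>' \<circ> \<psi>) y \<in> V}"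
      using True V(2) \<phi>A \<psi>(2) by auto
    also have "\<dots> \<longleftrightarrow> x \<in> \<phi> -` O' \<inter> ?X"
      unfolding O'(2) using True \<phi>A by auto
    finally show ?thesis .
  qed (use V(2) in auto)
  then have "S = \<phi> -` O' \<inter> ?X" by blast
  then show ?thesis
    using O'(1) unfolding openin_pullback_topology by blast
qed

lemma euclidean_topology_eq:
  assumes "closedin (zariski_topology n) A" and "regular_isomorphism X (affine_set n A) \<phi>"
  shows "euclidean_topology X = pullback_topology (topspace (zariski X)) \<phi> (Euclidean_space n)"
  unfolding euclidean_topology_def
proof (rule the_equality)
  fix T
  assume "\<exists>n A \<phi>. closedin (zariski_topology n) A \<and> regular_isomorphism X (affine_set n A) \<phi> \<and>
        T = pullback_topology (topspace (zariski X)) \<phi> (Euclidean_space n)"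
  then show "T = pullback_topology (topspace (zariski X)) \<phi> (Euclidean_space n)"
    unfolding topology_eq using pullback_le assms(2) by blast
qed (use assms in blast)

section \<open>Retract rationality\<close>

definition globally_retract_rational :: "'a function_space \<Rightarrow> bool" where
  "globally_retract_rational V \<longleftrightarrow>
     (\<exists>n W i r. openin (zariski_topology n) W \<and>
        regular_map V (affine_set n W) i \<and> regular_map (affine_set n W) V r \<and>
        (\<forall>v\<in>topspace (zariski V). r (i v) = v))"

definition uniformly_retract_rational :: "'a function_space \<Rightarrow> bool" where
  "uniformly_retract_rational Y \<longleftrightarrow>
     (\<forall>y\<in>topspace (zariski Y). \<exists>V. openin (zariski Y) V \<and> y \<in> V \<and>
        globally_retract_rational (induced Y V))"

end

(* The proof works with Zariski closed sets A in R^m and B in R^p.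

   Extending from the compact set Z: if P is a polynomial that is positive on R^n, then minimising
   sum x_i^(2D) + t P gives an algebraic function of t tending to infinity, hence growing at least
   like a power of t; this yields a Lojasiewicz lower bound for P.  Consequently Z is the zero set of
   a polynomial bounded away from 0 at infinity, and every regular function on Z with values in
   (-1,1) extends to a regular function on R^m with values in (-1,1).

   Moving inside B: a globally retract rational open piece of B is a regular retract rho of a
   Zariski open subset of R^p.  The sprays s(y,v) = rho(y + k(y) v), with k vanishing to high order
   where rho is undefined, are regular for all y in B and |v| < 1, so F -> s(F,v) preserves
   extendability from Z.  Finitely many sprays, composed along a partition of unity consisting of
   regular functions of the target x, move a point y of B to every nearby x in B, with velocities v
   that are regular functions of (x,y), also for x outside B.

   Following the homotopy in small steps, each intermediate map is approximated by a polynomial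
   map, which serves as the target x; in the last step the target is f itself. *)
theory Submission
  imports Defs
begin

text \<open>A regular function on \<open>Z\<close> with real values extends to \<open>A\<close> by
  an explicit formula, but extending the coordinates of a map into \<open>B\<close> gives a map that
  leaves \<open>B\<close>. So only velocities are extended, and a spray turns them into a motion
  inside \<open>B\<close>. The spray accepts a velocity only if it is bounded by 1 on all of
  \<open>A\<close>, which need not be compact although \<open>Z\<close> is; this is why control at
  infinity is needed.

  The spray of one chart stands still where its \<open>E\<close> vanishes and cannot carry
  \<open>y\<close> to \<open>x\<close> alone. The displacement is therefore written with weight 1 =
  sum of \<open>E^4 / S\<close>, where \<open>S\<close> is the sum of \<open>E^4\<close> over
  finitely many charts, and every chart removes its own summand from the weight of what is left.

  For a target in \<open>B\<close> the composed motion ends exactly at the target. Hence errors do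
  not accumulate along the homotopy: a map that is merely within a fixed distance of the next one
  suffices as a starting point.\<close>

abbreviation rn :: "nat \<Rightarrow> (nat \<Rightarrow> real) set" where
  "rn n \<equiv> topspace (Euclidean_space n)"

lemma rn_iff: "x \<in> rn n \<longleftrightarrow> (\<forall>i\<ge>n. x i = 0)"
  by (simp add: topspace_Euclidean_space)

section \<open>Closure properties of polynomial functions\<close>

declare polynomial_fun.intros [intro]

lemma polynomial_fun_scale: "polynomial_fun n P \<Longrightarrow> polynomial_fun n (\<lambda>x. c * P x)"
  by (intro polynomial_fun.mult polynomial_fun.const)

lemma polynomial_fun_minus: "polynomial_fun n P \<Longrightarrow> polynomial_fun n (\<lambda>x. - P x)"
  using polynomial_fun_scale[of n P "-1"] by simp

lemma polynomial_fun_diff: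
  "polynomial_fun n P \<Longrightarrow> polynomial_fun n Q \<Longrightarrow> polynomial_fun n (\<lambda>x. P x - Q x)"
  using polynomial_fun.add[OF _ polynomial_fun_minus, of n P Q] by simp

lemma polynomial_fun_power: "polynomial_fun n P \<Longrightarrow> polynomial_fun n (\<lambda>x. P x ^ k)"
  by (induction k) auto

lemma polynomial_fun_sum:
  "(\<And>i. i \<in> I \<Longrightarrow> polynomial_fun n (P i)) \<Longrightarrow> polynomial_fun n (\<lambda>x. \<Sum>i\<in>I. P i x)"
  by (induction I rule: infinite_finite_induct) auto

lemma polynomial_fun_prod:
  "(\<And>i. i \<in> I \<Longrightarrow> polynomial_fun n (P i)) \<Longrightarrow> polynomial_fun n (\<lambda>x. \<Prod>i\<in>I. P i x)"
  by (induction I rule: infinite_finite_induct) auto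

lemmas polynomial_fun_intros =
  polynomial_fun.intros polynomial_fun_scale polynomial_fun_minus polynomial_fun_diff
  polynomial_fun_power polynomial_fun_sum polynomial_fun_prod

lemma polynomial_fun_mono: "polynomial_fun m P \<Longrightarrow> m \<le> n \<Longrightarrow> polynomial_fun n P"
  by (induction rule: polynomial_fun.induct) auto

lemma polynomial_fun_cong:
  "polynomial_fun n P \<Longrightarrow> (\<And>i. i < n \<Longrightarrow> x i = y i) \<Longrightarrow> P x = P y"
  by (induction rule: polynomial_fun.induct) auto

section \<open>Hilbert's basis theorem for polynomial functions\<close>

text \<open>The ideal generated by \<open>A\<close> in the ring of polynomial functions, built one
  summand at a time so that its closure properties follow by rule induction.\<close>

inductive_set ideal_gen ::
    "nat \<Rightarrow> ((nat \<Rightarrow> real) \<Rightarrow> real) set \<Rightarrow> ((nat \<Rightarrow> real) \<Rightarrow> real) set" for n A where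
  zero: "(\<lambda>x. 0) \<in> ideal_gen n A"
| step: "polynomial_fun n u \<Longrightarrow> g \<in> A \<Longrightarrow> h \<in> ideal_gen n A \<Longrightarrow> (\<lambda>x. u x * g x + h x) \<in> ideal_gen n A"

lemma ideal_gen_base: "g \<in> A \<Longrightarrow> g \<in> ideal_gen n A"
  using ideal_gen.step[OF polynomial_fun.const[of n 1] _ ideal_gen.zero, of g A] by simp

lemma ideal_gen_add:
  assumes "h \<in> ideal_gen n A" "k \<in> ideal_gen n A"
  shows "(\<lambda>x. h x + k x) \<in> ideal_gen n A"
  using assms
proof induction
  case (step u g h)
  then show ?case using ideal_gen.step[OF step(1,2) step(4)] by (simp add: add.assoc)
qed simp

lemma ideal_gen_mult:
  assumes "h \<in> ideal_gen n A" "polynomial_fun n v"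
  shows "(\<lambda>x. v x * h x) \<in> ideal_gen n A"
  using assms
proof induction
  case (step u g h)
  have "(\<lambda>x. (v x * u x) * g x + v x * h x) \<in> ideal_gen n A"
    using step by (intro ideal_gen.step) auto
  then show ?case by (simp add: algebra_simps)
qed (simp add: ideal_gen.zero)

lemma ideal_gen_polynomial:
  "h \<in> ideal_gen n A \<Longrightarrow> (\<And>g. g \<in> A \<Longrightarrow> polynomial_fun n g) \<Longrightarrow> polynomial_fun n h"
proof (induction rule: ideal_gen.induct)
  case (step u g h)
  then show ?case by (intro polynomial_fun.add polynomial_fun.mult) simp_all
qed (rule polynomial_fun.const)

lemma ideal_gen_trans:
  assumes "h \<in> ideal_gen n A" "A \<subseteq> ideal_gen n A'"
  shows "h \<in> ideal_gen n A'"
  using assms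
proof induction
  case (step u g h)
  then have "(\<lambda>x. u x * g x) \<in> ideal_gen n A'" by (blast intro: ideal_gen_mult)
  from ideal_gen_add[OF this step(4)] step(5) show ?case by simp
qed (rule ideal_gen.zero)

lemma ideal_gen_mono: "A \<subseteq> A' \<Longrightarrow> ideal_gen n A \<subseteq> ideal_gen n A'"
  using ideal_gen_trans ideal_gen_base by blast

lemma ideal_gen_finite:
  assumes "h \<in> ideal_gen n A"
  shows "\<exists>A0. finite A0 \<and> A0 \<subseteq> A \<and> h \<in> ideal_gen n A0"
  using assms
proof induction
  case (step u g h)
  then obtain A0 where A0: "finite A0" "A0 \<subseteq> A" "h \<in> ideal_gen n A0" by blast
  have "h \<in> ideal_gen n (insert g A0)" using A0(3) ideal_gen_mono[of A0 "insert g A0"] by blast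
  then have "(\<lambda>x. u x * g x + h x) \<in> ideal_gen n (insert g A0)"
    by (intro ideal_gen.step step) auto
  then show ?case using A0 step(2) by (intro exI[of _ "insert g A0"]) auto
qed (auto intro: ideal_gen.zero)

lemma ideal_gen_zero:
  "h \<in> ideal_gen n A \<Longrightarrow> (\<And>g. g \<in> A \<Longrightarrow> g x = 0) \<Longrightarrow> h x = 0"
  by (induction rule: ideal_gen.induct) auto

text \<open>Dependent choice in the form used in Hilbert's argument: the k-th term is constrained
  only by the set of the earlier terms.\<close>

lemma exists_sequence_of_images:
  assumes "\<And>A. finite A \<Longrightarrow> \<exists>h. R A h"
  shows "\<exists>f :: nat \<Rightarrow> 'a. \<forall>k. R (f ` {..<k}) (f k)"
proof (rule dependent_wf_choice[of less_than "\<lambda>f k h. R (f ` {..<k}) h"])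
  show "R (f ` {..<x}) r = R (g ` {..<x}) r" if "\<And>z. (z, x) \<in> less_than \<Longrightarrow> f z = g z"
    for f g :: "nat \<Rightarrow> 'a" and x r
  proof -
    have "f ` {..<x} = g ` {..<x}" using that by (intro image_cong) auto
    then show ?thesis by simp
  qed
qed (use assms in auto)

section \<open>Expansion in the last variable\<close>

text \<open>The bound is strict: the degree in \<open>x n\<close> is less than \<open>d\<close>, so
  \<open>d = 0\<close> describes the zero function. The coefficients involve the first
  \<open>n\<close> variables only. Any expansion of this kind will do; the coefficients are chosen,
  not canonical.\<close>

definition deg_bound :: "nat \<Rightarrow> nat \<Rightarrow> ((nat \<Rightarrow> real) \<Rightarrow> real) \<Rightarrow> bool" where
  "deg_bound n d F \<longleftrightarrow> (\<exists>a. (\<forall>j. polynomial_fun n (a j)) \<and> F = (\<lambda>x. \<Sum>j<d. a j x * x n ^ j))"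

lemma polynomial_fun_if:
  "polynomial_fun n P \<Longrightarrow> polynomial_fun n (\<lambda>x. if b then P x else 0)"
  by (cases b) auto

lemma deg_bound_add:
  assumes "deg_bound n d F" "deg_bound n d G"
  shows "deg_bound n d (\<lambda>x. F x + G x)"
proof -
  obtain a b where "\<forall>j. polynomial_fun n (a j)" "F = (\<lambda>x. \<Sum>j<d. a j x * x n ^ j)"
    "\<forall>j. polynomial_fun n (b j)" "G = (\<lambda>x. \<Sum>j<d. b j x * x n ^ j)"
    using assms unfolding deg_bound_def by blast
  then show ?thesis unfolding deg_bound_def
    by (intro exI[of _ "\<lambda>j x. a j x + b j x"]) (auto simp: sum.distrib algebra_simps)
qed

lemma deg_bound_mono:
  assumes "deg_bound n d F" "d \<le> e"
  shows "deg_bound n e F"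
proof -
  obtain a where a: "\<forall>j. polynomial_fun n (a j)" "F = (\<lambda>x. \<Sum>j<d. a j x * x n ^ j)"
    using assms unfolding deg_bound_def by blast
  have "(\<Sum>j<d. a j x * x n ^ j) = (\<Sum>j<e. (if j < d then a j x else 0) * x n ^ j)" for x
    using assms(2) by (intro sum.mono_neutral_cong_left) auto
  then show ?thesis unfolding deg_bound_def a(2)
    by (intro exI[of _ "\<lambda>j x. if j < d then a j x else 0"]) (use a(1) in \<open>auto intro: polynomial_fun_if\<close>)
qed

lemma deg_bound_term:
  assumes "polynomial_fun n u" "e < d"
  shows "deg_bound n d (\<lambda>x. u x * x n ^ e)"
proof -
  have "(\<Sum>j<d. (if j = e then u x else 0) * x n ^ j) = u x * x n ^ e" for x
    using sum.remove[of "{..<d}" e "\<lambda>j. (if j = e then u x else 0) * x n ^ j"] assms(2) by simp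
  then show ?thesis unfolding deg_bound_def
    by (intro exI[of _ "\<lambda>j x. if j = e then u x else 0"]) (use assms(1) in \<open>auto intro: polynomial_fun_if\<close>)
qed

lemma deg_bound_zero: "deg_bound n d (\<lambda>x. 0)"
  unfolding deg_bound_def by (intro exI[of _ "\<lambda>j x. 0"]) auto

lemma deg_bound_sum:
  "(\<And>i. i \<in> I \<Longrightarrow> deg_bound n d (F i)) \<Longrightarrow> deg_bound n d (\<lambda>x. \<Sum>i\<in>I. F i x)"
  by (induction I rule: infinite_finite_induct) (auto intro: deg_bound_zero deg_bound_add)

lemma deg_bound_mult_term:
  assumes "deg_bound n d F" "polynomial_fun n u"
  shows "deg_bound n (d + e) (\<lambda>x. u x * x n ^ e * F x)"
proof -
  obtain a where a: "\<forall>j. polynomial_fun n (a j)" "F = (\<lambda>x. \<Sum>j<d. a j x * x n ^ j)"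
    using assms unfolding deg_bound_def by blast
  have "deg_bound n (d + e) (\<lambda>x. \<Sum>j<d. (u x * a j x) * x n ^ (e + j))"
    using a assms(2) by (intro deg_bound_sum deg_bound_term) auto
  moreover have "(\<lambda>x. \<Sum>j<d. (u x * a j x) * x n ^ (e + j)) = (\<lambda>x. u x * x n ^ e * F x)"
    unfolding a(2) by (simp add: sum_distrib_left power_add mult_ac)
  ultimately show ?thesis by simp
qed

lemma deg_bound_mult:
  assumes "deg_bound n d F" "deg_bound n e G"
  shows "deg_bound n (d + e) (\<lambda>x. F x * G x)"
proof -
  obtain a where a: "\<forall>j. polynomial_fun n (a j)" "F = (\<lambda>x. \<Sum>j<d. a j x * x n ^ j)"
    using assms unfolding deg_bound_def by blast
  have "deg_bound n (d + e) (\<lambda>x. a j x * x n ^ j * G x)" if "j < d" for j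
    using deg_bound_mono[OF deg_bound_mult_term[OF assms(2), of "a j" j], of "d+e"] a(1) that by auto
  then have "deg_bound n (d + e) (\<lambda>x. \<Sum>j<d. a j x * x n ^ j * G x)"
    by (intro deg_bound_sum) auto
  then show ?thesis unfolding a(2) by (simp add: sum_distrib_right)
qed

lemma polynomial_fun_deg_bound:
  assumes "polynomial_fun (Suc n) F"
  shows "\<exists>d. deg_bound n d F"
  using assms
proof induction
  case (const c)
  show ?case using deg_bound_term[OF polynomial_fun.const[of n c], of 0 1] by auto
next
  case (coord i)
  show ?case
  proof (cases "i = n")
    case True
    then show ?thesis using deg_bound_term[OF polynomial_fun.const[of n 1], of 1 2] by auto
  next
    case False
    then show ?thesis using deg_bound_term[OF polynomial_fun.coord[of i n], of 0 1] coord by auto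
  qed
next
  case (add P Q)
  then obtain d e where "deg_bound n d P" "deg_bound n e Q" by blast
  then have "deg_bound n (max d e) P" "deg_bound n (max d e) Q" using deg_bound_mono by auto
  then show ?case using deg_bound_add by blast
next
  case (mult P Q)
  then show ?case using deg_bound_mult by blast
qed

lemma deg_bound_Suc_split:
  assumes "deg_bound n (Suc d) F"
  shows "\<exists>a G. polynomial_fun n a \<and> deg_bound n d G \<and> F = (\<lambda>x. a x * x n ^ d + G x)"
proof -
  obtain a where a: "\<forall>j. polynomial_fun n (a j)" "F = (\<lambda>x. \<Sum>j<Suc d. a j x * x n ^ j)"
    using assms unfolding deg_bound_def by blast
  then show ?thesis
    by (intro exI[of _ "a d"] exI[of _ "\<lambda>x. \<Sum>j<d. a j x * x n ^ j"])
      (auto simp: deg_bound_def add.commute)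
qed

text \<open>Multiplying \<open>h k\<close> by \<open>x n ^ (d - deg k)\<close> moves its leading
  term to degree \<open>d\<close>. Hence every element of the ideal of the leading coefficients is
  the coefficient of \<open>x n ^ d\<close> in some element of the ideal of the \<open>h k\<close>,
  up to terms of lower degree.\<close>

lemma ideal_gen_lift:
  assumes "a \<in> ideal_gen n (lc ` {..<N})"
    and "\<And>k. k < N \<Longrightarrow> deg k \<le> d"
    and "\<And>k. k < N \<Longrightarrow> deg_bound n (deg k) (G k) \<and> h k = (\<lambda>x. lc k x * x n ^ deg k + G k x)"
  shows "\<exists>H\<in>ideal_gen (Suc n) (h ` {..<N}). \<exists>R. deg_bound n d R \<and> H = (\<lambda>x. a x * x n ^ d + R x)"
  using assms(1)
proof induction
  case zero
  show ?case by (rule bexI[OF _ ideal_gen.zero]) (auto intro: deg_bound_zero)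
next
  case (step u g a)
  then obtain k H R where k: "k < N" "g = lc k" and H: "H \<in> ideal_gen (Suc n) (h ` {..<N})"
    "deg_bound n d R" "H = (\<lambda>x. a x * x n ^ d + R x)" by blast
  let ?v = "\<lambda>x. u x * x n ^ (d - deg k)"
  have v: "polynomial_fun (Suc n) ?v"
    using polynomial_fun_mono[OF step(1), of "Suc n"] by (intro polynomial_fun.mult polynomial_fun_power polynomial_fun.coord) auto
  have "(\<lambda>x. ?v x * h k x + H x) \<in> ideal_gen (Suc n) (h ` {..<N})"
    using k v H by (intro ideal_gen.step) auto
  moreover have "deg_bound n d (\<lambda>x. ?v x * G k x + R x)"
    using deg_bound_mult_term[of n "deg k" "G k" u "d - deg k"] assms(2,3)[OF k(1)] step(1) H(2)
    by (intro deg_bound_add) auto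
  moreover have "(\<lambda>x. ?v x * h k x + H x) =
      (\<lambda>x. (u x * g x + a x) * x n ^ d + (?v x * G k x + R x))"
  proof
    fix x :: "nat \<Rightarrow> real"
    have "x n ^ d = x n ^ (d - deg k) * x n ^ deg k"
      using assms(2)[OF k(1)] power_add[of "x n" "d - deg k" "deg k"] by simp
    then show "?v x * h k x + H x = (u x * g x + a x) * x n ^ d + (?v x * G k x + R x)"
      using assms(3)[OF k(1)] H(3) k(2) by (simp add: algebra_simps)
  qed
  ultimately show ?case by blast
qed

text \<open>Hilbert's argument, by induction on the number of variables. Without a finite generating
  set one can choose, again and again, an element of least degree in the last variable outside the
  ideal of the earlier choices. The leading coefficients live in one variable fewer, so one of them
  is a combination of the earlier ones; cancelling it gives an element of smaller degree that is
  still outside, a contradiction. The finitely many generators of the ideal are then expressed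
  through finitely many elements of \<open>S\<close>.\<close>

theorem polynomial_ideal_finitely_generated:
  assumes "\<And>P. P \<in> S \<Longrightarrow> polynomial_fun n P"
  shows "\<exists>S0. finite S0 \<and> S0 \<subseteq> S \<and> S \<subseteq> ideal_gen n S0"
  using assms
proof (induction n arbitrary: S)
  case 0
  have const: "P x = P y" if "P \<in> S" for P x y
    using polynomial_fun_cong[OF 0[OF that]] by simp
  show ?case
  proof (cases "\<exists>P\<in>S. P (\<lambda>_. 0) \<noteq> 0")
    case True
    then obtain P where P: "P \<in> S" "P (\<lambda>_. 0) \<noteq> 0" by blast
    have "Q \<in> ideal_gen 0 {P}" if "Q \<in> S" for Q
    proof -
      have "(\<lambda>x. (Q (\<lambda>_. 0) / P (\<lambda>_. 0)) * P x) \<in> ideal_gen 0 {P}"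
        by (rule ideal_gen_mult) (auto intro: ideal_gen_base)
      moreover have "(\<lambda>x. (Q (\<lambda>_. 0) / P (\<lambda>_. 0)) * P x) = Q"
      proof
        fix x show "(Q (\<lambda>_. 0) / P (\<lambda>_. 0)) * P x = Q x"
          using const[OF that, of x "\<lambda>_. 0"] const[OF P(1), of x "\<lambda>_. 0"] P(2) by simp
      qed
      ultimately show ?thesis by simp
    qed
    then show ?thesis using P(1) by (intro exI[of _ "{P}"]) auto
  next
    case False
    have "Q = (\<lambda>x. 0)" if "Q \<in> S" for Q
    proof
      fix x show "Q x = 0" using False const[OF that, of x "\<lambda>_. 0"] that by simp
    qed
    then have "S \<subseteq> ideal_gen 0 {}" using ideal_gen.zero by blast
    then show ?thesis by blast
  qed
next
  case (Suc n)
  let ?I = "ideal_gen (Suc n) S"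
  have Ipoly: "polynomial_fun (Suc n) h" if "h \<in> ?I" for h
    using ideal_gen_polynomial[OF that] Suc.prems by blast
  have "\<exists>A. finite A \<and> A \<subseteq> ?I \<and> ?I \<subseteq> ideal_gen (Suc n) A"
  proof (rule ccontr)
    assume nofg: "\<not> ?thesis"
    define dg where "dg h = (LEAST d. deg_bound n d h)" for h
    have dgb: "deg_bound n (dg h) h" if "h \<in> ?I" for h
      using polynomial_fun_deg_bound[OF Ipoly[OF that]] unfolding dg_def by (rule LeastI_ex)
    \<comment> \<open>The premise \<open>A \<subseteq> ?I\<close> makes \<open>R A\<close>
      satisfiable for every finite \<open>A\<close>, as the dependent choice demands. It is
      discharged afterwards, since all chosen \<open>h k\<close> lie in \<open>?I\<close>.\<close>
    define R :: "((nat \<Rightarrow> real) \<Rightarrow> real) set \<Rightarrow> ((nat \<Rightarrow> real) \<Rightarrow> real) \<Rightarrow> bool" where "R A h \<longleftrightarrow> (A \<subseteq> ?I \<longrightarrow> h \<in> ?I - ideal_gen (Suc n) A \<and>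
        (\<forall>k \<in> ?I - ideal_gen (Suc n) A. dg h \<le> dg k))" for A h
    have RD: "h \<in> ?I" "h \<notin> ideal_gen (Suc n) A"
        "k \<in> ?I \<Longrightarrow> k \<notin> ideal_gen (Suc n) A \<Longrightarrow> dg h \<le> dg k"
      if "R A h" "A \<subseteq> ?I" for A h k using that unfolding R_def by simp_all
    have "\<exists>h. R A h" if "finite A" for A
    proof (cases "A \<subseteq> ?I")
      case True
      then have "\<not> ?I \<subseteq> ideal_gen (Suc n) A" using nofg that by simp
      then obtain h0 where h0: "h0 \<in> ?I - ideal_gen (Suc n) A" by (meson DiffI subsetI)
      obtain h where "h \<in> ?I - ideal_gen (Suc n) A"
        "\<forall>k. k \<in> ?I - ideal_gen (Suc n) A \<longrightarrow> dg h \<le> dg k"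
        using ex_has_least_nat[of "\<lambda>h. h \<in> ?I - ideal_gen (Suc n) A" h0 dg, OF h0]
        by (elim exE conjE) (rule that)
      then show ?thesis
        unfolding R_def by (intro exI[of _ h]) simp
    qed (simp add: R_def)
    then have "\<exists>h::nat \<Rightarrow> _. \<forall>k. R (h ` {..<k}) (h k)" by (rule exists_sequence_of_images)
    then obtain h :: "nat \<Rightarrow> (nat \<Rightarrow> real) \<Rightarrow> real" where h: "\<And>k. R (h ` {..<k}) (h k)"
      by blast
    have hI: "h k \<in> ?I" for k
    proof (induction k rule: less_induct)
      case (less k)
      then show ?case by (intro RD(1)[OF h]) blast
    qed
    then have him: "h ` {..<k} \<subseteq> ?I" for k by blast
    have hn: "h k \<notin> ideal_gen (Suc n) (h ` {..<k})" for k by (rule RD(2)[OF h him])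
    have hmin: "dg (h k) \<le> dg q" if "q \<in> ?I" "q \<notin> ideal_gen (Suc n) (h ` {..<k})" for k q
      using that by (rule RD(3)[OF h him])
    have hmono: "dg (h k) \<le> dg (h N)" if "k \<le> N" for k N
    proof (rule hmin[OF hI])
      have "h ` {..<k} \<subseteq> h ` {..<N}" using that by auto
      from ideal_gen_mono[OF this] show "h N \<notin> ideal_gen (Suc n) (h ` {..<k})" using hn[of N] by blast
    qed
    have pos: "dg (h k) > 0" for k
    proof (rule ccontr)
      assume "\<not> ?thesis"
      then have "deg_bound n 0 (h k)" using dgb[OF hI, of k] by simp
      then have "h k = (\<lambda>x. 0)" by (auto simp: deg_bound_def)
      then show False using hn[of k] ideal_gen.zero by simp
    qed
    \<comment> \<open>\<open>dg\<close> is a strict bound, and positive because the zero function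
      lies in every ideal; \<open>dd k\<close> is the exponent of the leading term.\<close>
    define dd where "dd k = dg (h k) - 1" for k
    have dd: "dg (h k) = Suc (dd k)" for k using pos[of k] by (simp add: dd_def)
    have "\<forall>k. \<exists>a G. polynomial_fun n a \<and> deg_bound n (dd k) G \<and> h k = (\<lambda>x. a x * x n ^ dd k + G x)"
    proof
      fix k
      have "deg_bound n (Suc (dd k)) (h k)" using dgb[OF hI, of k] dd[of k] by simp
      then show "\<exists>a G. polynomial_fun n a \<and> deg_bound n (dd k) G \<and> h k = (\<lambda>x. a x * x n ^ dd k + G x)"
        by (rule deg_bound_Suc_split)
    qed
    then obtain lc G where lc: "\<And>k. polynomial_fun n (lc k)" "\<And>k. deg_bound n (dd k) (G k)"
      "\<And>k. h k = (\<lambda>x. lc k x * x n ^ dd k + G k x)" unfolding choice_iff by blast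
    obtain S0 where S0: "finite S0" "S0 \<subseteq> range lc" "range lc \<subseteq> ideal_gen n S0"
      using Suc.IH[of "range lc"] lc(1) by blast
    obtain K where K: "finite K" "S0 = lc ` K"
      using S0(1,2) by (metis finite_subset_image)
    \<comment> \<open>\<open>N\<close> exceeds all the indices whose leading coefficients generate
      the ideal of all leading coefficients.\<close>
    define N where "N = Suc (Max (insert 0 K))"
    have "S0 \<subseteq> lc ` {..<N}" using K by (auto simp: N_def less_Suc_eq_le)
    then have "lc N \<in> ideal_gen n (lc ` {..<N})"
      using S0(3) ideal_gen_mono[of S0 "lc ` {..<N}"] by blast
    moreover have "dd k \<le> dd N" if "k < N" for k
      using hmono[of k N] that by (simp add: dd)
    moreover have "deg_bound n (dd k) (G k) \<and> h k = (\<lambda>x. lc k x * x n ^ dd k + G k x)" for k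
      using lc(2,3) by blast
    ultimately have "\<exists>H\<in>ideal_gen (Suc n) (h ` {..<N}). \<exists>R. deg_bound n (dd N) R \<and>
        H = (\<lambda>x. lc N x * x n ^ dd N + R x)"
      by (rule ideal_gen_lift)
    then obtain H R where H: "H \<in> ideal_gen (Suc n) (h ` {..<N})" "deg_bound n (dd N) R"
      "H = (\<lambda>x. lc N x * x n ^ dd N + R x)" by blast
    define q where "q = (\<lambda>x. h N x + (-1) * H x)"
    have sub: "ideal_gen (Suc n) (h ` {..<N}) \<subseteq> ?I"
      using ideal_gen_trans[of _ "Suc n" "h ` {..<N}" S] hI by blast
    have "(\<lambda>x. (-1) * H x) \<in> ?I"
      using H(1) sub by (intro ideal_gen_mult) auto
    then have qI: "q \<in> ?I" unfolding q_def by (rule ideal_gen_add[OF hI])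
    have "q \<notin> ideal_gen (Suc n) (h ` {..<N})"
    proof
      assume "q \<in> ideal_gen (Suc n) (h ` {..<N})"
      from ideal_gen_add[OF this H(1)] have "h N \<in> ideal_gen (Suc n) (h ` {..<N})"
        by (simp add: q_def)
      then show False using hn by blast
    qed
    then have "dg (h N) \<le> dg q" using hmin qI by blast
    moreover have "deg_bound n (dd N) (\<lambda>x. G N x + (-1) * x n ^ 0 * R x)"
      using deg_bound_mult_term[OF H(2) polynomial_fun.const[of n "-1"], of 0] lc(2)
      by (intro deg_bound_add) auto
    then have "deg_bound n (dd N) q"
      unfolding q_def H(3) lc(3)[of N] by (simp add: algebra_simps)
    then have "dg q \<le> dd N" unfolding dg_def by (rule Least_le)
    ultimately show False using dd[of N] by simp
  qed
  then obtain A where A: "finite A" "A \<subseteq> ?I" "?I \<subseteq> ideal_gen (Suc n) A" by blast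
  have "\<forall>a\<in>A. \<exists>T. finite T \<and> T \<subseteq> S \<and> a \<in> ideal_gen (Suc n) T"
    using ideal_gen_finite A(2) by blast
  then obtain T where T: "\<And>a. a \<in> A \<Longrightarrow> finite (T a) \<and> T a \<subseteq> S \<and> a \<in> ideal_gen (Suc n) (T a)"
    by metis
  let ?S0 = "\<Union>a\<in>A. T a"
  have "A \<subseteq> ideal_gen (Suc n) ?S0"
  proof
    fix a assume "a \<in> A"
    then show "a \<in> ideal_gen (Suc n) ?S0" using T[of a] ideal_gen_mono[of "T a" ?S0 "Suc n"] by blast
  qed
  then have "?I \<subseteq> ideal_gen (Suc n) ?S0" using A(3) ideal_gen_trans by blast
  moreover have "S \<subseteq> ?I" using ideal_gen_base by blast
  ultimately show ?case using A(1) T by (intro exI[of _ ?S0]) auto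
qed

text \<open>Finitely many of the equations generate all the others, and over the reals the sum of
  their squares vanishes exactly where each of them does.\<close>

corollary closedin_zariski_single_equation:
  assumes "closedin (zariski_topology n) A"
  shows "\<exists>\<phi>. polynomial_fun n \<phi> \<and> (\<forall>x. \<phi> x \<ge> 0) \<and> A = {x \<in> rn n. \<phi> x = 0}"
proof -
  obtain S where S: "\<forall>P\<in>S. polynomial_fun n P" "A = zero_set n S"
    using assms by (auto simp: closedin_zariski_topology)
  obtain S0 where S0: "finite S0" "S0 \<subseteq> S" "S \<subseteq> ideal_gen n S0"
    using polynomial_ideal_finitely_generated[of S n] S(1) by blast
  let ?p = "\<lambda>x. \<Sum>P\<in>S0. (P x)\<^sup>2"
  have "?p x = 0 \<longleftrightarrow> (\<forall>P\<in>S0. P x = 0)" for x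
    using S0(1) by (simp add: sum_nonneg_eq_0_iff)
  moreover have "(\<forall>P\<in>S0. P x = 0) \<longleftrightarrow> (\<forall>P\<in>S. P x = 0)" for x
    using S0(2,3) ideal_gen_zero[of _ n S0 x] by blast
  ultimately have "A = {x \<in> rn n. ?p x = 0}" unfolding S(2) zero_set_def by auto
  moreover have "polynomial_fun n ?p"
    using S(1) S0(2) by (intro polynomial_fun_intros) auto
  ultimately show ?thesis by (intro exI[of _ ?p]) (auto intro: sum_nonneg)
qed

section \<open>Linear combinations and linear dependence of real functions\<close>

text \<open>Equality is required on \<open>S\<close> only. When \<open>S\<close> consists of
  critical points, the critical equations may be used to find linear relations.\<close>

definition lincomb :: "'j set \<Rightarrow> ('j \<Rightarrow> 's \<Rightarrow> real) \<Rightarrow> 's set \<Rightarrow> ('s \<Rightarrow> real) \<Rightarrow> bool" where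
  "lincomb J \<phi> S F \<longleftrightarrow> (\<exists>a. \<forall>s\<in>S. F s = (\<Sum>j\<in>J. a j * \<phi> j s))"

lemma lincomb_add:
  assumes "lincomb J \<phi> S F" "lincomb J \<phi> S G"
  shows "lincomb J \<phi> S (\<lambda>s. F s + G s)"
proof -
  obtain a b where "\<forall>s\<in>S. F s = (\<Sum>j\<in>J. a j * \<phi> j s)" "\<forall>s\<in>S. G s = (\<Sum>j\<in>J. b j * \<phi> j s)"
    using assms unfolding lincomb_def by blast
  then show ?thesis unfolding lincomb_def
    by (intro exI[of _ "\<lambda>j. a j + b j"]) (simp add: distrib_right sum.distrib)
qed

lemma lincomb_scale:
  assumes "lincomb J \<phi> S F"
  shows "lincomb J \<phi> S (\<lambda>s. c * F s)"
proof -
  obtain a where "\<forall>s\<in>S. F s = (\<Sum>j\<in>J. a j * \<phi> j s)"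
    using assms unfolding lincomb_def by blast
  then show ?thesis unfolding lincomb_def
    by (intro exI[of _ "\<lambda>j. c * a j"]) (simp add: sum_distrib_left mult.assoc)
qed

lemma lincomb_base:
  assumes "finite J" "j \<in> J"
  shows "lincomb J \<phi> S (\<phi> j)"
proof -
  have "\<phi> j s = (\<Sum>i\<in>J. (if i = j then 1 else 0) * \<phi> i s)" for s
    using sum.remove[of J j "\<lambda>i. (if i = j then 1 else 0) * \<phi> i s"] assms by simp
  then show ?thesis unfolding lincomb_def by (intro exI[of _ "\<lambda>i. if i = j then 1 else 0"]) simp
qed

lemma lincomb_mono:
  assumes "lincomb J \<phi> S F" "J \<subseteq> K" "finite K"
  shows "lincomb K \<phi> S F"
proof -
  obtain a where a: "\<forall>s\<in>S. F s = (\<Sum>j\<in>J. a j * \<phi> j s)"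
    using assms unfolding lincomb_def by blast
  have "(\<Sum>j\<in>J. a j * \<phi> j s) = (\<Sum>j\<in>K. (if j \<in> J then a j else 0) * \<phi> j s)" for s
    using assms(2,3) by (intro sum.mono_neutral_cong_left) auto
  with a show ?thesis unfolding lincomb_def
    by (intro exI[of _ "\<lambda>j. if j \<in> J then a j else 0"]) simp
qed

lemma lincomb_cong: "lincomb J \<phi> S F \<Longrightarrow> (\<And>s. s \<in> S \<Longrightarrow> F s = G s) \<Longrightarrow> lincomb J \<phi> S G"
  unfolding lincomb_def by auto

text \<open>Gaussian elimination: with a pivot \<open>a k j\<close>, the equation for
  \<open>j\<close> is solved for the unknown \<open>c k\<close>, which leaves one equation and one
  unknown fewer.\<close>

lemma homogeneous_system_nontrivial_solution:
  fixes a :: "'i \<Rightarrow> 'j \<Rightarrow> real"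
  assumes "finite J" "finite I" "card J < card I"
  shows "\<exists>c. (\<exists>i\<in>I. c i \<noteq> 0) \<and> (\<forall>j\<in>J. (\<Sum>i\<in>I. c i * a i j) = 0)"
  using assms
proof (induction J arbitrary: I a rule: finite_induct)
  case empty
  then obtain i where "i \<in> I" by fastforce
  then show ?case by (intro exI[of _ "\<lambda>_. 1"]) auto
next
  case (insert j J)
  show ?case
  proof (cases "\<forall>i\<in>I. a i j = 0")
    case True
    have "card J < card I" using insert by simp
    then obtain c where "\<exists>i\<in>I. c i \<noteq> 0" "\<forall>j\<in>J. (\<Sum>i\<in>I. c i * a i j) = 0"
      using insert.IH[OF insert.prems(1), of a] by blast
    then show ?thesis using True by (intro exI[of _ c]) simp
  next
    case False
    then obtain k where k: "k \<in> I" "a k j \<noteq> 0" by blast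
    let ?I = "I - {k}"
    let ?b = "\<lambda>i l. a i l - a i j / a k j * a k l"
    have "finite ?I" "card J < card ?I" using insert k by simp_all
    from insert.IH[OF this, of ?b] obtain c where c: "\<exists>i\<in>?I. c i \<noteq> 0" "\<forall>l\<in>J. (\<Sum>i\<in>?I. c i * ?b i l) = 0"
      by (elim exE conjE) (rule that)
    let ?ck = "- (\<Sum>i\<in>?I. c i * (a i j / a k j))"
    let ?c = "c(k := ?ck)"
    have sum: "(\<Sum>i\<in>I. ?c i * a i l) = ?ck * a k l + (\<Sum>i\<in>?I. c i * a i l)" for l
      using sum.remove[OF insert.prems(1) k(1), of "\<lambda>i. ?c i * a i l"] by simp
    have eq: "?ck * a k l + (\<Sum>i\<in>?I. c i * a i l) = (\<Sum>i\<in>?I. c i * ?b i l)" for l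
      by (simp add: sum_distrib_left sum_subtractf algebra_simps)
    have "(\<Sum>i\<in>I. ?c i * a i l) = 0" if "l \<in> insert j J" for l
    proof (cases "l = j")
      case True
      then show ?thesis unfolding sum eq using k(2) by simp
    next
      case False
      then show ?thesis unfolding sum eq using c(2) that by simp
    qed
    moreover have "\<exists>i\<in>I. ?c i \<noteq> 0" using c(1) by auto
    ultimately show ?thesis by blast
  qed
qed

lemma lincomb_dependence:
  assumes "finite J" "finite I" "card J < card I" and "\<And>i. i \<in> I \<Longrightarrow> lincomb J \<phi> S (f i)"
  shows "\<exists>c. (\<exists>i\<in>I. c i \<noteq> 0) \<and> (\<forall>s\<in>S. (\<Sum>i\<in>I. c i * f i s) = 0)"
proof -
  obtain a where a: "\<And>i s. i \<in> I \<Longrightarrow> s \<in> S \<Longrightarrow> f i s = (\<Sum>j\<in>J. a i j * \<phi> j s)"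
    using assms(4) unfolding lincomb_def by metis
  obtain c where c: "\<exists>i\<in>I. c i \<noteq> 0" "\<forall>j\<in>J. (\<Sum>i\<in>I. c i * a i j) = 0"
    using homogeneous_system_nontrivial_solution[OF assms(1-3), of a] by blast
  have "(\<Sum>i\<in>I. c i * f i s) = 0" if "s \<in> S" for s
  proof -
    have "(\<Sum>i\<in>I. c i * f i s) = (\<Sum>i\<in>I. \<Sum>j\<in>J. c i * a i j * \<phi> j s)"
      using that by (simp add: a sum_distrib_left mult.assoc)
    also have "\<dots> = (\<Sum>j\<in>J. (\<Sum>i\<in>I. c i * a i j) * \<phi> j s)"
      by (subst sum.swap) (simp add: sum_distrib_right)
    also have "\<dots> = 0" using c(2) by simp
    finally show ?thesis .
  qed
  with c(1) show ?thesis by blast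
qed

section \<open>Monomials and reduction modulo a critical locus\<close>

definition monom_fun :: "nat \<Rightarrow> (nat \<Rightarrow> nat) \<Rightarrow> (nat \<Rightarrow> real) \<Rightarrow> real" where
  "monom_fun n \<beta> x = (\<Prod>i<n. x i ^ \<beta> i)"

lemma monom_fun_mult: "monom_fun n \<beta> x * monom_fun n \<gamma> x = monom_fun n (\<lambda>i. \<beta> i + \<gamma> i) x"
  by (simp add: monom_fun_def power_add prod.distrib)

lemma monom_fun_cong: "(\<And>i. i < n \<Longrightarrow> \<beta> i = \<gamma> i) \<Longrightarrow> monom_fun n \<beta> x = monom_fun n \<gamma> x"
  unfolding monom_fun_def by (intro prod.cong) auto

lemma monom_fun_zero [simp]: "monom_fun n (\<lambda>_. 0) x = 1"
  by (simp add: monom_fun_def)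

lemma monom_fun_single:
  assumes "i < n"
  shows "monom_fun n ((\<lambda>_. 0)(i := k)) x = x i ^ k"
  unfolding monom_fun_def using prod.remove[of "{..<n}" i "\<lambda>j. x j ^ ((\<lambda>_. 0)(i := k)) j"] assms by simp

lemma sum_single_exponent:
  assumes "i < (n::nat)"
  shows "(\<Sum>j<n. ((\<lambda>_. 0)(i := k)) j) = (k::nat)"
  using sum.remove[of "{..<n}" i "(\<lambda>_. 0)(i := k)"] assms by simp

inductive xpoly :: "nat \<Rightarrow> nat \<Rightarrow> ((nat \<Rightarrow> real) \<Rightarrow> real) \<Rightarrow> bool" for n k where
  "(\<Sum>i<n. \<beta> i) \<le> k \<Longrightarrow> xpoly n k (\<lambda>x. c * monom_fun n \<beta> x)"
| "xpoly n k P \<Longrightarrow> xpoly n k Q \<Longrightarrow> xpoly n k (\<lambda>x. P x + Q x)"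

lemma xpoly_mono: "xpoly n k P \<Longrightarrow> k \<le> l \<Longrightarrow> xpoly n l P"
  by (induction rule: xpoly.induct) (simp_all add: xpoly.intros)

lemma xpoly_mult_monom:
  assumes "xpoly n l Q" "(\<Sum>i<n. \<beta> i) \<le> k"
  shows "xpoly n (k + l) (\<lambda>x. c * monom_fun n \<beta> x * Q x)"
  using assms
proof (induction rule: xpoly.induct)
  case (1 \<gamma> d)
  have "xpoly n (k + l) (\<lambda>x. (c * d) * monom_fun n (\<lambda>i. \<beta> i + \<gamma> i) x)"
    using 1 by (intro xpoly.intros) (simp add: sum.distrib)
  then show ?case by (simp add: monom_fun_mult[symmetric] mult_ac)
next
  case (2 P Q)
  then show ?case using xpoly.intros(2)[OF 2(3,4)] by (simp add: distrib_left)
qed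

lemma xpoly_mult:
  assumes "xpoly n k P" "xpoly n l Q"
  shows "xpoly n (k + l) (\<lambda>x. P x * Q x)"
  using assms
proof (induction rule: xpoly.induct)
  case (1 \<beta> c)
  then show ?case by (intro xpoly_mult_monom)
next
  case (2 P P')
  then show ?case using xpoly.intros(2)[OF 2(3)[OF 2(5)] 2(4)[OF 2(5)]] by (simp add: distrib_right)
qed

lemma polynomial_fun_xpoly:
  assumes "polynomial_fun n P"
  shows "\<exists>k. xpoly n k P"
  using assms
proof induction
  case (const c)
  show ?case using xpoly.intros(1)[where \<beta>="\<lambda>_. 0" and n=n and k=0 and c=c] by auto
next
  case (coord i)
  then show ?case
    using xpoly.intros(1)[where \<beta>="(\<lambda>_. 0)(i := 1)" and n=n and k=1 and c=1]
    by (auto simp: monom_fun_single sum_single_exponent)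
next
  case (add P Q)
  then obtain k l where "xpoly n k P" "xpoly n l Q" by blast
  then have "xpoly n (max k l) P" "xpoly n (max k l) Q" using xpoly_mono by auto
  then show ?case using xpoly.intros(2) by blast
next
  case (mult P Q)
  then show ?case using xpoly_mult by blast
qed

(* Polynomials in a parameter, the first component, and n coordinates, of total degree at most k. *)
inductive wpoly :: "nat \<Rightarrow> nat \<Rightarrow> (real \<times> (nat \<Rightarrow> real) \<Rightarrow> real) \<Rightarrow> bool" for n k where
  "e + (\<Sum>i<n. \<beta> i) \<le> k \<Longrightarrow> wpoly n k (\<lambda>s. c * (fst s ^ e * monom_fun n \<beta> (snd s)))"
| "wpoly n k P \<Longrightarrow> wpoly n k Q \<Longrightarrow> wpoly n k (\<lambda>s. P s + Q s)"

lemma wpoly_mono: "wpoly n k P \<Longrightarrow> k \<le> l \<Longrightarrow> wpoly n l P"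
  by (induction rule: wpoly.induct) (simp_all add: wpoly.intros)

lemma wpoly_mult_monom:
  assumes "wpoly n l Q" "e + (\<Sum>i<n. \<beta> i) \<le> k"
  shows "wpoly n (k + l) (\<lambda>s. c * (fst s ^ e * monom_fun n \<beta> (snd s)) * Q s)"
  using assms
proof (induction rule: wpoly.induct)
  case (1 e' \<gamma> d)
  have "wpoly n (k + l) (\<lambda>s. (c * d) * (fst s ^ (e + e') * monom_fun n (\<lambda>i. \<beta> i + \<gamma> i) (snd s)))"
    using 1 by (intro wpoly.intros) (simp add: sum.distrib)
  then show ?case by (simp add: monom_fun_mult[symmetric] power_add mult_ac)
next
  case (2 P Q)
  then show ?case using wpoly.intros(2)[OF 2(3,4)] by (simp add: distrib_left)
qed

lemma wpoly_mult:
  assumes "wpoly n k P" "wpoly n l Q"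
  shows "wpoly n (k + l) (\<lambda>s. P s * Q s)"
  using assms
proof (induction rule: wpoly.induct)
  case (1 e \<beta> c)
  then show ?case by (intro wpoly_mult_monom)
next
  case (2 P P')
  then show ?case using wpoly.intros(2)[OF 2(3)[OF 2(5)] 2(4)[OF 2(5)]] by (simp add: distrib_right)
qed

lemma xpoly_wpoly:
  assumes "xpoly n k P"
  shows "wpoly n k (\<lambda>s. P (snd s))"
  using assms
proof induction
  case (1 \<beta> c)
  then show ?case using wpoly.intros(1)[where e=0 and \<beta>=\<beta> and n=n and k=k and c=c] by simp
next
  case (2 P Q)
  then show ?case by (intro wpoly.intros(2))
qed

lemma wpoly_param: "wpoly n a (\<lambda>s. fst s ^ a)"
  using wpoly.intros(1)[where e=a and \<beta>="\<lambda>_. 0" and n=n and k=a and c=1] by simp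

lemma wpoly_power:
  assumes "wpoly n k P"
  shows "wpoly n (b * k) (\<lambda>s. P s ^ b)"
proof (induction b)
  case 0
  then show ?case using wpoly_param[of n 0] by simp
next
  case (Suc b)
  then show ?case using wpoly_mult[OF assms Suc] by simp
qed

abbreviation box_monom :: "nat \<Rightarrow> nat \<times> (nat \<Rightarrow> nat) \<Rightarrow> real \<times> (nat \<Rightarrow> real) \<Rightarrow> real" where
  "box_monom n j s \<equiv> fst s ^ fst j * monom_fun n (snd j) (snd s)"

abbreviation exponent_box :: "nat \<Rightarrow> nat \<Rightarrow> (nat \<Rightarrow> nat) set" where
  "exponent_box n d \<equiv> PiE {..<n} (\<lambda>_. {..<d})"

lemma finite_exponent_box: "finite ({..k::nat} \<times> exponent_box n d)"
  by (intro finite_cartesian_product finite_PiE) auto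

text \<open>Replacing \<open>x i ^ d\<close> by the parameter times \<open>q i\<close> raises the
  exponent of the parameter by one and lowers the degree in the coordinates by at least one. The
  total degree never grows, which bounds the final exponents of the parameter, while all coordinate
  exponents end up below \<open>d\<close>.\<close>

lemma monomial_reduction:
  assumes d: "d > 0" and q: "\<And>i. i < n \<Longrightarrow> xpoly n (d - 1) (q i)"
    and S: "\<And>i s. i < n \<Longrightarrow> s \<in> S \<Longrightarrow> snd s i ^ d = fst s * q i (snd s)"
  shows "lincomb ({..e + (\<Sum>i<n. \<beta> i)} \<times> exponent_box n d) (box_monom n) S
     (\<lambda>s. fst s ^ e * monom_fun n \<beta> (snd s))"
proof (induction "\<Sum>i<n. \<beta> i" arbitrary: e \<beta> rule: less_induct)
  case (less \<beta>)
  let ?k = "e + (\<Sum>i<n. \<beta> i)"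
  let ?L = "lincomb ({..?k} \<times> exponent_box n d) (box_monom n) S"
  show ?case
  proof (cases "\<forall>i<n. \<beta> i < d")
    case True
    let ?b = "restrict \<beta> {..<n}"
    have "(e, ?b) \<in> {..?k} \<times> exponent_box n d" using True by auto
    from lincomb_base[OF finite_exponent_box this, of "box_monom n" S]
    show ?thesis by (simp add: monom_fun_cong[of n ?b \<beta>])
  next
    case False
    then obtain i where i: "i < n" "\<beta> i \<ge> d" by (meson not_less)
    let ?b = "\<beta>(i := \<beta> i - d)"
    have mono: "monom_fun n \<beta> x = x i ^ d * monom_fun n ?b x" for x
    proof -
      have "monom_fun n \<beta> x = monom_fun n (\<lambda>j. ((\<lambda>_. 0)(i := d)) j + ?b j) x"
        using i by (intro monom_fun_cong) auto
      then show ?thesis using i(1) by (simp only: monom_fun_mult[symmetric] monom_fun_single)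
    qed
    have deg: "(\<Sum>j<n. \<beta> j) = d + (\<Sum>j<n. ?b j)"
    proof -
      have "(\<Sum>j<n. \<beta> j) = (\<Sum>j<n. ((\<lambda>_. 0)(i := d)) j + ?b j)"
        using i by (intro sum.cong) auto
      then show ?thesis using i(1) by (simp only: sum.distrib sum_single_exponent)
    qed
    have "?L (\<lambda>s. fst s ^ Suc e * (Q (snd s) * monom_fun n ?b (snd s)))"
      if "xpoly n (d - 1) Q" for Q
      using that
    proof induction
      case (1 \<gamma> c)
      let ?g = "\<lambda>j. \<gamma> j + ?b j"
      have sm: "(\<Sum>j<n. ?g j) = (\<Sum>j<n. \<gamma> j) + (\<Sum>j<n. ?b j)" by (rule sum.distrib)
      have "(\<Sum>j<n. ?g j) < (\<Sum>j<n. \<beta> j)" using 1 d unfolding sm deg by linarith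
      from less[OF this, of "Suc e"]
      have "lincomb ({..Suc e + (\<Sum>j<n. ?g j)} \<times> exponent_box n d) (box_monom n) S
          (\<lambda>s. fst s ^ Suc e * monom_fun n ?g (snd s))" .
      moreover have "Suc e + (\<Sum>j<n. ?g j) \<le> ?k" using 1 d unfolding sm deg by linarith
      then have "{..Suc e + (\<Sum>j<n. ?g j)} \<times> exponent_box n d \<subseteq> {..?k} \<times> exponent_box n d"
        by (intro Sigma_mono) auto
      ultimately have "?L (\<lambda>s. fst s ^ Suc e * monom_fun n ?g (snd s))"
        by (rule lincomb_mono[OF _ _ finite_exponent_box])
      from lincomb_scale[OF this, of c]
      show ?case by (rule lincomb_cong) (simp only: monom_fun_mult[symmetric] mult_ac)
    next
      case (2 P Q)
      from lincomb_add[OF 2(3,4)] show ?case by (rule lincomb_cong) (simp add: algebra_simps)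
    qed
    from this[OF q[OF i(1)]] show ?thesis
      by (rule lincomb_cong) (simp add: mono S[OF i(1)] mult_ac)
  qed
qed

lemma wpoly_reduction:
  assumes "d > 0" and "\<And>i. i < n \<Longrightarrow> xpoly n (d - 1) (q i)"
    and "\<And>i s. i < n \<Longrightarrow> s \<in> S \<Longrightarrow> snd s i ^ d = fst s * q i (snd s)"
    and "wpoly n k F"
  shows "lincomb ({..k} \<times> exponent_box n d) (box_monom n) S F"
  using assms(4)
proof induction
  case (1 e \<beta> c)
  have "lincomb ({..e + (\<Sum>i<n. \<beta> i)} \<times> exponent_box n d) (box_monom n) S
      (\<lambda>s. fst s ^ e * monom_fun n \<beta> (snd s))"
    by (rule monomial_reduction[OF assms(1-3)])
  moreover have "{..e + (\<Sum>i<n. \<beta> i)} \<times> exponent_box n d \<subseteq> {..k} \<times> exponent_box n d"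
    using 1 by (intro Sigma_mono) auto
  ultimately show ?case
    by (intro lincomb_scale) (rule lincomb_mono[OF _ _ finite_exponent_box])
next
  case (2 P Q)
  then show ?case by (intro lincomb_add)
qed

text \<open>Dimension count. On \<open>S\<close>, the products of a power of the parameter and a
  power of \<open>F\<close>, with exponents up to \<open>N\<close>, lie in the span of the reduced
  monomials. The number of products is quadratic in \<open>N\<close>, that of reduced monomials only
  linear, so for suitable \<open>N\<close> the products are dependent.\<close>

lemma algebraic_relation:
  assumes "d > 0" and "\<And>i. i < n \<Longrightarrow> xpoly n (d - 1) (q i)"
    and "\<And>i s. i < n \<Longrightarrow> s \<in> S \<Longrightarrow> snd s i ^ d = fst s * q i (snd s)"
    and F: "wpoly n k F"
  shows "\<exists>N c. (\<exists>a\<le>N. \<exists>b\<le>N. c a b \<noteq> 0) \<and>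
    (\<forall>s\<in>S. (\<Sum>a\<le>N. \<Sum>b\<le>N. c a b * (fst s ^ a * F s ^ b)) = (0::real))"
proof -
  define B where "B = card (exponent_box n d)"
  \<comment> \<open>This choice gives \<open>N * N = N * (1 + k) * B + N * B\<close>, so that
    \<open>(N + 1) * (N + 1)\<close> exceeds the number \<open>N * (1 + k) * B + B\<close> of
    reduced monomials.\<close>
  define N where "N = (k + 2) * B"
  let ?I = "{..N} \<times> {..N}"
  let ?J = "{..N + N * k} \<times> exponent_box n d"
  have NN: "N * N = N * (1 + k) * B + N * B" by (simp add: N_def algebra_simps)
  have "N * (1 + k) * B + B < (N + 1) * (N + 1)"
  proof (cases "N = 0")
    case True
    then show ?thesis by (simp add: N_def)
  next
    case False
    then have "B \<le> N * B" by simp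
    moreover have "(N + 1) * (N + 1) = N * N + 2 * N + 1" by (simp add: algebra_simps)
    ultimately show ?thesis using NN by linarith
  qed
  moreover have "card ?J = N * (1 + k) * B + B"
    by (simp add: card_cartesian_product B_def algebra_simps)
  ultimately have card: "card ?J < card ?I" by (simp add: card_cartesian_product)
  have "lincomb ?J (box_monom n) S (\<lambda>s. fst s ^ fst i * F s ^ snd i)" if "i \<in> ?I" for i
  proof (rule wpoly_reduction[OF assms(1-3)])
    have "wpoly n (fst i + snd i * k) (\<lambda>s. fst s ^ fst i * F s ^ snd i)"
      by (intro wpoly_mult wpoly_param wpoly_power F)
    moreover have "fst i + snd i * k \<le> N + N * k" using that by (intro add_mono mult_mono) auto
    ultimately show "wpoly n (N + N * k) (\<lambda>s. fst s ^ fst i * F s ^ snd i)" by (rule wpoly_mono)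
  qed
  then have "\<exists>c. (\<exists>i\<in>?I. c i \<noteq> 0) \<and> (\<forall>s\<in>S. (\<Sum>i\<in>?I. c i * (fst s ^ fst i * F s ^ snd i)) = 0)"
    by (intro lincomb_dependence[of ?J ?I "box_monom n"] finite_exponent_box card) auto
  then obtain c where c: "\<exists>i\<in>?I. c i \<noteq> 0"
    "\<forall>s\<in>S. (\<Sum>i\<in>?I. c i * (fst s ^ fst i * F s ^ snd i)) = 0" by blast
  have "(\<Sum>i\<in>?I. c i * (fst s ^ fst i * F s ^ snd i)) =
      (\<Sum>a\<le>N. \<Sum>b\<le>N. c (a, b) * (fst s ^ a * F s ^ b))" for s
    by (simp add: sum.cartesian_product case_prod_unfold)
  with c show ?thesis by (intro exI[of _ N] exI[of _ "\<lambda>a b. c (a, b)"]) auto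
qed

section \<open>Growth of functions that satisfy a polynomial relation\<close>

text \<open>The coefficients are arbitrary reals, since in the application they depend on
  \<open>t\<close> as well, through the value of an unknown function.\<close>

lemma leading_term_bound:
  fixes u :: "nat \<Rightarrow> real"
  assumes "t \<ge> 1"
  shows "\<bar>u (Suc J)\<bar> * t ^ Suc J \<le> \<bar>\<Sum>a\<le>Suc J. u a * t ^ a\<bar> + t ^ J * (\<Sum>a\<le>J. \<bar>u a\<bar>)"
proof -
  have "\<bar>\<Sum>a\<le>J. u a * t ^ a\<bar> \<le> (\<Sum>a\<le>J. \<bar>u a * t ^ a\<bar>)" by (rule sum_abs)
  also have "\<dots> \<le> (\<Sum>a\<le>J. t ^ J * \<bar>u a\<bar>)"
  proof (rule sum_mono)
    fix a assume "a \<in> {..J}"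
    then have "t ^ a \<le> t ^ J" using assms by (intro power_increasing) auto
    then have "\<bar>u a\<bar> * t ^ a \<le> \<bar>u a\<bar> * t ^ J" by (rule mult_left_mono) simp
    then show "\<bar>u a * t ^ a\<bar> \<le> t ^ J * \<bar>u a\<bar>" using assms by (simp add: abs_mult mult.commute)
  qed
  finally have "\<bar>\<Sum>a\<le>J. u a * t ^ a\<bar> \<le> t ^ J * (\<Sum>a\<le>J. \<bar>u a\<bar>)" by (simp add: sum_distrib_left)
  moreover have "\<bar>u (Suc J)\<bar> * t ^ Suc J = \<bar>(\<Sum>a\<le>Suc J. u a * t ^ a) - (\<Sum>a\<le>J. u a * t ^ a)\<bar>"
    using assms by (simp add: abs_mult)
  ultimately show ?thesis by linarith
qed

lemma exists_top_index:
  assumes "\<exists>a\<le>N::nat. P a"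
  shows "\<exists>J\<le>N. P J \<and> (\<forall>a. J < a \<and> a \<le> N \<longrightarrow> \<not> P a)"
proof -
  let ?A = "{a. a \<le> N \<and> P a}"
  have fin: "finite ?A" by simp
  have ne: "?A \<noteq> {}" using assms by blast
  define m where "m = Max ?A"
  have m: "m \<le> N" "P m" using Max_in[OF fin ne] by (simp_all add: m_def)
  have "a \<le> m" if "a \<le> N" "P a" for a
    unfolding m_def using that by (intro Max_ge[OF fin]) simp
  then have "\<forall>a. m < a \<and> a \<le> N \<longrightarrow> \<not> P a" by (meson leD)
  with m show ?thesis by blast
qed

lemma nonzero_polynomial_bounded_below:
  fixes c :: "nat \<Rightarrow> real"
  assumes "\<exists>b\<le>N. c b \<noteq> 0"
  shows "\<exists>\<beta>>0. \<exists>L\<ge>1. \<forall>t\<ge>L. \<bar>\<Sum>b\<le>N. c b * t ^ b\<bar> \<ge> \<beta>"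
proof -
  obtain J where J: "J \<le> N" "c J \<noteq> 0" "\<forall>a. J < a \<and> a \<le> N \<longrightarrow> \<not> c a \<noteq> 0"
    using exists_top_index[OF assms] by blast
  have eq: "(\<Sum>b\<le>N. c b * t ^ b) = (\<Sum>b\<le>J. c b * t ^ b)" for t
    using J(1,3) by (intro sum.mono_neutral_right) auto
  show ?thesis
  proof (cases J)
    case 0
    then show ?thesis using J(2) unfolding eq by (intro exI[of _ "\<bar>c 0\<bar>"] conjI exI[of _ 1]) auto
  next
    case (Suc j)
    let ?S = "\<Sum>a\<le>j. \<bar>c a\<bar>"
    let ?L = "1 + ?S / \<bar>c J\<bar>"
    have S0: "?S \<ge> 0" by (intro sum_nonneg) auto
    have "\<bar>\<Sum>b\<le>N. c b * t ^ b\<bar> \<ge> \<bar>c J\<bar>" if t: "t \<ge> ?L" for t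
    proof -
      have "t \<ge> 1" using t S0 J(2) by (smt (verit) divide_nonneg_pos zero_less_abs_iff)
      have "\<bar>c J\<bar> * t \<ge> \<bar>c J\<bar> + ?S" using mult_left_mono[OF t, of "\<bar>c J\<bar>"] J(2)
        by (simp add: distrib_left)
      then have "1 * \<bar>c J\<bar> \<le> t ^ j * (\<bar>c J\<bar> * t - ?S)"
        using \<open>t \<ge> 1\<close> by (intro mult_mono) (auto simp: one_le_power)
      also have "\<dots> = \<bar>c J\<bar> * t ^ J - t ^ j * ?S" unfolding Suc by (simp add: algebra_simps)
      also have "\<dots> \<le> \<bar>\<Sum>b\<le>N. c b * t ^ b\<bar>"
        unfolding eq using leading_term_bound[OF \<open>t \<ge> 1\<close>, of c j] by (simp add: Suc)
      finally show ?thesis by simp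
    qed
    moreover have "?L \<ge> 1" using S0 by simp
    ultimately show ?thesis using J(2) by (intro exI[of _ "\<bar>c J\<bar>"] conjI exI[of _ ?L]) auto
  qed
qed

text \<open>Read the relation as a polynomial in \<open>t\<close> whose coefficients
  \<open>u t a\<close> are polynomials in \<open>M t\<close>. The highest coefficient that is not
  the zero polynomial stays away from 0 once \<open>M t\<close> is large, while the others are at
  most a constant times \<open>M t ^ N\<close>. Comparing the leading term with the rest bounds
  \<open>t\<close> by a multiple of \<open>M t ^ N\<close>.\<close>

lemma algebraic_function_growth:
  fixes c :: "nat \<Rightarrow> nat \<Rightarrow> real" and M :: "real \<Rightarrow> real"
  assumes c: "\<exists>a\<le>N. \<exists>b\<le>N. c a b \<noteq> 0"
    and rel: "\<And>t. t \<ge> 1 \<Longrightarrow> (\<Sum>a\<le>N. \<Sum>b\<le>N. c a b * (t ^ a * M t ^ b)) = 0"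
    and lim: "\<And>L. \<exists>t0. \<forall>t\<ge>t0. M t \<ge> L"
  shows "\<exists>C\<ge>0. \<exists>t0. \<forall>t\<ge>t0. t \<le> C * M t ^ N"
proof -
  obtain J where J: "J \<le> N" "\<exists>b\<le>N. c J b \<noteq> 0" "\<forall>a. J < a \<and> a \<le> N \<longrightarrow> \<not> (\<exists>b\<le>N. c a b \<noteq> 0)"
    using exists_top_index[OF c] by blast
  obtain \<beta> L where L: "\<beta> > 0" "L \<ge> 1" "\<forall>s\<ge>L. \<bar>\<Sum>b\<le>N. c J b * s ^ b\<bar> \<ge> \<beta>"
    using nonzero_polynomial_bounded_below[OF J(2)] by blast
  obtain t0 where t0: "\<forall>t\<ge>t0. M t \<ge> L" using lim by blast
  define u where "u t a = (\<Sum>b\<le>N. c a b * M t ^ b)" for t a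
  have u: "(\<Sum>a\<le>J. u t a * t ^ a) = 0" if "t \<ge> 1" for t
  proof -
    have "(\<Sum>a\<le>J. u t a * t ^ a) = (\<Sum>a\<le>N. u t a * t ^ a)"
      using J(1,3) by (intro sum.mono_neutral_left) (auto simp: u_def)
    also have "\<dots> = (\<Sum>a\<le>N. \<Sum>b\<le>N. c a b * (t ^ a * M t ^ b))"
      unfolding u_def sum_distrib_right by (intro sum.cong refl) (simp only: mult_ac)
    also have "\<dots> = 0" by (rule rel[OF that])
    finally show ?thesis .
  qed
  define K where "K = (\<Sum>a\<le>N. \<Sum>b\<le>N. \<bar>c a b\<bar>)"
  have K0: "K \<ge> 0" unfolding K_def by (intro sum_nonneg) auto
  have "t \<le> K / \<beta> * M t ^ N" if t: "t \<ge> max 1 t0" for t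
  proof -
    have M: "M t \<ge> L" "M t \<ge> 1" "t \<ge> 1" using t t0 L(2) by auto
    have lower: "\<bar>u t J\<bar> \<ge> \<beta>" using L(3) M(1) by (simp add: u_def)
    have "J \<noteq> 0"
    proof
      assume "J = 0"
      then show False using u[OF M(3)] lower L(1) by simp
    qed
    then obtain j where j: "J = Suc j" using not0_implies_Suc by blast
    have "\<bar>u t a\<bar> \<le> (\<Sum>b\<le>N. \<bar>c a b\<bar>) * M t ^ N" for a
    proof -
      have "\<bar>u t a\<bar> \<le> (\<Sum>b\<le>N. \<bar>c a b * M t ^ b\<bar>)" unfolding u_def by (rule sum_abs)
      also have "\<dots> \<le> (\<Sum>b\<le>N. \<bar>c a b\<bar> * M t ^ N)"
      proof (rule sum_mono)
        fix b assume "b \<in> {..N}"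
        then have "M t ^ b \<le> M t ^ N" using M(2) by (intro power_increasing) auto
        then show "\<bar>c a b * M t ^ b\<bar> \<le> \<bar>c a b\<bar> * M t ^ N"
          using M(2) by (simp add: abs_mult mult_left_mono)
      qed
      finally show ?thesis by (simp add: sum_distrib_right)
    qed
    then have "(\<Sum>a\<le>j. \<bar>u t a\<bar>) \<le> (\<Sum>a\<le>j. (\<Sum>b\<le>N. \<bar>c a b\<bar>) * M t ^ N)" by (rule sum_mono)
    also have "\<dots> \<le> (\<Sum>a\<le>N. (\<Sum>b\<le>N. \<bar>c a b\<bar>) * M t ^ N)"
      using j J(1) M(2) by (intro sum_mono2) (auto intro!: mult_nonneg_nonneg sum_nonneg)
    also have "\<dots> = K * M t ^ N" by (simp add: K_def sum_distrib_right)
    finally have upper: "(\<Sum>a\<le>j. \<bar>u t a\<bar>) \<le> K * M t ^ N" .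
    have tj: "t ^ j > 0" using M(3) by simp
    have "t ^ j * (t * \<beta>) \<le> t ^ j * (t * \<bar>u t J\<bar>)"
      using lower M(3) by (intro mult_left_mono) auto
    also have "\<dots> \<le> t ^ j * (\<Sum>a\<le>j. \<bar>u t a\<bar>)"
      using leading_term_bound[OF M(3), of "u t" j] u[OF M(3)] by (simp add: j mult_ac)
    also have "\<dots> \<le> t ^ j * (K * M t ^ N)" using upper tj by (intro mult_left_mono) auto
    finally have "t * \<beta> \<le> K * M t ^ N" using tj by simp
    then show ?thesis using L(1) by (simp add: pos_le_divide_eq)
  qed
  moreover have "K / \<beta> \<ge> 0" using K0 L(1) by simp
  ultimately show ?thesis by blast
qed

section \<open>A Lojasiewicz inequality for positive polynomials\<close>

lemma polynomial_fun_partial_derivative: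
  assumes "polynomial_fun n P"
  shows "\<exists>P'. polynomial_fun n P' \<and>
    (\<forall>x. ((\<lambda>t. P (x(i := t))) has_real_derivative P' x) (at (x i)))"
  using assms
proof induction
  case (const c)
  show ?case by (intro exI[of _ "\<lambda>x. 0"]) (auto intro!: derivative_eq_intros)
next
  case (coord j)
  show ?case
  proof (cases "j = i")
    case True
    then show ?thesis by (intro exI[of _ "\<lambda>x. 1"]) (auto intro!: derivative_eq_intros)
  next
    case False
    then show ?thesis by (intro exI[of _ "\<lambda>x. 0"]) (auto intro!: derivative_eq_intros)
  qed
next
  case (add P Q)
  then obtain P' Q' where *: "polynomial_fun n P'" "polynomial_fun n Q'"
    "\<And>x. ((\<lambda>t. P (x(i := t))) has_real_derivative P' x) (at (x i))"
    "\<And>x. ((\<lambda>t. Q (x(i := t))) has_real_derivative Q' x) (at (x i))" by blast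
  have "((\<lambda>t. P (x(i := t)) + Q (x(i := t))) has_real_derivative P' x + Q' x) (at (x i))" for x
    by (rule DERIV_add[OF *(3,4)])
  moreover have "polynomial_fun n (\<lambda>x. P' x + Q' x)" using * by (intro polynomial_fun.add)
  ultimately show ?case by blast
next
  case (mult P Q)
  then obtain P' Q' where *: "polynomial_fun n P'" "polynomial_fun n Q'"
    "\<And>x. ((\<lambda>t. P (x(i := t))) has_real_derivative P' x) (at (x i))"
    "\<And>x. ((\<lambda>t. Q (x(i := t))) has_real_derivative Q' x) (at (x i))" by blast
  have "((\<lambda>t. P (x(i := t)) * Q (x(i := t))) has_real_derivative P' x * Q x + Q' x * P x) (at (x i))" for x
    using DERIV_mult[OF *(3,4), of x x] by simp
  moreover have "polynomial_fun n (\<lambda>x. P' x * Q x + Q' x * P x)"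
    using * mult by (intro polynomial_fun.add polynomial_fun.mult)
  ultimately show ?case by blast
qed

lemma polynomial_fun_continuous_on:
  assumes "polynomial_fun n P"
  shows "continuous_on S P"
  using assms
proof induction
  case (coord i)
  show ?case by (rule continuous_on_subset[OF continuous_on_product_coordinates]) simp
qed (auto intro!: continuous_intros)

lemma compact_coordinate_box: "compact {x \<in> rn n. \<forall>i<n. \<bar>x i\<bar> \<le> L}"
proof -
  let ?S = "\<lambda>i. if i < n then {-L..L} else {0::real}"
  have "compactin (product_topology (\<lambda>_. euclideanreal) UNIV) (PiE UNIV ?S)"
    unfolding compactin_PiE by (intro disjI2 ballI) simp
  then have "compact (PiE UNIV ?S)" by (simp add: euclidean_product_topology)
  moreover have "PiE UNIV ?S = {x \<in> rn n. \<forall>i<n. \<bar>x i\<bar> \<le> L}"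
  proof -
    have "x \<in> PiE UNIV ?S \<longleftrightarrow> x \<in> {x \<in> rn n. \<forall>i<n. \<bar>x i\<bar> \<le> L}" for x
    proof -
      have "x i \<in> ?S i \<longleftrightarrow> (n \<le> i \<longrightarrow> x i = 0) \<and> (i < n \<longrightarrow> \<bar>x i\<bar> \<le> L)" for i
        by (auto simp: abs_le_iff)
      then have "(\<forall>i. x i \<in> ?S i) \<longleftrightarrow> (\<forall>i\<ge>n. x i = 0) \<and> (\<forall>i<n. \<bar>x i\<bar> \<le> L)" by blast
      then show ?thesis by (simp add: PiE_UNIV_domain Pi_iff rn_iff)
    qed
    then show ?thesis by blast
  qed
  ultimately show ?thesis by simp
qed

section \<open>Minima of a power sum plus a multiple of a polynomial\<close>

text \<open>For \<open>D \<ge> 1\<close> this is coercive, and its partial derivatives are multiples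
  of the pure powers \<open>x i ^ (2 * D - 1)\<close>. Critical points of its sum with a multiple of
  \<open>P\<close> therefore satisfy equations of the kind that reduces monomials.\<close>

definition power_gauge :: "nat \<Rightarrow> nat \<Rightarrow> (nat \<Rightarrow> real) \<Rightarrow> real" where
  "power_gauge n D x = (\<Sum>i<n. x i ^ (2 * D))"

lemma power_gauge_nonneg: "power_gauge n D x \<ge> 0"
  unfolding power_gauge_def by (intro sum_nonneg) (simp add: zero_le_even_power')

lemma polynomial_fun_power_gauge: "polynomial_fun n (power_gauge n D)"
proof -
  have "power_gauge n D = (\<lambda>x. \<Sum>i<n. x i ^ (2 * D))" by (rule ext) (simp add: power_gauge_def)
  then show ?thesis by (auto intro!: polynomial_fun_sum polynomial_fun_power)
qed

lemma power_gauge_ge: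
  assumes "D \<ge> 1" "i < n" "\<bar>x i\<bar> \<ge> 1"
  shows "power_gauge n D x \<ge> \<bar>x i\<bar>"
proof -
  have "\<bar>x i\<bar> \<le> \<bar>x i\<bar> ^ (2 * D)" using assms by (intro self_le_power) auto
  also have "\<dots> = x i ^ (2 * D)" by (simp add: power_mult)
  also have "\<dots> \<le> power_gauge n D x" unfolding power_gauge_def
    using assms(2) by (intro member_le_sum) (auto simp: zero_le_even_power')
  finally show ?thesis .
qed

lemma power_gauge_sublevel:
  assumes "D \<ge> 1" "x \<in> rn n" "power_gauge n D x \<le> L"
  shows "x \<in> {x \<in> rn n. \<forall>i<n. \<bar>x i\<bar> \<le> max 1 L}"
  using power_gauge_ge[OF assms(1), of _ n x] assms(2,3) by force

lemma power_gauge_derivative: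
  assumes "i < n"
  shows "((\<lambda>t. power_gauge n D (x(i := t))) has_real_derivative (2 * D) * x i ^ (2 * D - 1)) (at (x i))"
proof -
  have "power_gauge n D (x(i := t)) = t ^ (2 * D) + (\<Sum>j\<in>{..<n} - {i}. x j ^ (2 * D))" for t
    unfolding power_gauge_def
    using sum.remove[of "{..<n}" i "\<lambda>j. (x(i := t)) j ^ (2 * D)"] assms by simp
  then show ?thesis by (auto intro!: derivative_eq_intros)
qed

text \<open>Outside a coordinate box determined by the value at the origin the gauge alone exceeds
  that value, so a minimum over the compact box is a global one.\<close>

lemma penalized_minimum:
  assumes P: "polynomial_fun n P" "\<And>x. x \<in> rn n \<Longrightarrow> P x > 0" and D: "D \<ge> 1" and t: "t \<ge> 0"
  shows "\<exists>x\<in>rn n. \<forall>y\<in>rn n. power_gauge n D x + t * P x \<le> power_gauge n D y + t * P y"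
proof -
  let ?F = "\<lambda>x. power_gauge n D x + t * P x"
  let ?o = "\<lambda>_::nat. 0::real"
  let ?K = "{x \<in> rn n. \<forall>i<n. \<bar>x i\<bar> \<le> max 1 (?F ?o)}"
  have o: "?o \<in> ?K" by (simp add: rn_iff le_max_iff_disj)
  have "continuous_on ?K ?F"
    by (intro polynomial_fun_continuous_on[of n] polynomial_fun_intros polynomial_fun_power_gauge P(1))
  then obtain x where x: "x \<in> ?K" "\<forall>y\<in>?K. ?F x \<le> ?F y"
    using continuous_attains_inf[OF compact_coordinate_box, of n "max 1 (?F ?o)" ?F] o by blast
  have "?F x \<le> ?F y" if y: "y \<in> rn n" for y
  proof (cases "y \<in> ?K")
    case False
    then have "power_gauge n D y > ?F ?o" using power_gauge_sublevel[OF D y, of "?F ?o"] by force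
    moreover have "t * P y \<ge> 0" using P(2)[OF y] t by simp
    moreover have "?F x \<le> ?F ?o" using x(2) o by blast
    ultimately show ?thesis by linarith
  qed (use x in blast)
  then show ?thesis using x(1) by blast
qed

lemma penalized_minimum_critical:
  assumes P': "\<And>x. ((\<lambda>t. P (x(i := t))) has_real_derivative P' x) (at (x i))" and i: "i < n"
    and x: "x \<in> rn n" "\<And>y. y \<in> rn n \<Longrightarrow> power_gauge n D x + t * P x \<le> power_gauge n D y + t * P y"
  shows "(2 * D) * x i ^ (2 * D - 1) + t * P' x = 0"
proof -
  let ?f = "\<lambda>u. power_gauge n D (x(i := u)) + t * P (x(i := u))"
  have d: "(?f has_real_derivative (2 * D) * x i ^ (2 * D - 1) + t * P' x) (at (x i))"
    by (auto intro!: derivative_eq_intros power_gauge_derivative[OF i] P')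
  have le: "?f (x i) \<le> ?f u" for u
    using x(2)[of "x(i := u)"] x(1) i by (simp add: rn_iff)
  show ?thesis by (rule DERIV_local_min[OF d zero_less_one]) (intro allI impI le)
qed

text \<open>On a box \<open>P\<close> has a positive minimum, so \<open>t * P x\<close> exceeds
  \<open>L\<close> there for large \<open>t\<close>; outside the box the gauge does.\<close>

lemma penalized_minimum_tendsto_infinity:
  assumes P: "polynomial_fun n P" "\<And>x. x \<in> rn n \<Longrightarrow> P x > 0" and D: "D \<ge> 1"
  shows "\<exists>t0. \<forall>t\<ge>t0. \<forall>x\<in>rn n. power_gauge n D x + t * P x \<ge> L"
proof -
  let ?K = "{x \<in> rn n. \<forall>i<n. \<bar>x i\<bar> \<le> max 1 L}"
  have "(\<lambda>_. 0) \<in> ?K" by (simp add: rn_iff le_max_iff_disj)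
  then obtain z where z: "z \<in> ?K" "\<forall>y\<in>?K. P z \<le> P y"
    using continuous_attains_inf[OF compact_coordinate_box, of n "max 1 L" P]
      polynomial_fun_continuous_on[OF P(1)] by blast
  have pz: "P z > 0" using P(2) z(1) by blast
  have "power_gauge n D x + t * P x \<ge> L" if t: "t \<ge> max 0 (L / P z)" and x: "x \<in> rn n" for t x
  proof (cases "x \<in> ?K")
    case True
    have "L \<le> t * P z" using t pz by (simp add: pos_divide_le_eq)
    also have "\<dots> \<le> t * P x" using t z(2) True by (intro mult_left_mono) auto
    finally show ?thesis using power_gauge_nonneg[of n D x] by linarith
  next
    case False
    then have "power_gauge n D x > L" using power_gauge_sublevel[OF D x, of L] by force
    moreover have "t * P x \<ge> 0" using P(2)[OF x] t by simp
    ultimately show ?thesis by linarith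
  qed
  then show ?thesis by blast
qed

text \<open>The minimum \<open>M t\<close> of the gauge plus \<open>t * P\<close> satisfies a
  polynomial relation with \<open>t\<close>, hence \<open>t \<le> C * M t ^ N\<close> for large
  \<open>t\<close>. Given \<open>x\<close>, a number \<open>t\<close> of order
  \<open>(1 + gauge) ^ N\<close> is chosen that forces \<open>M t\<close> to be at least twice
  \<open>1 + gauge\<close>. As \<open>M t\<close> is at most the value at \<open>x\<close>, the term
  \<open>t * P x\<close> must be at least 1.\<close>

theorem positive_polynomial_lower_bound:
  assumes P: "polynomial_fun n P" "\<And>x. x \<in> rn n \<Longrightarrow> P x > 0"
  shows "\<exists>C>0. \<exists>D\<ge>1. \<exists>N. \<forall>x\<in>rn n. 1 \<le> P x * (C * (1 + power_gauge n D x) ^ N)"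
proof -
  have "\<forall>i. \<exists>P'. polynomial_fun n P' \<and> (\<forall>x. ((\<lambda>t. P (x(i := t))) has_real_derivative P' x) (at (x i)))"
    using polynomial_fun_partial_derivative[OF P(1)] by blast
  then obtain P' where P': "\<And>i. polynomial_fun n (P' i)"
    "\<And>i x. ((\<lambda>t. P (x(i := t))) has_real_derivative P' i x) (at (x i))" by metis
  have "\<forall>i. \<exists>k. xpoly n k (P' i)" using polynomial_fun_xpoly P'(1) by blast
  then obtain k where k: "\<And>i. xpoly n (k i) (P' i)" by metis
  \<comment> \<open>Large enough for all partial derivatives of \<open>P\<close> to have degree at
    most \<open>2 * D - 2\<close>, below the exponent of the pure power
    \<open>x i ^ (2 * D - 1)\<close> with which they are equated.\<close>
  define D where "D = Suc (\<Sum>i<n. k i)"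
  have D: "D \<ge> 1" by (simp add: D_def)
  define q where "q i x = (- 1 / (2 * D)) * P' i x" for i x
  have q: "xpoly n (2 * D - 1 - 1) (q i)" if "i < n" for i
  proof -
    have "k i \<le> (\<Sum>i<n. k i)" using that by (intro member_le_sum) auto
    then have "xpoly n (2 * D - 1 - 1) (P' i)" using xpoly_mono[OF k[of i]] by (simp add: D_def)
    moreover have "xpoly n 0 (\<lambda>x. - 1 / (2 * D))"
      using xpoly.intros(1)[where n=n and \<beta>="\<lambda>_. 0" and k=0 and c="- 1 / (2 * D)"] by simp
    ultimately show ?thesis
      using xpoly_mult[of n 0 "\<lambda>x. - 1 / (2 * D)" "2 * D - 1 - 1" "P' i"] by (simp add: q_def[abs_def])
  qed
  have "\<forall>t. \<exists>x. t \<ge> 0 \<longrightarrow> x \<in> rn n \<and>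
      (\<forall>y\<in>rn n. power_gauge n D x + t * P x \<le> power_gauge n D y + t * P y)"
    using penalized_minimum[OF P D] by blast
  then obtain m where m: "\<And>t. t \<ge> 0 \<Longrightarrow> m t \<in> rn n"
    "\<And>t y. t \<ge> 0 \<Longrightarrow> y \<in> rn n \<Longrightarrow>
      power_gauge n D (m t) + t * P (m t) \<le> power_gauge n D y + t * P y" by metis
  define M where "M t = power_gauge n D (m t) + t * P (m t)" for t
  let ?S = "(\<lambda>t. (t, m t)) ` {1..}"
  have crit: "snd s i ^ (2 * D - 1) = fst s * q i (snd s)" if i: "i < n" and s: "s \<in> ?S" for i s
  proof -
    obtain t where t: "s = (t, m t)" "t \<ge> 1" using s by auto
    have "(2 * D) * m t i ^ (2 * D - 1) + t * P' i (m t) = 0"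
      using penalized_minimum_critical[OF P'(2) i, of "m t" D t] m[of t] t(2) by auto
    then show ?thesis using D t(1) by (simp add: q_def field_simps)
  qed
  obtain kP where kP: "xpoly n kP P" using polynomial_fun_xpoly[OF P(1)] by blast
  obtain kG where kG: "xpoly n kG (power_gauge n D)"
    using polynomial_fun_xpoly[OF polynomial_fun_power_gauge] by blast
  have "wpoly n (1 + kP) (\<lambda>s. fst s ^ 1 * P (snd s))"
    by (intro wpoly_mult wpoly_param xpoly_wpoly kP)
  then have "wpoly n (kG + (1 + kP)) (\<lambda>s. fst s ^ 1 * P (snd s))"
    by (rule wpoly_mono) simp
  moreover have "wpoly n (kG + (1 + kP)) (\<lambda>s. power_gauge n D (snd s))"
    by (rule wpoly_mono[OF xpoly_wpoly[OF kG]]) simp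
  ultimately have "wpoly n (kG + (1 + kP)) (\<lambda>s. power_gauge n D (snd s) + fst s ^ 1 * P (snd s))"
    by (intro wpoly.intros(2))
  from algebraic_relation[of "2 * D - 1" n q ?S, OF _ q crit this]
  obtain N c where c: "\<exists>a\<le>N. \<exists>b\<le>N. c a b \<noteq> 0"
    "\<forall>s\<in>?S. (\<Sum>a\<le>N. \<Sum>b\<le>N. c a b * (fst s ^ a * (power_gauge n D (snd s) + fst s ^ 1 * P (snd s)) ^ b)) = (0::real)"
    using D by auto
  have rel: "(\<Sum>a\<le>N. \<Sum>b\<le>N. c a b * (t ^ a * M t ^ b)) = 0" if "t \<ge> 1" for t
    using c(2) that by (simp add: M_def)
  have lim: "\<exists>t0. \<forall>t\<ge>t0. M t \<ge> L" for L
  proof -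
    obtain t0 where "\<forall>t\<ge>t0. \<forall>x\<in>rn n. power_gauge n D x + t * P x \<ge> L"
      using penalized_minimum_tendsto_infinity[OF P D] by blast
    then show ?thesis using m(1) by (intro exI[of _ "max 0 t0"]) (auto simp: M_def)
  qed
  obtain C t0 where C: "C \<ge> 0" "\<And>t. t \<ge> t0 \<Longrightarrow> t \<le> C * M t ^ N"
    using algebraic_function_growth[OF c(1) rel lim] by blast
  \<comment> \<open>\<open>C'\<close> strictly exceeds \<open>C\<close>, which decides the
    comparison of \<open>M t\<close> with \<open>?g\<close> below, and it is large enough to give
    \<open>t \<ge> 1\<close> and \<open>t \<ge> t0\<close>.\<close>
  define C' where "C' = C + \<bar>t0\<bar> + 1"
  have "1 \<le> P x * (C' * 2 ^ N * (1 + power_gauge n D x) ^ N)" if x: "x \<in> rn n" for x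
  proof -
    let ?g = "2 + 2 * power_gauge n D x"
    define t where "t = C' * ?g ^ N"
    have g: "?g \<ge> 1" using power_gauge_nonneg[of n D x] by linarith
    then have gN: "?g ^ N \<ge> 1" by (rule one_le_power)
    have "C' * 1 \<le> t" unfolding t_def using gN C(1) by (intro mult_left_mono) (auto simp: C'_def)
    then have t: "t \<ge> C'" by simp
    then have t1: "t \<ge> 1" "t \<ge> t0" using C(1) by (auto simp: C'_def)
    have M0: "M t \<ge> 0" unfolding M_def
      using power_gauge_nonneg[of n D "m t"] P(2)[OF m(1), of t] t1(1) by (intro add_nonneg_nonneg) auto
    have "C' * ?g ^ N \<le> C * M t ^ N" using C(2)[OF t1(2)] by (simp add: t_def)
    also have "\<dots> < C' * (M t ^ N + 1)"
    proof -
      have "C * M t ^ N \<le> C' * M t ^ N" using M0 by (intro mult_right_mono) (auto simp: C'_def)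
      then show ?thesis using C(1) by (simp add: C'_def algebra_simps)
    qed
    finally have "C' * ?g ^ N < C' * (M t ^ N + 1)" .
    then have *: "C' * ?g ^ N \<le> C * M t ^ N" "C' > 0" using C(2)[OF t1(2)] C(1) by (auto simp: t_def C'_def)
    have "?g \<le> M t"
    proof (rule ccontr)
      assume "\<not> ?g \<le> M t"
      then have "M t ^ N \<le> ?g ^ N" using M0 by (intro power_mono) auto
      then have "C * M t ^ N \<le> C * ?g ^ N" using C(1) by (rule mult_left_mono)
      also have "\<dots> < C' * ?g ^ N" using gN by (intro mult_strict_right_mono) (auto simp: C'_def)
      finally show False using *(1) by simp
    qed
    also have "M t \<le> power_gauge n D x + t * P x" unfolding M_def using m(2) t1(1) x by simp
    finally have "1 \<le> t * P x" using power_gauge_nonneg[of n D x] by linarith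
    moreover have "?g ^ N = 2 ^ N * (1 + power_gauge n D x) ^ N"
      by (simp flip: power_mult_distrib)
    ultimately show ?thesis by (simp add: t_def mult_ac)
  qed
  moreover have "C' * 2 ^ N > 0" using C(1) by (simp add: C'_def)
  ultimately show ?thesis using D by blast
qed

section \<open>Separating a compact zero set from infinity\<close>

text \<open>At the point over \<open>x\<close> with extra coordinate \<open>sqrt (?s x - r)\<close>
  the polynomial \<open>P\<close> takes the value \<open>\<phi> x\<close>, so the factor in the
  lower bound for \<open>P\<close> lifts \<open>\<phi>\<close> above 1 outside the ball. The square
  root enters that factor only through its power \<open>2 * D\<close>, which is at most the
  polynomial \<open>?s x ^ D\<close>.\<close>

corollary compact_zero_set_separating_polynomial:
  assumes \<phi>: "polynomial_fun m \<phi>" "\<And>x. \<phi> x \<ge> 0" and r: "r \<ge> 0"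
    and bdd: "\<And>x. x \<in> rn m \<Longrightarrow> \<phi> x = 0 \<Longrightarrow> (\<Sum>i<m. (x i)\<^sup>2) < r"
  shows "\<exists>\<Phi>. polynomial_fun m \<Phi> \<and> (\<forall>x. \<Phi> x \<ge> 0) \<and> (\<forall>x. \<Phi> x = 0 \<longleftrightarrow> \<phi> x = 0) \<and>
     (\<forall>x\<in>rn m. (\<Sum>i<m. (x i)\<^sup>2) \<ge> r \<longrightarrow> \<Phi> x \<ge> 1)"
proof -
  let ?s = "\<lambda>x::nat\<Rightarrow>real. \<Sum>i<m. (x i)\<^sup>2"
  (* The extra coordinate encodes |x|^2 >= r as an equation, making P positive everywhere. *)
  define P where "P x = \<phi> x + (?s x - r - (x m)\<^sup>2)\<^sup>2" for x
  have "polynomial_fun (Suc m) (\<lambda>x. \<phi> x + (?s x - r - (x m)\<^sup>2)\<^sup>2)"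
    using polynomial_fun_mono[OF \<phi>(1), of "Suc m"]
    by (intro polynomial_fun_intros) auto
  then have P: "polynomial_fun (Suc m) P" by (simp add: P_def[abs_def])
  have pos: "P x > 0" if "x \<in> rn (Suc m)" for x
  proof -
    let ?y = "x(m := 0)"
    have y: "?y \<in> rn m" using that by (auto simp: rn_iff)
    have eq: "\<phi> x = \<phi> ?y" "?s x = ?s ?y"
      using polynomial_fun_cong[OF \<phi>(1), of x ?y] by auto
    show ?thesis
    proof (cases "\<phi> ?y = 0")
      case True
      have "?s ?y < r" by (rule bdd[OF y True])
      then have "?s x < r" using eq(2) by linarith
      then have "?s x - r - (x m)\<^sup>2 \<noteq> 0" using zero_le_power2[of "x m"] by linarith
      then show ?thesis unfolding P_def using \<phi>(2)[of x] by (intro add_nonneg_pos) auto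
    next
      case False
      then have "\<phi> x > 0" using \<phi>(2)[of ?y] eq(1) by linarith
      then show ?thesis unfolding P_def by (intro add_pos_nonneg) auto
    qed
  qed
  obtain C D N where C: "C > 0" "D \<ge> 1"
    "\<And>x. x \<in> rn (Suc m) \<Longrightarrow> 1 \<le> P x * (C * (1 + power_gauge (Suc m) D x) ^ N)"
    using positive_polynomial_lower_bound[OF P pos] by blast
  define \<Phi> where "\<Phi> x = \<phi> x * (C * (1 + (power_gauge m D x + ?s x ^ D)) ^ N)" for x
  have gauge: "1 + (power_gauge m D x + ?s x ^ D) \<ge> 1" for x
    using power_gauge_nonneg[of m D x] by (simp add: sum_nonneg)
  have fac: "C * (1 + (power_gauge m D x + ?s x ^ D)) ^ N > 0" for x
    by (intro mult_pos_pos C(1) zero_less_power) (use gauge[of x] in linarith)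
  have "\<Phi> x \<ge> 1" if x: "x \<in> rn m" "?s x \<ge> r" for x
  proof -
    let ?y = "x(m := sqrt (?s x - r))"
    have y: "?y \<in> rn (Suc m)" using x(1) by (auto simp: rn_iff)
    have "?s ?y = ?s x" by simp
    moreover have "(?y m)\<^sup>2 = ?s x - r" using x(2) by simp
    moreover have "\<phi> ?y = \<phi> x" by (rule polynomial_fun_cong[OF \<phi>(1)]) auto
    ultimately have Py: "P ?y = \<phi> x" unfolding P_def by simp
    have "power_gauge (Suc m) D ?y = power_gauge m D x + (?s x - r) ^ D"
      using x(2) by (simp add: power_gauge_def power_mult)
    moreover have "(?s x - r) ^ D \<le> ?s x ^ D" using x(2) r by (intro power_mono) auto
    ultimately have le: "power_gauge (Suc m) D ?y \<le> power_gauge m D x + ?s x ^ D" by simp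
    have "1 \<le> \<phi> x * (C * (1 + power_gauge (Suc m) D ?y) ^ N)" using C(3)[OF y] Py by simp
    also have "\<dots> \<le> \<Phi> x" unfolding \<Phi>_def
      using le power_gauge_nonneg[of "Suc m" D ?y] C(1) \<phi>(2)
      by (intro mult_left_mono power_mono) auto
    finally show ?thesis .
  qed
  moreover have "\<Phi> x \<ge> 0" for x unfolding \<Phi>_def using \<phi>(2)[of x] fac[of x] by simp
  moreover have mult0: "a * k = 0 \<longleftrightarrow> a = 0" if "k > 0" for a k :: real using that by simp
  have "\<Phi> x = 0 \<longleftrightarrow> \<phi> x = 0" for x unfolding \<Phi>_def by (rule mult0[OF fac])
  moreover have "polynomial_fun m (\<lambda>x. \<phi> x * (C * (1 + (power_gauge m D x + ?s x ^ D)) ^ N))"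
    using \<phi>(1) polynomial_fun_power_gauge by (intro polynomial_fun_intros) auto
  then have "polynomial_fun m \<Phi>" by (simp add: \<Phi>_def[abs_def])
  ultimately show ?thesis by blast
qed

section \<open>Algebras of functions\<close>

text \<open>Continuous functions and quotients of polynomials are the two instances, so that one
  derivation shows an explicit formula to be continuous near the diagonal and rational on
  \<open>Z\<close>. Membership depends only on the values on \<open>S\<close>, and reciprocals ask
  for non-vanishing only there.\<close>

locale function_algebra =
  fixes S :: "'z set" and R :: "('z \<Rightarrow> real) \<Rightarrow> bool"
  assumes const: "R (\<lambda>z. c)"
    and add: "R f \<Longrightarrow> R g \<Longrightarrow> R (\<lambda>z. f z + g z)"
    and mult: "R f \<Longrightarrow> R g \<Longrightarrow> R (\<lambda>z. f z * g z)"
    and recip: "R f \<Longrightarrow> (\<And>z. z \<in> S \<Longrightarrow> f z \<noteq> 0) \<Longrightarrow> R (\<lambda>z. 1 / f z)"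
    and cong: "R f \<Longrightarrow> (\<And>z. z \<in> S \<Longrightarrow> f z = g z) \<Longrightarrow> R g"
begin

lemma scale: "R f \<Longrightarrow> R (\<lambda>z. c * f z)"
  by (intro mult const)

lemma minus: "R f \<Longrightarrow> R (\<lambda>z. - f z)"
  using scale[of f "-1"] by simp

lemma diff: "R f \<Longrightarrow> R g \<Longrightarrow> R (\<lambda>z. f z - g z)"
  using add[OF _ minus, of f g] by simp

lemma power: "R f \<Longrightarrow> R (\<lambda>z. f z ^ k)"
  by (induction k) (simp_all add: const mult)

lemma divide:
  assumes "R f" "R g" "\<And>z. z \<in> S \<Longrightarrow> g z \<noteq> 0"
  shows "R (\<lambda>z. f z / g z)"
  using mult[OF assms(1) recip[OF assms(2,3)]] by simp

lemma polynomial: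
  assumes "polynomial_fun n P" "\<And>i. i < n \<Longrightarrow> R (\<lambda>z. h z i)"
  shows "R (\<lambda>z. P (h z))"
  using assms by induction (simp_all add: const add mult)

end

lemma function_algebra_continuous:
  fixes S :: "'z::topological_space set"
  shows "function_algebra S (continuous_on S)"
proof
  show "continuous_on S g" if "continuous_on S f" "\<And>z. z \<in> S \<Longrightarrow> f z = g z" for f g :: "'z \<Rightarrow> real"
    using that continuous_on_cong[of S S f g] by simp
qed (auto intro!: continuous_intros)

section \<open>Functions given by one quotient of polynomials\<close>

definition rational_on :: "nat \<Rightarrow> (nat \<Rightarrow> real) set \<Rightarrow> ((nat \<Rightarrow> real) \<Rightarrow> real) \<Rightarrow> bool" where
  "rational_on n S f \<longleftrightarrow> (\<exists>P Q. polynomial_fun n P \<and> polynomial_fun n Q \<and>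
     (\<forall>x\<in>S. Q x \<noteq> 0 \<and> f x = P x / Q x))"

lemma rational_onI:
  "polynomial_fun n P \<Longrightarrow> polynomial_fun n Q \<Longrightarrow> (\<And>x. x \<in> S \<Longrightarrow> Q x \<noteq> 0) \<Longrightarrow>
   (\<And>x. x \<in> S \<Longrightarrow> f x = P x / Q x) \<Longrightarrow> rational_on n S f"
  unfolding rational_on_def by blast

lemma rational_onE:
  assumes "rational_on n S f"
  obtains P Q where "polynomial_fun n P" "polynomial_fun n Q" "\<And>x. x \<in> S \<Longrightarrow> Q x \<noteq> 0"
    "\<And>x. x \<in> S \<Longrightarrow> f x = P x / Q x"
  using assms unfolding rational_on_def by blast

lemma rational_on_polynomial: "polynomial_fun n P \<Longrightarrow> rational_on n S P"
  by (rule rational_onI[of n P "\<lambda>_. 1"]) auto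

lemma rational_on_subset: "rational_on n S f \<Longrightarrow> T \<subseteq> S \<Longrightarrow> rational_on n T f"
  unfolding rational_on_def by blast

lemma function_algebra_rational: "function_algebra S (rational_on n S)"
proof
  fix f g assume f: "rational_on n S f" and g: "rational_on n S g"
  from f obtain P Q where PQ: "polynomial_fun n P" "polynomial_fun n Q"
    "\<And>x. x \<in> S \<Longrightarrow> Q x \<noteq> 0" "\<And>x. x \<in> S \<Longrightarrow> f x = P x / Q x" by (rule rational_onE) (rule that)
  from g obtain P' Q' where PQ': "polynomial_fun n P'" "polynomial_fun n Q'"
    "\<And>x. x \<in> S \<Longrightarrow> Q' x \<noteq> 0" "\<And>x. x \<in> S \<Longrightarrow> g x = P' x / Q' x" by (rule rational_onE) (rule that)
  show "rational_on n S (\<lambda>z. f z + g z)"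
    by (rule rational_onI[of n "\<lambda>x. P x * Q' x + P' x * Q x" "\<lambda>x. Q x * Q' x"])
      (use PQ PQ' in \<open>auto simp: add_frac_eq\<close>)
  show "rational_on n S (\<lambda>z. f z * g z)"
    by (rule rational_onI[of n "\<lambda>x. P x * P' x" "\<lambda>x. Q x * Q' x"]) (use PQ PQ' in auto)
next
  fix f assume rat: "rational_on n S f" and f: "\<And>z. z \<in> S \<Longrightarrow> f z \<noteq> 0"
  from rat obtain P Q where PQ: "polynomial_fun n P" "polynomial_fun n Q"
    "\<And>x. x \<in> S \<Longrightarrow> Q x \<noteq> 0" "\<And>x. x \<in> S \<Longrightarrow> f x = P x / Q x" by (rule rational_onE) (rule that)
  then show "rational_on n S (\<lambda>z. 1 / f z)"
    by (intro rational_onI[of n Q P]) (use f in force)+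
next
  fix f g assume "rational_on n S f" and "\<And>z. z \<in> S \<Longrightarrow> f z = g z"
  then show "rational_on n S g" unfolding rational_on_def by metis
qed (auto intro: rational_on_polynomial)

lemma rational_on_continuous:
  assumes "rational_on n S f"
  shows "continuous_on S f"
proof -
  interpret function_algebra S "continuous_on S :: (_ \<Rightarrow> real) \<Rightarrow> bool" by (rule function_algebra_continuous)
  obtain P Q where PQ: "polynomial_fun n P" "polynomial_fun n Q" "\<And>x. x \<in> S \<Longrightarrow> Q x \<noteq> 0"
    "\<And>x. x \<in> S \<Longrightarrow> f x = P x / Q x" using assms by (rule rational_onE) (rule that)
  have "continuous_on S (\<lambda>x. P x / Q x)"
    by (intro divide polynomial_fun_continuous_on[OF PQ(1)] polynomial_fun_continuous_on[OF PQ(2)] PQ(3))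
  then show ?thesis by (rule cong) (simp add: PQ(4))
qed

lemma rational_on_common_denominator:
  fixes k :: nat
  assumes "\<And>i. i < k \<Longrightarrow> rational_on n S (f i)"
  shows "\<exists>P Q. (\<forall>i<k. polynomial_fun n (P i)) \<and> polynomial_fun n Q \<and>
    (\<forall>x\<in>S. Q x \<noteq> 0 \<and> (\<forall>i<k. f i x = P i x / Q x))"
proof -
  have "\<forall>i. \<exists>P Q. i < k \<longrightarrow> polynomial_fun n P \<and> polynomial_fun n Q \<and>
     (\<forall>x\<in>S. Q x \<noteq> 0 \<and> f i x = P x / Q x)"
    using assms unfolding rational_on_def by blast
  then obtain P Q where PQ: "\<And>i. i < k \<Longrightarrow> polynomial_fun n (P i) \<and> polynomial_fun n (Q i) \<and>
     (\<forall>x\<in>S. Q i x \<noteq> 0 \<and> f i x = P i x / Q i x)" unfolding choice_iff by blast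
  have nz: "Q i x \<noteq> 0" if "x \<in> S" "i < k" for i x using PQ[OF that(2)] that(1) by blast
  let ?Q = "\<lambda>x. \<Prod>j<k. Q j x"
  let ?P = "\<lambda>i x. P i x * (\<Prod>j\<in>{..<k} - {i}. Q j x)"
  have "polynomial_fun n (?P i)" if "i < k" for i
    using PQ that by (intro polynomial_fun.mult polynomial_fun_prod) auto
  moreover have "polynomial_fun n ?Q" using PQ by (intro polynomial_fun_prod) auto
  moreover have "?Q x \<noteq> 0" if "x \<in> S" for x using nz[OF that] by simp
  moreover have "f i x = ?P i x / ?Q x" if "x \<in> S" "i < k" for i x
  proof -
    have "?Q x = Q i x * (\<Prod>j\<in>{..<k} - {i}. Q j x)" using that(2) by (intro prod.remove) auto
    moreover have "(\<Prod>j\<in>{..<k} - {i}. Q j x) \<noteq> 0" using nz[OF that(1)] by simp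
    ultimately show ?thesis using PQ[OF that(2)] that(1) by simp
  qed
  ultimately show ?thesis by (intro exI[of _ ?P] exI[of _ ?Q]) blast
qed

text \<open>If \<open>f = P / Q\<close> on \<open>Z\<close> and \<open>\<Phi>\<close> vanishes in
  R^m exactly on \<open>Z\<close>, then \<open>P * Q / (Q^2 + \<Phi>)\<close> extends
  \<open>f\<close> to R^m. This extension \<open>h\<close> is divided by
  \<open>1 + c * \<Phi> * (1 + h^2)\<close>, which is 1 on \<open>Z\<close> and exceeds
  \<open>|h|\<close> everywhere provided that \<open>c * \<Phi> \<ge> 1\<close> wherever
  \<open>|h| \<ge> 1\<close>. Such a \<open>c\<close> exists because \<open>\<Phi>\<close> is
  bounded below at infinity.\<close>

lemma rational_extension_bounded:
  assumes Z: "closedin (zariski_topology m) Z" "compact Z"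
    and f: "rational_on m Z f" "\<And>x. x \<in> Z \<Longrightarrow> \<bar>f x\<bar> < 1"
  shows "\<exists>g. rational_on m (rn m) g \<and> (\<forall>x\<in>Z. g x = f x) \<and> (\<forall>x\<in>rn m. \<bar>g x\<bar> < 1)"
proof -
  obtain \<phi> where \<phi>: "polynomial_fun m \<phi>" "\<And>x. \<phi> x \<ge> 0" "Z = {x \<in> rn m. \<phi> x = 0}"
    using closedin_zariski_single_equation[OF Z(1)] by blast
  let ?s = "\<lambda>x::nat\<Rightarrow>real. \<Sum>i<m. (x i)\<^sup>2"
  have "polynomial_fun m ?s" by (intro polynomial_fun_intros) auto
  then have "compact (?s ` Z)" using Z(2) by (intro compact_continuous_image polynomial_fun_continuous_on)
  then obtain b where b: "\<forall>y\<in>?s ` Z. \<bar>y\<bar> \<le> b" using compact_imp_bounded bounded_real by metis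
  define r where "r = \<bar>b\<bar> + 1"
  have r: "r \<ge> 0" "\<And>x. x \<in> rn m \<Longrightarrow> \<phi> x = 0 \<Longrightarrow> ?s x < r"
    using b \<phi>(3) by (auto simp: r_def)
  obtain \<Phi> where \<Phi>: "polynomial_fun m \<Phi>" "\<And>x. \<Phi> x \<ge> 0" "\<And>x. \<Phi> x = 0 \<longleftrightarrow> \<phi> x = 0"
    "\<And>x. x \<in> rn m \<Longrightarrow> ?s x \<ge> r \<Longrightarrow> \<Phi> x \<ge> 1"
    using compact_zero_set_separating_polynomial[OF \<phi>(1,2) r] by blast
  have inZ: "x \<in> Z" if "x \<in> rn m" "\<Phi> x = 0" for x using that \<Phi>(3) \<phi>(3) by blast
  have Z0: "\<Phi> x = 0" if "x \<in> Z" for x using that \<Phi>(3) \<phi>(3) by blast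
  obtain P Q where PQ: "polynomial_fun m P" "polynomial_fun m Q" "\<And>x. x \<in> Z \<Longrightarrow> Q x \<noteq> 0"
    "\<And>x. x \<in> Z \<Longrightarrow> f x = P x / Q x" using f(1) by (rule rational_onE) (rule that)
  have den: "(Q x)\<^sup>2 + \<Phi> x > 0" if "x \<in> rn m" for x
  proof (cases "\<Phi> x = 0")
    case True
    then show ?thesis using PQ(3)[OF inZ[OF that True]] by simp
  next
    case False
    then show ?thesis using \<Phi>(2)[of x] by (intro add_nonneg_pos) auto
  qed
  define h where "h x = P x * Q x / ((Q x)\<^sup>2 + \<Phi> x)" for x
  interpret function_algebra "rn m" "rational_on m (rn m)" by (rule function_algebra_rational)
  have pol: "rational_on m (rn m) P" "rational_on m (rn m) Q" "rational_on m (rn m) \<Phi>"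
    using PQ(1,2) \<Phi>(1) by (auto intro: rational_on_polynomial)
  have hrat: "rational_on m (rn m) (\<lambda>x. P x * Q x / ((Q x)\<^sup>2 + \<Phi> x))"
    by (intro divide mult add power pol) (use den in force)
  then have hrat: "rational_on m (rn m) h" by (simp add: h_def[abs_def])
  have hf: "h x = f x" if "x \<in> Z" for x
    using PQ(3,4)[OF that] Z0[OF that] by (simp add: h_def power2_eq_square)
  let ?K = "{x \<in> rn m. \<forall>i<m. \<bar>x i\<bar> \<le> 1 + r}"
  \<comment> \<open>This is positive on the box: \<open>\<Phi>\<close> vanishes only on
    \<open>Z\<close>, where \<open>|h| < 1\<close>. At points with \<open>|h| \<ge> 1\<close> the
    second entry is not positive, so the minimum of \<open>?\<psi>\<close> is there a lower bound
    for \<open>\<Phi>\<close>.\<close>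
  let ?\<psi> = "\<lambda>x. max (\<Phi> x) (1 - \<bar>h x\<bar>)"
  have inK: "x \<in> ?K" if x: "x \<in> rn m" "?s x < r" for x
  proof -
    have "\<bar>x i\<bar> \<le> 1 + r" if "i < m" for i
    proof -
      have "(x i)\<^sup>2 \<le> ?s x" using that by (intro member_le_sum) auto
      then have "(x i)\<^sup>2 \<le> r" using x(2) by simp
      moreover have "2 * \<bar>x i\<bar> \<le> 1 + (x i)\<^sup>2"
        using zero_le_power2[of "\<bar>x i\<bar> - 1"] by (simp add: power2_eq_square algebra_simps flip: abs_mult)
      ultimately show ?thesis using r(1) by linarith
    qed
    then show ?thesis using x(1) by simp
  qed
  have "(\<lambda>_. 0) \<in> ?K" using r(1) by (simp add: rn_iff)
  moreover have "continuous_on ?K h"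
    using rational_on_continuous[OF rational_on_subset[OF hrat]] by simp
  then have "continuous_on ?K ?\<psi>"
    by (intro continuous_intros polynomial_fun_continuous_on[OF \<Phi>(1)])
  ultimately obtain z where z: "z \<in> ?K" "\<forall>x\<in>?K. ?\<psi> z \<le> ?\<psi> x"
    using continuous_attains_inf[OF compact_coordinate_box, of m "1 + r" ?\<psi>] by blast
  define \<delta> where "\<delta> = ?\<psi> z"
  have \<delta>: "\<delta> > 0"
  proof (cases "\<Phi> z = 0")
    case True
    then have "\<bar>h z\<bar> < 1" using inZ[of z] z(1) hf[of z] f(2)[of z] by simp
    then show ?thesis by (simp add: \<delta>_def)
  next
    case False
    then show ?thesis using \<Phi>(2)[of z] by (simp add: \<delta>_def less_max_iff_disj)
  qed
  \<comment> \<open>\<open>c \<ge> 1\<close> serves the region where \<open>\<Phi> \<ge> 1\<close>,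
    and \<open>c * \<delta> \<ge> 1\<close> the points of the box where
    \<open>|h| \<ge> 1\<close>.\<close>
  define c where "c = 1 / \<delta> + 1"
  have c: "c \<ge> 1" "c * \<delta> \<ge> 1" using \<delta> by (simp_all add: c_def distrib_right)
  define g where "g x = h x / (1 + c * \<Phi> x * (1 + (h x)\<^sup>2))" for x
  have gden: "1 + c * \<Phi> x * (1 + (h x)\<^sup>2) \<ge> 1" for x
    using c(1) \<Phi>(2)[of x] by simp
  have "\<bar>g x\<bar> < 1" if x: "x \<in> rn m" for x
  proof -
    have "\<bar>h x\<bar> < 1 + c * \<Phi> x * (1 + (h x)\<^sup>2)"
    proof (cases "\<bar>h x\<bar> < 1")
      case True
      then show ?thesis using gden[of x] by linarith
    next
      case False
      have "c * \<Phi> x \<ge> 1"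
      proof (cases "?s x \<ge> r")
        case True
        then show ?thesis using mult_mono[of 1 c 1 "\<Phi> x"] \<Phi>(4)[OF x True] c(1) by simp
      next
        case False
        then have "?\<psi> z \<le> ?\<psi> x" using inK[OF x] z(2) by force
        then have "\<delta> \<le> \<Phi> x" using \<open>\<not> \<bar>h x\<bar> < 1\<close> \<delta> unfolding \<delta>_def by linarith
        then show ?thesis using c mult_left_mono[of \<delta> "\<Phi> x" c] by linarith
      qed
      then have "1 * (1 + (h x)\<^sup>2) \<le> c * \<Phi> x * (1 + (h x)\<^sup>2)" by (intro mult_right_mono) auto
      then have "1 + (1 + (h x)\<^sup>2) \<le> 1 + c * \<Phi> x * (1 + (h x)\<^sup>2)" by simp
      moreover have "2 * \<bar>h x\<bar> \<le> 1 + (h x)\<^sup>2"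
        using zero_le_power2[of "\<bar>h x\<bar> - 1"] by (simp add: power2_eq_square algebra_simps flip: abs_mult)
      then have "\<bar>h x\<bar> < 1 + (1 + (h x)\<^sup>2)" using zero_le_power2[of "h x"] by linarith
      ultimately show ?thesis by (rule less_le_trans[rotated])
    qed
    then show ?thesis using gden[of x] unfolding g_def by (simp add: abs_divide)
  qed
  moreover have "rational_on m (rn m) (\<lambda>x. h x / (1 + c * \<Phi> x * (1 + (h x)\<^sup>2)))"
    by (intro divide add mult power const pol hrat) (use gden in \<open>smt (verit)\<close>)
  then have "rational_on m (rn m) g" by (simp add: g_def[abs_def])
  moreover have "g x = f x" if "x \<in> Z" for x using Z0[OF that] hf[OF that] by (simp add: g_def)
  ultimately show ?thesis by blast
qed

section \<open>Finite differences\<close>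

text \<open>Polynomial expressions in a base point, a direction and two step lengths. The inductive
  form lets membership in a function algebra pass to such expressions by rule induction.\<close>

inductive palg4 :: "nat \<Rightarrow> ((nat \<Rightarrow> real) \<Rightarrow> (nat \<Rightarrow> real) \<Rightarrow> real \<Rightarrow> real \<Rightarrow> real) \<Rightarrow> bool" for p where
  const: "palg4 p (\<lambda>y d t u. c)"
| base: "i < p \<Longrightarrow> palg4 p (\<lambda>y d t u. y i)"
| dir: "i < p \<Longrightarrow> palg4 p (\<lambda>y d t u. d i)"
| fst: "palg4 p (\<lambda>y d t u. t)"
| snd: "palg4 p (\<lambda>y d t u. u)"
| add: "palg4 p F \<Longrightarrow> palg4 p G \<Longrightarrow> palg4 p (\<lambda>y d t u. F y d t u + G y d t u)"
| mult: "palg4 p F \<Longrightarrow> palg4 p G \<Longrightarrow> palg4 p (\<lambda>y d t u. F y d t u * G y d t u)"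

lemma palg4_polynomial: "polynomial_fun p P \<Longrightarrow> palg4 p (\<lambda>y d t u. P y)"
  by (induction rule: polynomial_fun.induct) (simp_all add: palg4.intros)

lemma (in function_algebra) palg4:
  assumes "palg4 p F" "\<And>i. i < p \<Longrightarrow> R (\<lambda>z. y z i)" "\<And>i. i < p \<Longrightarrow> R (\<lambda>z. d z i)" "R t" "R u"
  shows "R (\<lambda>z. F (y z) (d z) (t z) (u z))"
  using assms by induction (simp_all add: const add mult)

text \<open>The bound is polynomial in the base point and uniform over directions and step lengths
  in the unit cube; this is what allows a polynomial damping factor in the sprays.\<close>

lemma palg4_bound:
  assumes "palg4 p F"
  shows "\<exists>M. polynomial_fun p M \<and> (\<forall>y. M y \<ge> 0) \<and>
    (\<forall>y d t u. (\<forall>i<p. \<bar>d i\<bar> \<le> 1) \<longrightarrow> \<bar>t\<bar> \<le> 1 \<longrightarrow> \<bar>u\<bar> \<le> 1 \<longrightarrow> \<bar>F y d t u\<bar> \<le> M y)"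
  using assms
proof induction
  case (const c)
  show ?case by (rule exI[of _ "\<lambda>_. \<bar>c\<bar>"]) auto
next
  case (base i)
  have "\<bar>a\<bar> \<le> 1 + a * a" for a :: real
    using zero_le_square[of "\<bar>a\<bar> - 1"] by (simp add: algebra_simps flip: abs_mult)
  with base show ?case
    by (intro exI[of _ "\<lambda>y. 1 + y i * y i"] conjI polynomial_fun.intros) auto
next
  case (add F G)
  then obtain M N where *: "polynomial_fun p M" "polynomial_fun p N" "\<forall>y. M y \<ge> 0" "\<forall>y. N y \<ge> 0"
    "\<forall>y d t u. (\<forall>i<p. \<bar>d i\<bar> \<le> 1) \<longrightarrow> \<bar>t\<bar> \<le> 1 \<longrightarrow> \<bar>u\<bar> \<le> 1 \<longrightarrow> \<bar>F y d t u\<bar> \<le> M y"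
    "\<forall>y d t u. (\<forall>i<p. \<bar>d i\<bar> \<le> 1) \<longrightarrow> \<bar>t\<bar> \<le> 1 \<longrightarrow> \<bar>u\<bar> \<le> 1 \<longrightarrow> \<bar>G y d t u\<bar> \<le> N y"
    by (elim exE conjE) (rule that)
  have "\<bar>F y d t u + G y d t u\<bar> \<le> M y + N y"
    if "\<forall>i<p. \<bar>d i\<bar> \<le> 1" "\<bar>t\<bar> \<le> 1" "\<bar>u\<bar> \<le> 1" for y d t u
  proof -
    have "\<bar>F y d t u\<bar> \<le> M y" "\<bar>G y d t u\<bar> \<le> N y" using *(5,6) that by simp_all
    then show ?thesis by linarith
  qed
  with * show ?case
    by (intro exI[of _ "\<lambda>y. M y + N y"] conjI polynomial_fun.add allI impI) simp_all
next
  case (mult F G)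
  then obtain M N where *: "polynomial_fun p M" "polynomial_fun p N" "\<forall>y. M y \<ge> 0" "\<forall>y. N y \<ge> 0"
    "\<forall>y d t u. (\<forall>i<p. \<bar>d i\<bar> \<le> 1) \<longrightarrow> \<bar>t\<bar> \<le> 1 \<longrightarrow> \<bar>u\<bar> \<le> 1 \<longrightarrow> \<bar>F y d t u\<bar> \<le> M y"
    "\<forall>y d t u. (\<forall>i<p. \<bar>d i\<bar> \<le> 1) \<longrightarrow> \<bar>t\<bar> \<le> 1 \<longrightarrow> \<bar>u\<bar> \<le> 1 \<longrightarrow> \<bar>G y d t u\<bar> \<le> N y"
    by (elim exE conjE) (rule that)
  have "\<bar>F y d t u * G y d t u\<bar> \<le> M y * N y"
    if "\<forall>i<p. \<bar>d i\<bar> \<le> 1" "\<bar>t\<bar> \<le> 1" "\<bar>u\<bar> \<le> 1" for y d t u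
    unfolding abs_mult using * that by (intro mult_mono) simp_all
  with * show ?case
    by (intro exI[of _ "\<lambda>y. M y * N y"] conjI polynomial_fun.mult allI impI) simp_all
qed (auto intro!: exI[of _ "\<lambda>_. 1"])

text \<open>\<open>W\<close> is the first and \<open>V\<close> the second divided difference of
  \<open>P\<close> along the line through \<open>y\<close> in direction \<open>d\<close>. Since both
  are polynomial, zeros of \<open>P\<close> at points of a line become factors. The clause for
  direction 0 ensures that nothing moves on the diagonal.\<close>

definition difference_quotients ::
    "nat \<Rightarrow> ((nat \<Rightarrow> real) \<Rightarrow> real) \<Rightarrow> ((nat \<Rightarrow> real) \<Rightarrow> (nat \<Rightarrow> real) \<Rightarrow> real \<Rightarrow> real) \<Rightarrow>
     ((nat \<Rightarrow> real) \<Rightarrow> (nat \<Rightarrow> real) \<Rightarrow> real \<Rightarrow> real \<Rightarrow> real) \<Rightarrow> bool" where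
  "difference_quotients p P W V \<longleftrightarrow>
     palg4 p (\<lambda>y d t u. W y d t) \<and> palg4 p (\<lambda>y d t u. W y d u) \<and> palg4 p V \<and>
     (\<forall>y d t. P (\<lambda>i. y i + t * d i) = P y + t * W y d t) \<and>
     (\<forall>y d t u. W y d t - W y d u = (t - u) * V y d t u) \<and>
     (\<forall>y d t u. (\<forall>i<p. d i = 0) \<longrightarrow> W y d t = 0 \<and> V y d t u = 0)"

lemma difference_quotients_shift:
  "difference_quotients p P W V \<Longrightarrow> P (\<lambda>i. y i + t * d i) = P y + t * W y d t"
  by (simp add: difference_quotients_def)

lemma difference_quotients_second:
  "difference_quotients p P W V \<Longrightarrow> W y d t - W y d u = (t - u) * V y d t u"
  by (simp add: difference_quotients_def)

lemma difference_quotients_zero: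
  "difference_quotients p P W V \<Longrightarrow> (\<And>i. i < p \<Longrightarrow> d i = 0) \<Longrightarrow> W y d t = 0"
  "difference_quotients p P W V \<Longrightarrow> (\<And>i. i < p \<Longrightarrow> d i = 0) \<Longrightarrow> V y d t u = 0"
  by (simp_all add: difference_quotients_def)

lemma difference_quotients_exist:
  assumes "polynomial_fun p P"
  shows "\<exists>W V. difference_quotients p P W V"
  using assms
proof induction
  case (const c)
  show ?case
    by (rule exI[of _ "\<lambda>y d t. 0"], rule exI[of _ "\<lambda>y d t u. 0"])
      (simp add: difference_quotients_def palg4.intros)
next
  case (coord i)
  then show ?case
    by (intro exI[of _ "\<lambda>y d t. d i"] exI[of _ "\<lambda>y d t u. 0"])
      (simp add: difference_quotients_def palg4.intros)
next
  case (add P Q)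
  then obtain W V W' V' where *: "difference_quotients p P W V" "difference_quotients p Q W' V'" by blast
  have "difference_quotients p (\<lambda>x. P x + Q x) (\<lambda>y d t. W y d t + W' y d t) (\<lambda>y d t u. V y d t u + V' y d t u)"
    unfolding difference_quotients_def
  proof (intro conjI allI impI)
    fix y d t u
    have "W y d t - W y d u = (t - u) * V y d t u" "W' y d t - W' y d u = (t - u) * V' y d t u"
      using * by (simp_all add: difference_quotients_def)
    then show "W y d t + W' y d t - (W y d u + W' y d u) = (t - u) * (V y d t u + V' y d t u)"
      by (simp add: algebra_simps)
  qed (use * in \<open>simp_all add: difference_quotients_def palg4.intros algebra_simps\<close>)
  then show ?case by blast
next
  case (mult P Q)
  then obtain W V W' V' where *: "difference_quotients p P W V" "difference_quotients p Q W' V'" by blast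
  let ?W = "\<lambda>y d t. W y d t * Q y + P y * W' y d t + t * (W y d t * W' y d t)"
  \<comment> \<open>This comes from expanding \<open>?W\<close> at \<open>t\<close> and at
    \<open>u\<close> and dividing the difference by \<open>t - u\<close>; the explicit factor
    \<open>t\<close> in \<open>?W\<close> contributes the last product \<open>W * W'\<close> and the
    terms with \<open>u\<close>.\<close>
  let ?V = "\<lambda>y d t u. V y d t u * Q y + P y * V' y d t u + W y d t * W' y d t
      + u * (V y d t u * W' y d t + W y d u * V' y d t u)"
  have "difference_quotients p (\<lambda>x. P x * Q x) ?W ?V"
    unfolding difference_quotients_def
  proof (intro conjI allI impI)
    show "palg4 p (\<lambda>y d t u. ?W y d t)" "palg4 p (\<lambda>y d t u. ?W y d u)" "palg4 p ?V"
      using * palg4_polynomial[OF mult(1)] palg4_polynomial[OF mult(2)]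
      by (simp_all add: difference_quotients_def palg4.intros)
    fix y d t u
    show "P (\<lambda>i. y i + t * d i) * Q (\<lambda>i. y i + t * d i) = P y * Q y + t * ?W y d t"
      using * by (simp add: difference_quotients_def algebra_simps)
    have "W y d t - W y d u = (t - u) * V y d t u" "W' y d t - W' y d u = (t - u) * V' y d t u"
      using * by (simp_all add: difference_quotients_def)
    then have W: "W y d t = W y d u + (t - u) * V y d t u" "W' y d t = W' y d u + (t - u) * V' y d t u"
      by linarith+
    show "?W y d t - ?W y d u = (t - u) * ?V y d t u"
      unfolding W by (simp add: algebra_simps)
  qed (use * in \<open>simp_all add: difference_quotients_def\<close>)
  then show ?case by blast
qed

section \<open>Sprays obtained from local regular retractions\<close>

(* x - N x / E x is a retraction of the Zariski open set where E does not vanish onto a subset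
   of B; the factor E^2 / M makes all sprays below defined over the whole of B. *)
locale spray_chart =
  fixes p :: nat and B :: "(nat \<Rightarrow> real) set" and E :: "(nat \<Rightarrow> real) \<Rightarrow> real"
    and N :: "nat \<Rightarrow> (nat \<Rightarrow> real) \<Rightarrow> real"
    and WE :: "(nat \<Rightarrow> real) \<Rightarrow> (nat \<Rightarrow> real) \<Rightarrow> real \<Rightarrow> real"
    and VE :: "(nat \<Rightarrow> real) \<Rightarrow> (nat \<Rightarrow> real) \<Rightarrow> real \<Rightarrow> real \<Rightarrow> real"
    and WN :: "nat \<Rightarrow> (nat \<Rightarrow> real) \<Rightarrow> (nat \<Rightarrow> real) \<Rightarrow> real \<Rightarrow> real"
    and VN :: "nat \<Rightarrow> (nat \<Rightarrow> real) \<Rightarrow> (nat \<Rightarrow> real) \<Rightarrow> real \<Rightarrow> real \<Rightarrow> real"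
    and M :: "(nat \<Rightarrow> real) \<Rightarrow> real"
  assumes B: "B \<subseteq> rn p"
    and E: "polynomial_fun p E" and M: "polynomial_fun p M"
    and retract: "\<And>x. x \<in> rn p \<Longrightarrow> E x \<noteq> 0 \<Longrightarrow> (\<lambda>l. if l < p then x l - N l x / E x else 0) \<in> B"
    and N_zero: "\<And>l y. l < p \<Longrightarrow> y \<in> B \<Longrightarrow> N l y = 0"
    and dqE: "difference_quotients p E WE VE"
    and dqN: "\<And>l. l < p \<Longrightarrow> difference_quotients p (N l) (WN l) (VN l)"
    and M_ge: "\<And>y. M y \<ge> 1" "\<And>y. (E y)\<^sup>2 \<le> M y"
    and M_bound: "\<And>y d t. (\<forall>i<p. \<bar>d i\<bar> \<le> 1) \<Longrightarrow> 0 \<le> t \<Longrightarrow> t \<le> 1 \<Longrightarrow> 2 * (\<bar>E y\<bar> * \<bar>WE y d t\<bar>) \<le> M y"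
begin

definition kap :: "(nat \<Rightarrow> real) \<Rightarrow> real" where
  "kap y = (E y)\<^sup>2 / M y"

text \<open>The relative change of \<open>E\<close>: where \<open>E y \<noteq> 0\<close> it is
  \<open>E (y + kap y * v) / E y - 1\<close>. Division by \<open>M\<close> keeps its absolute value
  at most 1/2 for velocities in the unit cube.\<close>

definition eps :: "(nat \<Rightarrow> real) \<Rightarrow> (nat \<Rightarrow> real) \<Rightarrow> real" where
  "eps y v = E y / M y * WE y v (kap y)"

text \<open>For \<open>y\<close> in \<open>B\<close> this is the retraction applied to
  \<open>y + kap y * v\<close>, with a factor \<open>E y\<close> cancelled: \<open>N\<close>
  vanishes at \<open>y\<close>, so its value at the shifted point is \<open>kap y * WN\<close>, and
  \<open>kap y / E y = E y / M y\<close>. The cancelled form also makes sense where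
  \<open>E y = 0\<close>, and there it leaves \<open>y\<close> fixed.\<close>

definition spray :: "(nat \<Rightarrow> real) \<Rightarrow> (nat \<Rightarrow> real) \<Rightarrow> nat \<Rightarrow> real" where
  "spray y v l = (if l < p then y l + kap y * v l - E y / M y * WN l y v (kap y) / (1 + eps y v) else 0)"

lemma M_pos: "M y > 0"
  using M_ge(1)[of y] by linarith

lemma kap_bounds: "0 \<le> kap y" "kap y \<le> 1"
  using M_pos[of y] M_ge(2)[of y] by (simp_all add: kap_def)

lemma eps_bound:
  assumes "\<forall>i<p. \<bar>v i\<bar> \<le> 1"
  shows "1 + eps y v > 0"
proof -
  have "2 * \<bar>eps y v\<bar> = 2 * (\<bar>E y\<bar> * \<bar>WE y v (kap y)\<bar>) / M y"
    using M_pos[of y] by (simp add: eps_def abs_mult)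
  also have "\<dots> \<le> 1" using M_bound[OF assms kap_bounds] M_pos[of y] by simp
  finally show ?thesis by linarith
qed

lemma E_shift:
  "E (\<lambda>i. y i + kap y * v i) = E y * (1 + eps y v)"
proof -
  have "E (\<lambda>i. y i + kap y * v i) = E y + kap y * WE y v (kap y)"
    using dqE by (simp add: difference_quotients_def)
  then show ?thesis by (simp add: eps_def kap_def power2_eq_square algebra_simps)
qed

lemma spray_eq:
  assumes "l < p" "y \<in> B" "E y \<noteq> 0"
  shows "spray y v l = (y l + kap y * v l) -
    N l (\<lambda>i. y i + kap y * v i) / E (\<lambda>i. y i + kap y * v i)"
proof -
  have "N l (\<lambda>i. y i + kap y * v i) = kap y * WN l y v (kap y)"
    using dqN[OF assms(1)] N_zero[OF assms(1,2)] by (simp add: difference_quotients_def)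
  then show ?thesis unfolding E_shift using assms(1,3)
    by (simp add: spray_def kap_def[of y] power2_eq_square)
qed

lemma spray_E_zero:
  assumes "y \<in> B" "E y = 0"
  shows "spray y v = y"
proof
  fix l
  have "l \<ge> p \<Longrightarrow> y l = 0" using assms(1) B by (auto simp: rn_iff)
  then show "spray y v l = y l" using assms(2) by (simp add: spray_def kap_def)
qed

lemma spray_in:
  assumes y: "y \<in> B" and v: "v \<in> rn p" "\<forall>i<p. \<bar>v i\<bar> \<le> 1"
  shows "spray y v \<in> B"
proof (cases "E y = 0")
  case True
  then show ?thesis using spray_E_zero[OF y] y by simp
next
  case False
  let ?x = "\<lambda>i. y i + kap y * v i"
  have "?x \<in> rn p" using y v B by (auto simp: rn_iff)
  moreover have "E ?x \<noteq> 0" unfolding E_shift using False eps_bound[OF v(2), of y] by simp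
  ultimately have "(\<lambda>l. if l < p then ?x l - N l ?x / E ?x else 0) \<in> B" by (rule retract)
  moreover have "(\<lambda>l. if l < p then ?x l - N l ?x / E ?x else 0) = spray y v"
  proof
    fix l show "(if l < p then ?x l - N l ?x / E ?x else 0) = spray y v l"
      using spray_eq[OF _ y False, of l v] by (simp add: spray_def)
  qed
  ultimately show ?thesis by simp
qed

lemma palg4_parts:
  "palg4 p (\<lambda>y d t u. WE y d t)" "l < p \<Longrightarrow> palg4 p (\<lambda>y d t u. WN l y d t)" "l < p \<Longrightarrow> palg4 p (VN l)"
  using dqE dqN by (simp_all add: difference_quotients_def)

lemma algebra_spray:
  assumes "function_algebra S R" and y: "\<And>i. i < p \<Longrightarrow> R (\<lambda>z. y z i)" and v: "\<And>i. i < p \<Longrightarrow> R (\<lambda>z. v z i)"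
    and bound: "\<And>z i. z \<in> S \<Longrightarrow> i < p \<Longrightarrow> \<bar>v z i\<bar> \<le> 1"
  shows "R (\<lambda>z. E (y z))" "R (\<lambda>z. M (y z))" "R (\<lambda>z. 1 + eps (y z) (v z))" "R (\<lambda>z. spray (y z) (v z) l)"
proof -
  interpret function_algebra S R by fact
  show Ey: "R (\<lambda>z. E (y z))" and My: "R (\<lambda>z. M (y z))" using E M y by (blast intro: polynomial)+
  have M0: "M (y z) \<noteq> 0" for z using M_pos[of "y z"] by simp
  have k: "R (\<lambda>z. kap (y z))" unfolding kap_def by (intro divide power Ey My M0)
  have "R (\<lambda>z. WE (y z) (v z) (kap (y z)))" by (rule palg4[OF palg4_parts(1) y v k const])
  then show e: "R (\<lambda>z. 1 + eps (y z) (v z))"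
    unfolding eps_def by (intro add mult divide const Ey My M0)
  have e0: "1 + eps (y z) (v z) \<noteq> 0" if "z \<in> S" for z
    using eps_bound[of "v z" "y z"] bound[OF that] by simp
  show "R (\<lambda>z. spray (y z) (v z) l)"
  proof (cases "l < p")
    case True
    have "R (\<lambda>z. WN l (y z) (v z) (kap (y z)))" by (rule palg4[OF palg4_parts(2)[OF True] y v k const])
    then have "R (\<lambda>z. E (y z) / M (y z) * WN l (y z) (v z) (kap (y z)) / (1 + eps (y z) (v z)))"
      by (rule divide[OF mult[OF divide[OF Ey My M0]] e e0])
    then have "R (\<lambda>z. y z l + kap (y z) * v z l - E (y z) / M (y z) * WN l (y z) (v z) (kap (y z)) / (1 + eps (y z) (v z)))"
      by (rule diff[OF add[OF y[OF True] mult[OF k v[OF True]]]])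
    then show ?thesis using True by (simp add: spray_def)
  next
    case False
    then show ?thesis by (simp add: spray_def const)
  qed
qed

end

text \<open>For a retraction \<open>c / e\<close> the obvious numerator \<open>e * x - c\<close> is
  known to vanish only at those points of \<open>B\<close> where \<open>e\<close> does not.
  Multiplying numerator and denominator by \<open>e\<close> makes it vanish on all of
  \<open>B\<close>; hence \<open>E\<close> is the square of \<open>e\<close>.\<close>

lemma spray_chart_exists:
  assumes B: "B \<subseteq> rn p" and e: "polynomial_fun p e" and c: "\<And>l. l < p \<Longrightarrow> polynomial_fun p (c l)"
    and retract: "\<And>x. x \<in> rn p \<Longrightarrow> e x \<noteq> 0 \<Longrightarrow> (\<lambda>l. if l < p then c l x / e x else 0) \<in> B"
    and fix_B: "\<And>y l. y \<in> B \<Longrightarrow> e y \<noteq> 0 \<Longrightarrow> l < p \<Longrightarrow> c l y / e y = y l"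
  shows "\<exists>N WE VE WN VN M. spray_chart p B (\<lambda>x. (e x)\<^sup>2) N WE VE WN VN M"
proof -
  let ?E = "\<lambda>x. (e x)\<^sup>2"
  let ?N = "\<lambda>l x. e x * (e x * x l - c l x)"
  have E: "polynomial_fun p ?E" using e by (rule polynomial_fun_power)
  obtain WE VE where WE: "difference_quotients p ?E WE VE" using difference_quotients_exist[OF E] by blast
  have "\<forall>l. \<exists>W V. l < p \<longrightarrow> difference_quotients p (?N l) W V"
  proof
    fix l
    have "polynomial_fun p (?N l)" if "l < p"
      using e c[OF that] that by (intro polynomial_fun_intros)
    then show "\<exists>W V. l < p \<longrightarrow> difference_quotients p (?N l) W V"
      using difference_quotients_exist by blast
  qed
  then obtain WN VN where WN: "\<And>l. l < p \<Longrightarrow> difference_quotients p (?N l) (WN l) (VN l)"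
    unfolding choice_iff by blast
  have "palg4 p (\<lambda>y d t u. WE y d t)" using WE by (simp add: difference_quotients_def)
  from palg4_bound[OF this] obtain b where b: "polynomial_fun p b" "\<forall>y. b y \<ge> 0"
    "\<forall>y d t (u::real). (\<forall>i<p. \<bar>d i\<bar> \<le> 1) \<longrightarrow> \<bar>t\<bar> \<le> 1 \<longrightarrow> \<bar>u\<bar> \<le> 1 \<longrightarrow> \<bar>WE y d t\<bar> \<le> b y"
    by (elim exE conjE) (rule that)
  \<comment> \<open>One polynomial that dominates 1, the square of \<open>?E\<close> and twice
    \<open>|?E| * |WE|\<close>, the last by means of \<open>|a| \<le> 1 + a^2\<close>.\<close>
  define M where "M y = 2 * ((1 + (?E y)\<^sup>2) * (1 + b y))" for y
  have "polynomial_fun p (\<lambda>y. 2 * ((1 + (?E y)\<^sup>2) * (1 + b y)))"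
    using e b(1) by (intro polynomial_fun_intros)
  then have M: "polynomial_fun p M" by (simp add: M_def[abs_def])
  have big: "1 + (?E y)\<^sup>2 \<le> M y" for y
  proof -
    have le: "1 * 1 \<le> 2 * (1 + b y)" using b(2) by simp
    have "0 \<le> 1 + (?E y)\<^sup>2" by simp
    from mult_left_mono[OF le this] show ?thesis
      by (simp only: M_def mult_1_right mult.left_commute[of _ 2])
  qed
  have "spray_chart p B ?E ?N WE VE WN VN M"
  proof
    show "(\<lambda>l. if l < p then x l - ?N l x / ?E x else 0) \<in> B" if "x \<in> rn p" "?E x \<noteq> 0" for x
    proof -
      have "(\<lambda>l. if l < p then x l - ?N l x / ?E x else 0) = (\<lambda>l. if l < p then c l x / e x else 0)"
        using that(2) by (auto simp: power2_eq_square field_simps)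
      then show ?thesis using retract[OF that(1)] that(2) by simp
    qed
    show "?N l y = 0" if "l < p" "y \<in> B" for l y
      using fix_B[OF that(2) _ that(1)] by (cases "e y = 0") (simp_all add: field_simps)
    show "1 \<le> M y" "(?E y)\<^sup>2 \<le> M y" for y
      using big[of y] zero_le_power2[of "?E y"] by linarith+
    show "2 * (\<bar>?E y\<bar> * \<bar>WE y d t\<bar>) \<le> M y" if "\<forall>i<p. \<bar>d i\<bar> \<le> 1" "0 \<le> t" "t \<le> 1" for y d t
    proof -
      have "\<bar>WE y d t\<bar> \<le> b y" using b(3)[rule_format, of d t 0 y] that by simp
      moreover have "\<bar>a\<bar> \<le> 1 + a\<^sup>2" for a :: real
        using zero_le_power2[of "\<bar>a\<bar> - 1"] abs_ge_zero[of a] by (simp add: power2_diff)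
      then have "\<bar>?E y\<bar> \<le> 1 + (?E y)\<^sup>2" .
      ultimately have "\<bar>?E y\<bar> * \<bar>WE y d t\<bar> \<le> (1 + (?E y)\<^sup>2) * (1 + b y)"
        by (intro mult_mono) auto
      then show ?thesis by (simp add: M_def)
    qed
  qed (use B E M WE WN in auto)
  then show ?thesis by blast
qed

section \<open>Moving a point towards a target inside one chart\<close>

(* Write wt = lam + ga with lam = E^4 / S.  If y = x + wt x * D, then E y = E x * un + ga x * dE, so
   the step length th = (E y)^2 * pq is divisible by (E y)^2 and equals lam modulo ga x; this makes
   the chart move y to x + ga x * rest although E y and E x need not vanish together. *)
locale spray_transition = spray_chart +
  fixes S \<Gamma> :: "(nat \<Rightarrow> real) \<Rightarrow> real"
  assumes S: "polynomial_fun p S" and \<Gamma>: "polynomial_fun p \<Gamma>" "\<And>x. \<Gamma> x \<ge> 0"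
begin

definition wt :: "(nat \<Rightarrow> real) \<Rightarrow> real" where
  "wt x = (E x ^ 4 + \<Gamma> x) / S x"

definition ga :: "(nat \<Rightarrow> real) \<Rightarrow> real" where
  "ga x = \<Gamma> x / S x"

definition dE :: "(nat \<Rightarrow> real) \<Rightarrow> (nat \<Rightarrow> real) \<Rightarrow> real" where
  "dE x D = WE x D (wt x)"

text \<open>The second summand is the contribution of \<open>E x ^ 4 / S x\<close> to the change of
  \<open>E\<close>, with a factor \<open>E x\<close> taken out. It vanishes for
  \<open>D = 0\<close>, so \<open>un\<close> is nonzero near the diagonal.\<close>

definition un :: "(nat \<Rightarrow> real) \<Rightarrow> (nat \<Rightarrow> real) \<Rightarrow> real" where
  "un x D = 1 + E x ^ 3 * dE x D / S x"

text \<open>Determined by \<open>(E x * un x D)^2 * pq x D = E x ^ 4 / S x\<close> when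
  \<open>S x\<close> and \<open>un x D\<close> are nonzero.\<close>

definition pq :: "(nat \<Rightarrow> real) \<Rightarrow> (nat \<Rightarrow> real) \<Rightarrow> real" where
  "pq x D = (E x)\<^sup>2 / (S x * (un x D)\<^sup>2)"

text \<open>The factor \<open>M y\<close> cancels the denominator of \<open>kap y\<close>, so that
  the damped velocity \<open>kap y * vel x y D l\<close> is
  \<open>- (E y)^2 * pq x D * D l\<close>.\<close>

definition vel :: "(nat \<Rightarrow> real) \<Rightarrow> (nat \<Rightarrow> real) \<Rightarrow> (nat \<Rightarrow> real) \<Rightarrow> nat \<Rightarrow> real" where
  "vel x y D l = - (pq x D * D l * M y)"

definition move :: "(nat \<Rightarrow> real) \<Rightarrow> (nat \<Rightarrow> real) \<Rightarrow> (nat \<Rightarrow> real) \<Rightarrow> nat \<Rightarrow> real" where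
  "move x y D = spray y (vel x y D)"

text \<open>The cofactor in \<open>wt x - th x y D = ga x * cf x D\<close>, read off after squaring
  the expression of \<open>E y\<close> in terms of \<open>E x\<close>.\<close>

definition cf :: "(nat \<Rightarrow> real) \<Rightarrow> (nat \<Rightarrow> real) \<Rightarrow> real" where
  "cf x D = 1 - (2 * E x * un x D * dE x D + ga x * (dE x D)\<^sup>2) * pq x D"

definition th :: "(nat \<Rightarrow> real) \<Rightarrow> (nat \<Rightarrow> real) \<Rightarrow> (nat \<Rightarrow> real) \<Rightarrow> real" where
  "th x y D = (E y)\<^sup>2 * pq x D"

definition rest :: "(nat \<Rightarrow> real) \<Rightarrow> (nat \<Rightarrow> real) \<Rightarrow> (nat \<Rightarrow> real) \<Rightarrow> nat \<Rightarrow> real" where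
  "rest x y D l = (if l < p then cf x D * (D l + E y * pq x D / (1 + eps y (vel x y D)) *
      VN l y (\<lambda>i. - D i) (th x y D) (wt x)) else 0)"

text \<open>Moving by \<open>th\<close> leaves two errors: the displacement
  \<open>(wt x - th) * D\<close> and the correction made by the retraction. On the line through
  \<open>y\<close> in direction \<open>- D\<close> the numerator \<open>N l\<close> has zeros at
  steps 0 and \<open>wt x\<close>, so its value at step \<open>th\<close> contains
  \<open>th * (th - wt x)\<close>. The factor \<open>(E y)^2\<close> of \<open>th\<close> removes
  the denominator, and \<open>wt x - th\<close> is a multiple of \<open>ga x\<close>; hence both
  errors are.\<close>

lemma move_eq:
  assumes x: "x \<in> B" and y: "y \<in> B" and D: "D \<in> rn p" and eq: "\<And>l. l < p \<Longrightarrow> y l = x l + wt x * D l"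
    and S0: "S x > 0" and U0: "un x D \<noteq> 0" and v: "\<forall>i<p. \<bar>vel x y D i\<bar> \<le> 1" and l: "l < p"
  shows "move x y D l = x l + ga x * rest x y D l"
proof -
  let ?lam = "E x ^ 4 / S x" and ?U = "un x D" and ?w = "dE x D" and ?P = "pq x D"
    and ?T = "th x y D" and ?pi = "wt x" and ?v = "vel x y D"
  let ?w' = "2 * E x * ?U * ?w + ga x * ?w\<^sup>2"
  have y_eq: "y = (\<lambda>i. x i + ?pi * D i)"
  proof
    fix i show "y i = x i + ?pi * D i"
    proof (cases "i < p")
      case False
      then show ?thesis using subsetD[OF B x] subsetD[OF B y] D by (simp add: rn_iff)
    qed (rule eq)
  qed
  have pi: "?pi = ?lam + ga x" by (simp add: wt_def ga_def add_divide_distrib)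
  have "E (\<lambda>i. x i + ?pi * D i) = E x + ?pi * ?w"
    unfolding dE_def by (rule difference_quotients_shift[OF dqE])
  then have "E y = E x + ?pi * ?w" unfolding y_eq[symmetric] .
  also have "\<dots> = E x * ?U + ga x * ?w"
    unfolding pi un_def using S0 by (simp add: field_simps power_numeral_reduce)
  finally have Ey: "E y = E x * ?U + ga x * ?w" .
  have "?T = ((E x)\<^sup>2 * ?U\<^sup>2 + ga x * ?w') * ?P"
    unfolding th_def Ey by (simp add: power2_eq_square algebra_simps)
  also have "\<dots> = ?lam + ga x * ?w' * ?P"
    unfolding pq_def using S0 U0 by (simp add: field_simps power_numeral_reduce)
  finally have rem: "?pi - ?T = ga x * cf x D" by (simp add: pi cf_def algebra_simps)
  have kv: "kap y * ?v i = ?T * - D i" for i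
    using M_pos[of y] by (simp add: kap_def vel_def th_def)
  show ?thesis
  proof (cases "E y = 0")
    case True
    then have "?T = 0" by (simp add: th_def)
    then have "?pi = ga x * cf x D" using rem by simp
    then show ?thesis using True l eq[OF l] unfolding move_def spray_E_zero[OF y True]
      by (simp add: rest_def)
  next
    case False
    let ?D = "\<lambda>i. - D i"
    have NW: "N l (\<lambda>i. y i + t * ?D i) = t * WN l y ?D t" for t
    proof -
      have "N l (\<lambda>i. y i + t * ?D i) = N l y + t * WN l y ?D t"
        by (rule difference_quotients_shift[OF dqN[OF l]])
      then show ?thesis by (simp only: N_zero[OF l y] add_0_left)
    qed
    (* t -> N l (y - t D) vanishes at t = 0 and at t = pi, since y and x lie in B. *)
    have pi0: "?pi \<noteq> 0"
    proof
      assume "?pi = 0"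
      moreover have "?lam \<ge> 0" "ga x \<ge> 0" using S0 \<Gamma>(2)[of x] by (simp_all add: ga_def)
      ultimately have "?lam = 0" "ga x = 0" using pi by linarith+
      then have "E x = 0" using S0 by simp
      then show False using Ey False \<open>ga x = 0\<close> by simp
    qed
    have "(\<lambda>i. y i + ?pi * ?D i) = x" unfolding y_eq by auto
    then have "?pi * WN l y ?D ?pi = 0" using NW[of ?pi] N_zero[OF l x] by simp
    then have "WN l y ?D ?T = (?T - ?pi) * VN l y ?D ?T ?pi"
      using difference_quotients_second[OF dqN[OF l], of y ?D ?T ?pi] pi0 by simp
    moreover have shift: "(\<lambda>i. y i + kap y * ?v i) = (\<lambda>i. y i + ?T * ?D i)" by (simp only: kv)
    ultimately have N: "N l (\<lambda>i. y i + kap y * ?v i) = ?T * ((?T - ?pi) * VN l y ?D ?T ?pi)"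
      using NW[of ?T] by simp
    have e: "1 + eps y ?v \<noteq> 0" using eps_bound[OF v, of y] by simp
    have "move x y D l = (y l + ?T * - D l) - ?T * ((?T - ?pi) * VN l y ?D ?T ?pi) / (E y * (1 + eps y ?v))"
      unfolding move_def spray_eq[OF l y False] unfolding N E_shift unfolding kv by (rule refl)
    also have "?T * ((?T - ?pi) * VN l y ?D ?T ?pi) / (E y * (1 + eps y ?v)) =
        - ((?pi - ?T) * (E y * ?P / (1 + eps y ?v) * VN l y ?D ?T ?pi))"
    proof -
      have key: "?T * X / (E y * Y) = E y * ?P / Y * X" for X Y
        using False by (simp add: th_def power2_eq_square)
      have alg: "q * ((a - b) * v) = - ((b - a) * (q * v))" for a b q v :: real
        by (simp add: algebra_simps)
      show ?thesis by (rule trans[OF key alg])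
    qed
    also have "y l + ?T * - D l - \<dots> = x l + (?pi - ?T) * (D l + E y * ?P / (1 + eps y ?v) * VN l y ?D ?T ?pi)"
      unfolding eq[OF l] by (simp add: algebra_simps)
    also have "\<dots> = x l + ga x * rest x y D l"
      unfolding rem using l by (simp add: rest_def)
    finally show ?thesis .
  qed
qed

lemma algebra_weights:
  assumes fa: "function_algebra A R" and x: "\<forall>i<p. R (\<lambda>z. x z i)"
    and S0: "\<forall>z\<in>A. S (x z) \<noteq> 0"
  shows "R (\<lambda>z. E (x z))" "R (\<lambda>z. S (x z))" "R (\<lambda>z. wt (x z))" "R (\<lambda>z. ga (x z))"
proof -
  interpret function_algebra A R by (rule fa)
  show e: "R (\<lambda>z. E (x z))" by (rule polynomial[OF E]) (simp add: x)
  show s: "R (\<lambda>z. S (x z))" by (rule polynomial[OF S]) (simp add: x)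
  have g: "R (\<lambda>z. \<Gamma> (x z))" by (rule polynomial[OF \<Gamma>(1)]) (simp add: x)
  show "R (\<lambda>z. wt (x z))" unfolding wt_def
    by (rule divide[OF add[OF power[OF e] g] s]) (simp add: S0)
  show "R (\<lambda>z. ga (x z))" unfolding ga_def
    by (rule divide[OF g s]) (simp add: S0)
qed

lemma algebra_unit:
  assumes fa: "function_algebra A R" and x: "\<forall>i<p. R (\<lambda>z. x z i)"
    and S0: "\<forall>z\<in>A. S (x z) \<noteq> 0" and D: "\<forall>i<p. R (\<lambda>z. D z i)"
  shows "R (\<lambda>z. dE (x z) (D z))" "R (\<lambda>z. un (x z) (D z))"
proof -
  interpret function_algebra A R by (rule fa)
  note W = algebra_weights[OF fa x S0]
  show d: "R (\<lambda>z. dE (x z) (D z))" unfolding dE_def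
    by (rule palg4[OF palg4_parts(1) _ _ W(3) const]) (simp_all add: x D)
  show "R (\<lambda>z. un (x z) (D z))" unfolding un_def
    by (rule add[OF const divide[OF mult[OF power[OF W(1)] d] W(2)]]) (simp add: S0)
qed

lemma algebra_velocity:
  assumes fa: "function_algebra A R" and x: "\<forall>i<p. R (\<lambda>z. x z i)"
    and S0: "\<forall>z\<in>A. S (x z) \<noteq> 0" and D: "\<forall>i<p. R (\<lambda>z. D z i)"
    and y: "\<forall>i<p. R (\<lambda>z. y z i)" and U0: "\<forall>z\<in>A. un (x z) (D z) \<noteq> 0"
  shows "R (\<lambda>z. pq (x z) (D z))" "\<forall>l<p. R (\<lambda>z. vel (x z) (y z) (D z) l)"
proof -
  interpret function_algebra A R by (rule fa)
  note W = algebra_weights[OF fa x S0] and U = algebra_unit[OF fa x S0 D]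
  show P: "R (\<lambda>z. pq (x z) (D z))" unfolding pq_def
    by (rule divide[OF power[OF W(1)] mult[OF W(2) power[OF U(2)]]]) (simp add: S0 U0)
  have M: "R (\<lambda>z. M (y z))" by (rule polynomial[OF M]) (simp add: y)
  show "\<forall>l<p. R (\<lambda>z. vel (x z) (y z) (D z) l)"
    unfolding vel_def using mult[OF mult[OF P] M, THEN minus] D by blast
qed

lemma algebra_rest:
  assumes fa: "function_algebra A R" and x: "\<forall>i<p. R (\<lambda>z. x z i)"
    and S0: "\<forall>z\<in>A. S (x z) \<noteq> 0" and D: "\<forall>i<p. R (\<lambda>z. D z i)"
    and y: "\<forall>i<p. R (\<lambda>z. y z i)" and U0: "\<forall>z\<in>A. un (x z) (D z) \<noteq> 0"
    and v: "\<forall>z\<in>A. \<forall>i<p. \<bar>vel (x z) (y z) (D z) i\<bar> \<le> 1"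
  shows "R (\<lambda>z. move (x z) (y z) (D z) l)" "R (\<lambda>z. rest (x z) (y z) (D z) l)"
proof -
  interpret function_algebra A R by (rule fa)
  note W = algebra_weights[OF fa x S0] and U = algebra_unit[OF fa x S0 D]
    and P = algebra_velocity[OF fa x S0 D y U0]
  show "R (\<lambda>z. move (x z) (y z) (D z) l)" unfolding move_def
    by (rule algebra_spray(4)[OF fa]) (simp_all add: y P(2) v)
  have Ey: "R (\<lambda>z. E (y z))" by (rule polynomial[OF E]) (simp add: y)
  have ep: "R (\<lambda>z. 1 + eps (y z) (vel (x z) (y z) (D z)))"
    by (rule algebra_spray(3)[OF fa]) (simp_all add: y P(2) v)
  have ep0: "1 + eps (y z) (vel (x z) (y z) (D z)) \<noteq> 0" if "z \<in> A" for z
    using eps_bound[of "vel (x z) (y z) (D z)" "y z"] v that by simp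
  show "R (\<lambda>z. rest (x z) (y z) (D z) l)"
  proof (cases "l < p")
    case True
    have th: "R (\<lambda>z. th (x z) (y z) (D z))" unfolding th_def by (rule mult[OF power[OF Ey] P(1)])
    have V: "R (\<lambda>z. VN l (y z) (\<lambda>i. - D z i) (th (x z) (y z) (D z)) (wt (x z)))"
      by (rule palg4[OF palg4_parts(3)[OF True] _ _ th W(3)]) (simp_all add: y D minus)
    have cf: "R (\<lambda>z. cf (x z) (D z))" unfolding cf_def
      by (rule diff[OF const mult[OF add[OF mult[OF mult[OF mult[OF const W(1)] U(2)] U(1)]
          mult[OF W(4) power[OF U(1)]]] P(1)]])
    have Dl: "R (\<lambda>z. D z l)" using D True by blast
    have "R (\<lambda>z. E (y z) * pq (x z) (D z) / (1 + eps (y z) (vel (x z) (y z) (D z))))"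
      by (rule divide[OF mult[OF Ey P(1)] ep ep0])
    from mult[OF cf add[OF Dl mult[OF this V]]] show ?thesis using True by (simp add: rest_def)
  next
    case False
    then show ?thesis by (simp add: rest_def const)
  qed
qed

text \<open>For displacement 0 the quotient \<open>un\<close> is 1 and nothing moves. Positivity
  near the diagonal is later deduced from such values by continuity and compactness.\<close>

lemma diagonal:
  assumes "\<And>i. i < p \<Longrightarrow> D i = 0" "x \<in> B"
  shows "un x D = 1" "vel x x D i = - (pq x D * D i * M x)" "move x x (\<lambda>_. 0) = x" "rest x x (\<lambda>_. 0) = (\<lambda>_. 0)"
proof -
  have W0: "WE y d t = 0" if "\<And>i. i < p \<Longrightarrow> d i = 0" for y d t
    by (rule difference_quotients_zero(1)[OF dqE that])
  have N0: "WN l y d t = 0" if "l < p" "\<And>i. i < p \<Longrightarrow> d i = 0" for l y d t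
    by (rule difference_quotients_zero(1)[OF dqN[OF that(1)] that(2)])
  have N1: "VN l y (\<lambda>_. 0) t u = 0" if "l < p" for l y t u
    by (rule difference_quotients_zero(2)[OF dqN[OF that]]) simp
  show "un x D = 1" using W0[OF assms(1)] by (simp add: un_def dE_def)
  show "vel x x D i = - (pq x D * D i * M x)" by (simp add: vel_def)
  have "l \<ge> p \<Longrightarrow> x l = 0" for l using assms(2) B by (auto simp: rn_iff)
  then show "move x x (\<lambda>_. 0) = x" by (auto simp: move_def spray_def N0 vel_def)
  show "rest x x (\<lambda>_. 0) = (\<lambda>_. 0)" by (auto simp: rest_def N1)
qed

end

section \<open>Extendable maps\<close>

text \<open>Uniform continuity at the points of a compact set, while the other point ranges over the
  possibly noncompact \<open>T\<close>. A Lebesgue number of a cover of \<open>K\<close> by balls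
  serves as \<open>\<delta>\<close>.\<close>

lemma continuous_near_compact:
  fixes F :: "'a::metric_space \<Rightarrow> 'b::metric_space"
  assumes F: "continuous_on T F" and K: "compact K" "K \<subseteq> T" and \<eta>: "\<eta> > 0"
  shows "\<exists>\<delta>>0. \<forall>k\<in>K. \<forall>t\<in>T. dist t k < \<delta> \<longrightarrow> dist (F t) (F k) < \<eta>"
proof -
  have "\<forall>k. \<exists>d. k \<in> K \<longrightarrow> d > 0 \<and> (\<forall>t\<in>T. dist t k < d \<longrightarrow> dist (F t) (F k) < \<eta> / 2)"
  proof
    fix k show "\<exists>d. k \<in> K \<longrightarrow> d > 0 \<and> (\<forall>t\<in>T. dist t k < d \<longrightarrow> dist (F t) (F k) < \<eta> / 2)"
    proof (cases "k \<in> K")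
      case True
      then have "k \<in> T" using K(2) by blast
      then show ?thesis
        using F half_gt_zero[OF \<eta>] unfolding continuous_on_iff by blast
    qed simp
  qed
  then obtain d where d: "\<And>k. k \<in> K \<Longrightarrow> d k > 0"
    "\<And>k t. k \<in> K \<Longrightarrow> t \<in> T \<Longrightarrow> dist t k < d k \<Longrightarrow> dist (F t) (F k) < \<eta> / 2"
    unfolding choice_iff by blast
  let ?G = "(\<lambda>k. ball k (d k)) ` K"
  have cover: "K \<subseteq> \<Union>?G" using d(1) by fastforce
  have op: "open G" if "G \<in> ?G" for G using that by auto
  obtain \<delta> where \<delta>: "\<delta> > 0" "\<And>k. k \<in> K \<Longrightarrow> \<exists>G\<in>?G. ball k \<delta> \<subseteq> G"
    by (rule Heine_Borel_lemma[OF K(1) cover op], assumption) (rule that)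
  have "dist (F t) (F k) < \<eta>" if k: "k \<in> K" and t: "t \<in> T" "dist t k < \<delta>" for k t
  proof -
    obtain k' where k': "k' \<in> K" "ball k \<delta> \<subseteq> ball k' (d k')" using \<delta>(2)[OF k] by blast
    have "k \<in> ball k \<delta>" "t \<in> ball k \<delta>" using \<delta>(1) t(2) by (simp_all add: dist_commute)
    then have "k \<in> ball k' (d k')" "t \<in> ball k' (d k')" using k'(2) by blast+
    then have "dist k k' < d k'" "dist t k' < d k'" by (simp_all add: dist_commute)
    then have "dist (F k) (F k') < \<eta> / 2" "dist (F t) (F k') < \<eta> / 2"
      using d(2)[OF k'(1)] k K(2) t(1) by blast+
    then show ?thesis by (rule dist_triangle_half_l[rotated])
  qed
  with \<delta>(1) show ?thesis by blast
qed

text \<open>\<open>C\<close> will be the compact part of \<open>B\<close> swept out by the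
  homotopy.\<close>

locale extension_setting =
  fixes m :: nat and A Z :: "(nat \<Rightarrow> real) set" and p :: nat and B C :: "(nat \<Rightarrow> real) set"
  assumes A: "A \<subseteq> rn m" and Z: "Z \<subseteq> A" "closedin (zariski_topology m) Z" "compact Z"
    and B_rn: "B \<subseteq> rn p" and C: "compact C" "C \<subseteq> B"
begin

definition extendable :: "((nat \<Rightarrow> real) \<Rightarrow> nat \<Rightarrow> real) \<Rightarrow> bool" where
  "extendable \<phi> \<longleftrightarrow> (\<exists>F. (\<forall>x\<in>A. F x \<in> B) \<and> (\<forall>l<p. rational_on m A (\<lambda>x. F x l)) \<and> (\<forall>z\<in>Z. F z = \<phi> z))"

lemma extendable_cong: "extendable \<phi> \<Longrightarrow> (\<And>z. z \<in> Z \<Longrightarrow> \<phi> z = \<psi> z) \<Longrightarrow> extendable \<psi>"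
  unfolding extendable_def by auto

lemma extendable_rational:
  assumes "extendable \<phi>" "l < p"
  shows "rational_on m Z (\<lambda>z. \<phi> z l)"
proof -
  obtain F where F: "\<forall>l<p. rational_on m A (\<lambda>x. F x l)" "\<forall>z\<in>Z. F z = \<phi> z"
    using assms(1) unfolding extendable_def by blast
  have "rational_on m Z (\<lambda>x. F x l)" using F(1) assms(2) rational_on_subset[OF _ Z(1)] by blast
  then show ?thesis by (rule function_algebra.cong[OF function_algebra_rational]) (simp add: F(2))
qed

lemma extendable_in: "extendable \<phi> \<Longrightarrow> z \<in> Z \<Longrightarrow> \<phi> z \<in> B"
  unfolding extendable_def using Z(1) by fastforce

text \<open>The velocity is given on \<open>Z\<close> only, but being strictly bounded by 1 there it
  extends to R^m with the same bound. The spray is then defined along the whole extension of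
  \<open>\<phi>\<close> and stays in \<open>B\<close>.\<close>

lemma spray_extendable:
  assumes chart: "spray_chart p B E N WE VE WN VN M" and \<phi>: "extendable \<phi>"
    and v: "\<And>l. l < p \<Longrightarrow> rational_on m Z (\<lambda>z. v z l)" "\<And>z l. z \<in> Z \<Longrightarrow> l < p \<Longrightarrow> \<bar>v z l\<bar> < 1"
      "\<And>z. z \<in> Z \<Longrightarrow> v z \<in> rn p"
  shows "extendable (\<lambda>z. spray_chart.spray p E WE WN M (\<phi> z) (v z))"
proof -
  interpret spray_chart p B E N WE VE WN VN M by fact
  obtain F where F: "\<forall>x\<in>A. F x \<in> B" "\<forall>l<p. rational_on m A (\<lambda>x. F x l)" "\<forall>z\<in>Z. F z = \<phi> z"
    using \<phi> unfolding extendable_def by blast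
  have "\<forall>l. \<exists>g. l < p \<longrightarrow> rational_on m (rn m) g \<and> (\<forall>x\<in>Z. g x = v x l) \<and> (\<forall>x\<in>rn m. \<bar>g x\<bar> < 1)"
    using rational_extension_bounded[OF Z(2,3) v(1,2)] by blast
  then obtain g where g: "\<And>l. l < p \<Longrightarrow> rational_on m (rn m) (g l)"
    "\<And>l x. l < p \<Longrightarrow> x \<in> Z \<Longrightarrow> g l x = v x l" "\<And>l x. l < p \<Longrightarrow> x \<in> rn m \<Longrightarrow> \<bar>g l x\<bar> < 1"
    unfolding choice_iff by blast
  define w where "w x = (\<lambda>l. if l < p then g l x else 0)" for x
  have w: "w x \<in> rn p" "\<forall>i<p. \<bar>w x i\<bar> \<le> 1" if "x \<in> A" for x
    using g(3)[of _ x] that A by (auto simp: w_def rn_iff less_imp_le)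
  have wr: "rational_on m A (\<lambda>x. w x i)" if "i < p" for i
    using rational_on_subset[OF g(1)[OF that] A] that by (simp add: w_def)
  have wZ: "w z = v z" if "z \<in> Z" for z
    using g(2)[OF _ that] v(3)[OF that] by (auto simp: w_def rn_iff)
  show ?thesis unfolding extendable_def
  proof (intro exI[of _ "\<lambda>x. spray (F x) (w x)"] conjI ballI allI impI)
    show "spray (F x) (w x) \<in> B" if "x \<in> A" for x using F(1) that w[OF that] by (intro spray_in) auto
    show "rational_on m A (\<lambda>x. spray (F x) (w x) l)" if "l < p" for l
      by (rule algebra_spray(4)[OF function_algebra_rational]) (use F(2) wr w(2) in auto)
    show "spray (F z) (w z) = spray (\<phi> z) (v z)" if "z \<in> Z" for z using F(3) wZ that by simp
  qed
qed

section \<open>Neighbourhoods of the diagonal\<close>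

text \<open>Pairs of a target and a starting point. Only the starting point must lie in
  \<open>B\<close>: targets will be polynomial approximations, which need not have values in
  \<open>B\<close>.\<close>

definition tube :: "real \<Rightarrow> ((nat \<Rightarrow> real) \<times> (nat \<Rightarrow> real)) set" where
  "tube e = {s. fst s \<in> rn p \<and> snd s \<in> B \<and> (\<exists>c\<in>C. dist s (c, c) < e)}"

lemma tube_mono:
  assumes "e \<le> e'"
  shows "tube e \<subseteq> tube e'"
proof
  fix s assume "s \<in> tube e"
  then obtain c where c: "fst s \<in> rn p" "snd s \<in> B" "c \<in> C" "dist s (c, c) < e"
    unfolding tube_def by blast
  have "dist s (c, c) < e'" using c(4) assms by linarith
  with c(1-3) show "s \<in> tube e'" unfolding tube_def by blast
qed

lemma tube_diagonal:
  assumes "c \<in> C" "e > 0"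
  shows "(c, c) \<in> tube e"
proof -
  have "c \<in> B" using assms(1) C(2) by blast
  moreover have "c \<in> rn p" using \<open>c \<in> B\<close> B_rn by blast
  moreover have "dist (c, c) (c, c) < e" using assms(2) by simp
  ultimately show ?thesis unfolding tube_def using assms(1) by (intro CollectI conjI bexI[of _ c]) simp_all
qed

lemma tube_shrink:
  assumes F: "continuous_on (tube e) F" and e: "e > 0" and pos: "\<And>c. c \<in> C \<Longrightarrow> F (c, c) > (0::real)"
  shows "\<exists>e'>0. e' \<le> e \<and> (\<forall>s\<in>tube e'. F s > 0)"
proof (cases "C = {}")
  case True
  then have "tube e = {}" unfolding tube_def by simp
  then show ?thesis using e by (intro exI[of _ e]) simp
next
  case False
  let ?K = "(\<lambda>c. (c, c)) ` C"
  have K: "compact ?K" by (intro compact_continuous_image continuous_intros C(1))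
  have KT: "?K \<subseteq> tube e" using tube_diagonal e by blast
  obtain k where k: "k \<in> ?K" "\<forall>s\<in>?K. F k \<le> F s"
    using continuous_attains_inf[OF K _ continuous_on_subset[OF F KT]] False by blast
  have Fk: "F k > 0" using k(1) pos by auto
  obtain \<delta> where \<delta>: "\<delta> > 0" "\<forall>q\<in>?K. \<forall>t\<in>tube e. dist t q < \<delta> \<longrightarrow> dist (F t) (F q) < F k"
    using continuous_near_compact[OF F K KT Fk] by blast
  have "F s > 0" if s: "s \<in> tube (min e \<delta>)" for s
  proof -
    have sT: "s \<in> tube e" using s tube_mono[of "min e \<delta>" e] by auto
    obtain c where c: "c \<in> C" "dist s (c, c) < \<delta>" using s by (auto simp: tube_def)
    then have "dist (F s) (F (c, c)) < F k" "F k \<le> F (c, c)" using \<delta>(2) sT k(2) by blast+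
    then show ?thesis by (simp add: dist_real_def)
  qed
  then show ?thesis using e \<delta>(1) by (intro exI[of _ "min e \<delta>"]) simp
qed

lemma tube_shrink_finite:
  assumes "\<And>l. l < (k::nat) \<Longrightarrow> continuous_on (tube e) (F l)" and e: "e > 0"
    and "\<And>l c. l < k \<Longrightarrow> c \<in> C \<Longrightarrow> F l (c, c) > (0::real)"
  shows "\<exists>e'>0. e' \<le> e \<and> (\<forall>l<k. \<forall>s\<in>tube e'. F l s > 0)"
  using assms(1,3)
proof (induction k)
  case 0
  then show ?case using e by auto
next
  case (Suc k)
  then obtain e1 where e1: "e1 > 0" "e1 \<le> e" "\<forall>l<k. \<forall>s\<in>tube e1. F l s > 0" by auto
  obtain e2 where e2: "e2 > 0" "e2 \<le> e" "\<forall>s\<in>tube e2. F k s > 0"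
    using tube_shrink[of e "F k"] Suc.prems e by auto
  have "tube (min e1 e2) \<subseteq> tube e1" "tube (min e1 e2) \<subseteq> tube e2" by (auto intro!: tube_mono)
  then have "\<forall>l<Suc k. \<forall>s\<in>tube (min e1 e2). F l s > 0"
    using e1(3) e2(3) by (auto simp: less_Suc_eq)
  then show ?case using e1 e2 by (intro exI[of _ "min e1 e2"]) auto
qed

(* At target x and starting point y, the current point is Y (x, y) = x + w x * D (x, y). *)
definition stage :: "real \<Rightarrow> ((nat \<Rightarrow> real) \<Rightarrow> real) \<Rightarrow>
    ((nat \<Rightarrow> real) \<times> (nat \<Rightarrow> real) \<Rightarrow> nat \<Rightarrow> real) \<Rightarrow>
    ((nat \<Rightarrow> real) \<times> (nat \<Rightarrow> real) \<Rightarrow> nat \<Rightarrow> real) \<Rightarrow> bool" where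
  "stage e w Y D \<longleftrightarrow> e > 0 \<and>
     (\<forall>s\<in>tube e. Y s \<in> B \<and> D s \<in> rn p) \<and>
     (\<forall>l<p. continuous_on (tube e) (\<lambda>s. Y s l) \<and> continuous_on (tube e) (\<lambda>s. D s l)) \<and>
     (\<forall>c\<in>C. Y (c, c) = c \<and> D (c, c) = (\<lambda>_. 0)) \<and>
     (\<forall>s\<in>tube e. fst s \<in> B \<longrightarrow> (\<forall>l<p. Y s l = fst s l + w (fst s) * D s l)) \<and>
     (\<forall>\<xi> \<phi>. (\<forall>z\<in>Z. (\<xi> z, \<phi> z) \<in> tube e) \<longrightarrow> (\<forall>l<p. rational_on m Z (\<lambda>z. \<xi> z l)) \<longrightarrow> extendable \<phi> \<longrightarrow>
        extendable (\<lambda>z. Y (\<xi> z, \<phi> z)) \<and> (\<forall>l<p. rational_on m Z (\<lambda>z. D (\<xi> z, \<phi> z) l)))"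

lemma continuous_on_fst_coordinate: "continuous_on T (\<lambda>s. fst s i :: real)"
proof -
  have "continuous_on T ((\<lambda>x. x i) \<circ> fst)"
    by (intro continuous_on_compose continuous_intros)
      (rule continuous_on_subset[OF continuous_on_product_coordinates], simp)
  then show ?thesis by (simp add: o_def)
qed

text \<open>The formulas of the chart require \<open>S > 0\<close>, then
  \<open>un \<noteq> 0\<close>, then velocities below 1. Each condition holds on the diagonal of
  \<open>C\<close> and is continuous once the previous one is granted, so the tube is shrunk three
  times. On the last tube the chart moves the current point, and the weight loses its summand
  \<open>E x ^ 4 / S x\<close>.\<close>

lemma stage_transition:
  assumes tr: "spray_transition p B E N WE VE WN VN M S \<Gamma>"
    and S_pos: "\<And>c. c \<in> C \<Longrightarrow> S c > 0"
    and st: "stage e (\<lambda>x. (E x ^ 4 + \<Gamma> x) / S x) Y D"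
  shows "\<exists>e' Y' D'. stage e' (\<lambda>x. \<Gamma> x / S x) Y' D'"
proof -
  interpret spray_transition p B E N WE VE WN VN M S \<Gamma> by fact
  have e: "e > 0" and Y: "\<And>s. s \<in> tube e \<Longrightarrow> Y s \<in> B" and D: "\<And>s. s \<in> tube e \<Longrightarrow> D s \<in> rn p"
    and cY: "\<And>l. l < p \<Longrightarrow> continuous_on (tube e) (\<lambda>s. Y s l)"
    and cD: "\<And>l. l < p \<Longrightarrow> continuous_on (tube e) (\<lambda>s. D s l)"
    and diag: "\<And>c. c \<in> C \<Longrightarrow> Y (c, c) = c" "\<And>c. c \<in> C \<Longrightarrow> D (c, c) = (\<lambda>_. 0)"
    and eq: "\<And>s l. s \<in> tube e \<Longrightarrow> fst s \<in> B \<Longrightarrow> l < p \<Longrightarrow> Y s l = fst s l + wt (fst s) * D s l"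
    and ext: "\<And>\<xi> \<phi>. \<forall>z\<in>Z. (\<xi> z, \<phi> z) \<in> tube e \<Longrightarrow> \<forall>l<p. rational_on m Z (\<lambda>z. \<xi> z l) \<Longrightarrow>
       extendable \<phi> \<Longrightarrow> extendable (\<lambda>z. Y (\<xi> z, \<phi> z)) \<and> (\<forall>l<p. rational_on m Z (\<lambda>z. D (\<xi> z, \<phi> z) l))"
    using st unfolding stage_def wt_def by simp_all
  have CB: "c \<in> B" if "c \<in> C" for c using that C(2) by blast
  have "continuous_on (tube e) (\<lambda>s. S (fst s))"
    by (rule function_algebra.polynomial[OF function_algebra_continuous S continuous_on_fst_coordinate])
  moreover have "S (fst (c, c)) > 0" if "c \<in> C" for c using S_pos[OF that] by simp
  ultimately obtain e1 where e1: "e1 > 0" "e1 \<le> e" "\<forall>s\<in>tube e1. S (fst s) > 0"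
    using tube_shrink[of e "\<lambda>s. S (fst s)"] e by blast
  have cont1: "continuous_on (tube e') (\<lambda>s. Y s l)" "continuous_on (tube e') (\<lambda>s. D s l)"
    if "l < p" "e' \<le> e" for l e'
    using continuous_on_subset[OF _ tube_mono[OF that(2)]] cY cD that(1) by blast+
  have S1: "S (fst s) \<noteq> 0" if "s \<in> tube e'" "e' \<le> e1" for s e'
    using e1(3) tube_mono[OF that(2)] that(1) by fastforce
  have "continuous_on (tube e1) (\<lambda>s. un (fst s) (D s))"
    by (rule algebra_unit(2)[OF function_algebra_continuous])
      (use S1 cont1 e1(2) continuous_on_fst_coordinate in auto)
  moreover have "un (fst (c, c)) (D (c, c)) > 0" if "c \<in> C" for c
    using diagonal(1)[of "D (c, c)" c] diag(2)[OF that] CB[OF that] by simp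
  ultimately obtain e2 where e2: "e2 > 0" "e2 \<le> e1" "\<forall>s\<in>tube e2. un (fst s) (D s) > 0"
    using tube_shrink[of e1 "\<lambda>s. un (fst s) (D s)"] e1(1) by blast
  have U2: "un (fst s) (D s) \<noteq> 0" if "s \<in> tube e'" "e' \<le> e2" for s e'
    using e2(3) tube_mono[OF that(2)] that(1) by fastforce
  have "\<forall>l<p. continuous_on (tube e2) (\<lambda>s. vel (fst s) (Y s) (D s) l)"
    by (rule algebra_velocity(2)[OF function_algebra_continuous])
      (use S1 U2 cont1 e1(2) e2(2) continuous_on_fst_coordinate in auto)
  then have "continuous_on (tube e2) (\<lambda>s. 1 - \<bar>vel (fst s) (Y s) (D s) l\<bar>)" if "l < p" for l
    using that by (intro continuous_intros) blast
  moreover have "1 - \<bar>vel (fst (c, c)) (Y (c, c)) (D (c, c)) l\<bar> > 0" if "l < p" "c \<in> C" for l c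
    using diag(2)[OF that(2)] by (simp add: vel_def)
  ultimately obtain e3 where e3: "e3 > 0" "e3 \<le> e2"
    "\<forall>l<p. \<forall>s\<in>tube e3. 1 - \<bar>vel (fst s) (Y s) (D s) l\<bar> > 0"
    using tube_shrink_finite[of p e2 "\<lambda>l s. 1 - \<bar>vel (fst s) (Y s) (D s) l\<bar>"] e2(1) by blast
  have sub: "s \<in> tube e" if "s \<in> tube e3" for s
    using that e3(2) e2(2) e1(2) tube_mono[of e3 e] by auto
  have v: "\<bar>vel (fst s) (Y s) (D s) l\<bar> < 1" if "s \<in> tube e3" "l < p" for s l
    using e3(3) that by fastforce
  have e31: "e3 \<le> e1" using e3(2) e2(2) by simp
  have S3: "S (fst s) \<noteq> 0" "S (fst s) > 0" and U3: "un (fst s) (D s) \<noteq> 0" if "s \<in> tube e3" for s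
    using S1[OF that e31] U2[OF that e3(2)] e1(3) that tube_mono[OF e31] by blast+
  have vrn: "vel x y d \<in> rn p" if "d \<in> rn p" for x y d using that by (simp add: rn_iff vel_def)
  let ?Y = "\<lambda>s. move (fst s) (Y s) (D s)" and ?D = "\<lambda>s. rest (fst s) (Y s) (D s)"
  have "stage e3 (\<lambda>x. \<Gamma> x / S x) ?Y ?D"
    unfolding stage_def
  proof (intro conjI ballI allI impI)
    show "e3 > 0" by fact
    fix s assume s: "s \<in> tube e3"
    show "?Y s \<in> B" unfolding move_def
      using v[OF s] by (intro spray_in Y vrn D sub s) (auto simp: less_imp_le)
    show "?D s \<in> rn p" by (simp add: rn_iff rest_def)
    fix l assume "fst s \<in> B" "l < p"
    then show "?Y s l = fst s l + \<Gamma> (fst s) / S (fst s) * ?D s l"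
      using move_eq[of "fst s" "Y s" "D s" l] Y[OF sub[OF s]] D[OF sub[OF s]] eq[OF sub[OF s]] S3[OF s] U3[OF s] v[OF s]
      by (simp add: ga_def less_imp_le)
  next
    fix l assume l: "l < p"
    have e3e: "e3 \<le> e" using e1 e2 e3 by simp
    show "continuous_on (tube e3) (\<lambda>s. ?Y s l)"
      by (rule algebra_rest(1)[OF function_algebra_continuous])
        (use S3 U3 v cont1[OF _ e3e] continuous_on_fst_coordinate in \<open>auto simp: less_imp_le\<close>)
    show "continuous_on (tube e3) (\<lambda>s. ?D s l)"
      by (rule algebra_rest(2)[OF function_algebra_continuous])
        (use S3 U3 v cont1[OF _ e3e] continuous_on_fst_coordinate in \<open>auto simp: less_imp_le\<close>)
  next
    fix c assume "c \<in> C"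
    then show "?Y (c, c) = c" "?D (c, c) = (\<lambda>_. 0)"
      using diag diagonal(3,4)[where D="\<lambda>_. 0"] CB by auto
  next
    fix \<xi> \<phi> assume *: "\<forall>z\<in>Z. (\<xi> z, \<phi> z) \<in> tube e3" "\<forall>l<p. rational_on m Z (\<lambda>z. \<xi> z l)" "extendable \<phi>"
    let ?y = "\<lambda>z. Y (\<xi> z, \<phi> z)" and ?d = "\<lambda>z. D (\<xi> z, \<phi> z)"
    have y: "extendable ?y" and d: "\<forall>l<p. rational_on m Z (\<lambda>z. ?d z l)"
    proof -
      have "\<forall>z\<in>Z. (\<xi> z, \<phi> z) \<in> tube e" using *(1) sub by blast
      from ext[OF this *(2,3)] show "extendable ?y" "\<forall>l<p. rational_on m Z (\<lambda>z. ?d z l)" by simp_all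
    qed
    have yr: "\<forall>l<p. rational_on m Z (\<lambda>z. ?y z l)" using extendable_rational[OF y] by blast
    have S0: "\<forall>z\<in>Z. S (\<xi> z) \<noteq> 0"
    proof
      fix z assume "z \<in> Z"
      then show "S (\<xi> z) \<noteq> 0" using S3(1)[of "(\<xi> z, \<phi> z)"] *(1) by simp
    qed
    have U0: "\<forall>z\<in>Z. un (\<xi> z) (?d z) \<noteq> 0"
    proof
      fix z assume "z \<in> Z"
      then show "un (\<xi> z) (?d z) \<noteq> 0" using U3[of "(\<xi> z, \<phi> z)"] *(1) by simp
    qed
    have vz: "\<bar>vel (\<xi> z) (?y z) (?d z) l\<bar> < 1" if "z \<in> Z" "l < p" for z l
      using v[of "(\<xi> z, \<phi> z)" l] *(1) that by auto
    have "extendable (\<lambda>z. spray (?y z) (vel (\<xi> z) (?y z) (?d z)))"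
    proof (rule spray_extendable[OF spray_chart_axioms y])
      have "\<forall>l<p. rational_on m Z (\<lambda>z. vel (\<xi> z) (?y z) (?d z) l)"
        by (rule algebra_velocity(2)[OF function_algebra_rational[of Z m], OF *(2) S0 d yr U0])
      then show "rational_on m Z (\<lambda>z. vel (\<xi> z) (?y z) (?d z) l)" if "l < p" for l
        using that by simp
      show "vel (\<xi> z) (?y z) (?d z) \<in> rn p" if "z \<in> Z" for z
      proof -
        have "(\<xi> z, \<phi> z) \<in> tube e3" using *(1) that by simp
        then show ?thesis by (rule vrn[OF D[OF sub]])
      qed
    qed (use vz in auto)
    then show "extendable (\<lambda>z. ?Y (\<xi> z, \<phi> z))" by (simp add: move_def)
    fix l assume "l < p"
    show "rational_on m Z (\<lambda>z. ?D (\<xi> z, \<phi> z) l)"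
      using algebra_rest(2)[OF function_algebra_rational[of Z m], OF *(2) S0 d yr U0, of l] vz by (simp add: less_imp_le)
  qed
  then show ?thesis by blast
qed

section \<open>Composing finitely many charts\<close>

definition is_chart :: "((nat \<Rightarrow> real) \<Rightarrow> real) \<Rightarrow> bool" where
  "is_chart E \<longleftrightarrow> (\<exists>N WE VE WN VN M. spray_chart p B E N WE VE WN VN M)"

text \<open>Summation over a list makes passing to the tail remove one fourth power, exactly what
  one transition does to the numerator of the weight.\<close>

definition quartic_sum :: "((nat \<Rightarrow> real) \<Rightarrow> real) list \<Rightarrow> (nat \<Rightarrow> real) \<Rightarrow> real" where
  "quartic_sum Es x = (\<Sum>E\<leftarrow>Es. E x ^ 4)"

lemma quartic_sum_nonneg: "quartic_sum Es x \<ge> 0"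
  unfolding quartic_sum_def by (intro sum_list_nonneg) auto

lemma quartic_sum_pos:
  assumes "E \<in> set Es" "E x \<noteq> 0"
  shows "quartic_sum Es x > 0"
  using assms
proof (induction Es)
  case (Cons F Es)
  have eq: "quartic_sum (F # Es) x = F x ^ 4 + quartic_sum Es x" by (simp add: quartic_sum_def)
  show ?case
  proof (cases "E = F")
    case True
    then have "F x ^ 4 > 0" using Cons.prems by simp
    then show ?thesis unfolding eq using quartic_sum_nonneg[of Es x] by linarith
  next
    case False
    then have "quartic_sum Es x > 0" using Cons by simp
    moreover have "F x ^ 4 \<ge> 0" by simp
    ultimately show ?thesis unfolding eq by linarith
  qed
qed simp

lemma chart_polynomial: "is_chart E \<Longrightarrow> polynomial_fun p E"
  unfolding is_chart_def by (auto simp: spray_chart_def)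

lemma polynomial_fun_quartic_sum:
  "(\<And>E. E \<in> set Es \<Longrightarrow> is_chart E) \<Longrightarrow> polynomial_fun p (quartic_sum Es)"
proof (induction Es)
  case Nil
  then show ?case by (simp add: quartic_sum_def[abs_def] polynomial_fun.const)
next
  case (Cons E Es)
  then have "polynomial_fun p (\<lambda>x. E x ^ 4 + quartic_sum Es x)"
    by (intro polynomial_fun.add[OF polynomial_fun_power[OF chart_polynomial]]) auto
  then show ?case by (simp add: quartic_sum_def[abs_def])
qed

text \<open>The denominator \<open>S\<close> stays fixed while the list shrinks. At weight 0 the
  current point coincides with the target whenever the target lies in \<open>B\<close>.\<close>

lemma stage_charts:
  assumes "polynomial_fun p S" "\<And>c. c \<in> C \<Longrightarrow> S c > 0" and "\<And>E. E \<in> set Es \<Longrightarrow> is_chart E"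
    and "stage e (\<lambda>x. quartic_sum Es x / S x) Y D"
  shows "\<exists>e' Y' D'. stage e' (\<lambda>x. 0) Y' D'"
  using assms(3,4)
proof (induction Es arbitrary: e Y D)
  case Nil
  then show ?case by (auto simp: quartic_sum_def)
next
  case (Cons E Es)
  have "is_chart E" using Cons.prems(1) by simp
  then obtain N WE VE WN VN M where "spray_chart p B E N WE VE WN VN M" unfolding is_chart_def by blast
  moreover have "polynomial_fun p (quartic_sum Es)"
    using Cons.prems(1) by (intro polynomial_fun_quartic_sum) simp
  ultimately have tr: "spray_transition p B E N WE VE WN VN M S (quartic_sum Es)"
    using assms(1) quartic_sum_nonneg by (simp add: spray_transition_def spray_transition_axioms_def)
  have "stage e (\<lambda>x. (E x ^ 4 + quartic_sum Es x) / S x) Y D"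
    using Cons.prems(2) by (simp add: quartic_sum_def)
  from stage_transition[OF tr assms(2) this] obtain e' Y' D'
    where "stage e' (\<lambda>x. quartic_sum Es x / S x) Y' D'" by blast
  from Cons.IH[OF _ this] Cons.prems(1) show ?case by simp
qed

text \<open>\<open>\<Omega>\<close> projects a target near \<open>C\<close> into \<open>B\<close>,
  starting the motion from a nearby point of \<open>B\<close>. It fixes targets in \<open>B\<close>,
  and being composed of sprays it preserves extendability in its second argument. Compactness of
  \<open>C\<close> reduces the charts to finitely many.\<close>

lemma local_projection:
  assumes charts: "\<And>c. c \<in> C \<Longrightarrow> \<exists>E. is_chart E \<and> E c \<noteq> 0"
  shows "\<exists>e>0. \<exists>\<Omega>. (\<forall>s\<in>tube e. \<Omega> s \<in> B) \<and> continuous_on (tube e) \<Omega> \<and>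
    (\<forall>s\<in>tube e. fst s \<in> B \<longrightarrow> \<Omega> s = fst s) \<and>
    (\<forall>\<xi> \<phi>. (\<forall>z\<in>Z. (\<xi> z, \<phi> z) \<in> tube e) \<longrightarrow> (\<forall>l<p. rational_on m Z (\<lambda>z. \<xi> z l)) \<longrightarrow> extendable \<phi> \<longrightarrow>
       extendable (\<lambda>z. \<Omega> (\<xi> z, \<phi> z)))"
proof -
  let ?U = "\<lambda>E. {x. E x \<noteq> (0::real)}"
  have op: "open (?U E)" if "is_chart E" for E
    using polynomial_fun_continuous_on[OF chart_polynomial[OF that], of UNIV]
    by (intro open_Collect_neq) auto
  have "C \<subseteq> (\<Union>E\<in>Collect is_chart. ?U E)" using charts by blast
  then obtain F where F: "F \<subseteq> Collect is_chart" "finite F" "C \<subseteq> (\<Union>E\<in>F. ?U E)"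
    using compactE_image[OF C(1), of "Collect is_chart" ?U] op by (metis (no_types, lifting) mem_Collect_eq)
  obtain Es where Es: "set Es = F" using finite_list[OF F(2)] by blast
  define S where "S = quartic_sum Es"
  have S: "polynomial_fun p S" "\<And>c. c \<in> C \<Longrightarrow> S c > 0"
    unfolding S_def using F(1,3) Es by (blast intro: polynomial_fun_quartic_sum quartic_sum_pos)+
  have "continuous_on (tube 1) (\<lambda>s. S (fst s))"
    by (rule function_algebra.polynomial[OF function_algebra_continuous S(1) continuous_on_fst_coordinate])
  moreover have "S (fst (c, c)) > 0" if "c \<in> C" for c using S(2)[OF that] by simp
  ultimately obtain e where e: "e > 0" "\<forall>s\<in>tube e. S (fst s) > 0"
    using tube_shrink[of 1 "\<lambda>s. S (fst s)"] zero_less_one by blast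
  have snd: "continuous_on T (\<lambda>s. snd s l :: real)" for T :: "((nat \<Rightarrow> real) \<times> (nat \<Rightarrow> real)) set" and l
  proof -
    have "continuous_on T ((\<lambda>x. x l) \<circ> snd)"
      by (intro continuous_on_compose continuous_intros)
        (rule continuous_on_subset[OF continuous_on_product_coordinates], simp)
    then show ?thesis by (simp add: o_def)
  qed
  \<comment> \<open>At the outset the weight is \<open>S / S = 1\<close>, the current point is the
    starting point and the displacement is its difference from the target.\<close>
  have "stage e (\<lambda>x. quartic_sum Es x / S x) snd (\<lambda>s i. snd s i - fst s i)"
    unfolding stage_def
  proof (intro conjI ballI allI impI)
    show "snd s \<in> B" "(\<lambda>i. snd s i - fst s i) \<in> rn p" if "s \<in> tube e" for s
      using that B_rn by (auto simp: tube_def rn_iff)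
    show "snd s l = fst s l + quartic_sum Es (fst s) / S (fst s) * (snd s l - fst s l)"
      if "s \<in> tube e" for s l
    proof -
      have "S (fst s) > 0" using e(2) that by blast
      then show ?thesis by (simp add: S_def)
    qed
    show "rational_on m Z (\<lambda>z. snd (\<xi> z, \<phi> z) l - fst (\<xi> z, \<phi> z) l)"
      if "\<forall>l<p. rational_on m Z (\<lambda>z. \<xi> z l)" "extendable \<phi>" "l < p" for \<xi> \<phi> l
      using that extendable_rational[OF that(2,3)]
      by (simp add: function_algebra.diff[OF function_algebra_rational])
  qed (use e(1) in \<open>auto intro!: continuous_intros continuous_on_fst_coordinate snd\<close>)
  from stage_charts[OF S _ this] F(1) Es obtain e' \<Omega> D where st: "stage e' (\<lambda>x. 0) \<Omega> D" by blast
  have in_B: "\<And>s. s \<in> tube e' \<Longrightarrow> \<Omega> s \<in> B" using st unfolding stage_def by blast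
  have zero: "\<Omega> s l = 0" if "s \<in> tube e'" "\<not> l < p" for s l
    using in_B[OF that(1)] B_rn that(2) by (auto simp: rn_iff)
  have "continuous_on (tube e') (\<lambda>s. \<Omega> s l)" for l
  proof (cases "l < p")
    case True
    then show ?thesis using st unfolding stage_def by blast
  next
    case False
    then show ?thesis using zero continuous_on_cong[of "tube e'" "tube e'" "\<lambda>s. \<Omega> s l" "\<lambda>_. 0"] by simp
  qed
  then have "continuous_on (tube e') \<Omega>" by (rule continuous_on_coordinatewise_then_product)
  moreover have "\<Omega> s = fst s" if s: "s \<in> tube e'" "fst s \<in> B" for s
  proof
    fix l
    show "\<Omega> s l = fst s l"
    proof (cases "l < p")
      case True
      then show ?thesis using st s unfolding stage_def by simp
    next
      case False
      then show ?thesis using zero[OF s(1) False] s by (auto simp: tube_def rn_iff)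
    qed
  qed
  moreover have "e' > 0" "\<forall>\<xi> \<phi>. (\<forall>z\<in>Z. (\<xi> z, \<phi> z) \<in> tube e') \<longrightarrow> (\<forall>l<p. rational_on m Z (\<lambda>z. \<xi> z l)) \<longrightarrow>
      extendable \<phi> \<longrightarrow> extendable (\<lambda>z. \<Omega> (\<xi> z, \<phi> z))"
    using st unfolding stage_def by blast+
  ultimately show ?thesis using in_B by blast
qed

end

section \<open>Polynomial approximation and homotopies\<close>

text \<open>The metric on sequences weighs the coordinates by powers of 1/2, whose sum is 2.\<close>

lemma dist_fun_le:
  fixes x y :: "nat \<Rightarrow> real"
  assumes "\<And>i. \<bar>x i - y i\<bar> \<le> r"
  shows "dist x y \<le> 2 * r"
proof -
  have sg: "summable (\<lambda>n. (1 / 2) ^ n * r)" by (intro summable_mult2 summable_geometric) simp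
  have "dist x y = (\<Sum>n. (1/2)^n * min (dist (x (from_nat n)) (y (from_nat n))) 1)" by (rule dist_fun_def)
  also have "\<dots> \<le> (\<Sum>n. (1/2)^n * r)"
  proof (rule suminf_le)
    show "(1/2)^n * min (dist (x (from_nat n)) (y (from_nat n))) 1 \<le> (1/2)^n * r" for n
      using assms[of "from_nat n"] by (intro mult_left_mono) (auto simp: dist_real_def min_le_iff_disj)
    show "summable (\<lambda>n. (1/2)^n * min (dist (x (from_nat n)) (y (from_nat n))) 1)"
    proof (rule summable_comparison_test'[of "\<lambda>n. (1/2)^n * 1"])
      show "summable (\<lambda>n. (1/2)^n * (1::real))" by (intro summable_mult2 summable_geometric) simp
      show "norm ((1/2)^n * min (dist (x (from_nat n)) (y (from_nat n))) 1) \<le> (1/2)^n * 1" for n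
        unfolding norm_mult by (intro mult_mono) auto
    qed
  qed (rule sg)
  also have "\<dots> = 2 * r" using suminf_mult2[of "\<lambda>n. (1/2)^n" r] suminf_geometric[of "1/2::real"] by simp
  finally show ?thesis .
qed

lemma dist_Pair_le: "dist (a, b) (c, d) \<le> dist a c + dist b d"
  unfolding dist_Pair_Pair by (intro sqrt_sum_squares_le_sum) auto

text \<open>Stone-Weierstrass in each coordinate; an error of \<open>\<delta> / 4\<close> per
  coordinate amounts to at most \<open>\<delta> / 2\<close> in the metric on sequences.\<close>

lemma polynomial_map_approximation:
  assumes Z: "compact Z" "Z \<subseteq> rn m" and h: "continuous_on Z h" "\<And>z. z \<in> Z \<Longrightarrow> h z \<in> rn p" and \<delta>: "\<delta> > 0"
  shows "\<exists>\<xi>. (\<forall>l<p. polynomial_fun m (\<lambda>z. \<xi> z l)) \<and> (\<forall>z. \<xi> z \<in> rn p) \<and> (\<forall>z\<in>Z. dist (\<xi> z) (h z) < \<delta>)"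
proof -
  interpret function_ring_on "Collect (polynomial_fun m)" Z
  proof
    show "\<exists>f\<in>Collect (polynomial_fun m). f x \<noteq> f y"
      if xy: "x \<in> Z" "y \<in> Z" "x \<noteq> y" for x y
    proof -
      obtain i where i: "x i \<noteq> y i" using xy(3) by blast
      have "i < m"
      proof (rule ccontr)
        assume "\<not> i < m"
        then show False using i subsetD[OF Z(2) xy(1)] subsetD[OF Z(2) xy(2)] by (simp add: rn_iff)
      qed
      then show ?thesis using i by (intro bexI[of _ "\<lambda>x. x i"]) auto
    qed
  qed (use Z(1) polynomial_fun_continuous_on in auto)
  have "\<exists>g\<in>Collect (polynomial_fun m). \<forall>z\<in>Z. \<bar>h z l - g z\<bar> < \<delta> / 4" for l
    by (rule Stone_Weierstrass_basic[OF continuous_on_product_then_coordinatewise[OF h(1)]])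
      (use \<delta> in simp)
  then obtain g where g: "\<And>l. polynomial_fun m (g l)" "\<And>l z. z \<in> Z \<Longrightarrow> \<bar>h z l - g l z\<bar> < \<delta> / 4"
    by (metis mem_Collect_eq)
  let ?x = "\<lambda>z l. if l < p then g l z else 0"
  have "dist (?x z) (h z) < \<delta>" if "z \<in> Z" for z
  proof -
    have "\<bar>?x z l - h z l\<bar> \<le> \<delta> / 4" for l
      using g(2)[OF that, of l] h(2)[OF that] \<delta> by (auto simp: rn_iff abs_minus_commute)
    then have "dist (?x z) (h z) \<le> 2 * (\<delta> / 4)" by (rule dist_fun_le)
    then show ?thesis using \<delta> by simp
  qed
  then show ?thesis using g(1) by (intro exI[of _ ?x]) (auto simp: rn_iff)
qed

text \<open>Along the subdivision it is shown that each intermediate map has arbitrarily close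
  extendable approximations. The approximation at \<open>t i\<close> serves only as a starting point
  within a fixed distance. The new target is a polynomial map close to the map at
  \<open>t (Suc i)\<close>, which \<open>\<Omega>\<close> fixes, so continuity of
  \<open>\<Omega>\<close> makes the new error as small as desired.\<close>

theorem homotopy_extension:
  fixes H :: "real \<times> (nat \<Rightarrow> real) \<Rightarrow> nat \<Rightarrow> real"
  assumes A: "A \<subseteq> rn m" and Z: "Z \<subseteq> A" "closedin (zariski_topology m) Z" "compact Z"
    and B: "B \<subseteq> rn p"
    and charts: "\<And>y. y \<in> B \<Longrightarrow> \<exists>E N WE VE WN VN M. spray_chart p B E N WE VE WN VN M \<and> E y \<noteq> 0"
    and H: "continuous_on ({0..1} \<times> Z) H" "H ` ({0..1} \<times> Z) \<subseteq> B"
    and f: "\<And>l. l < p \<Longrightarrow> rational_on m Z (\<lambda>z. H (1, z) l)"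
    and G: "\<And>x. x \<in> A \<Longrightarrow> G x \<in> B" "\<And>l. l < p \<Longrightarrow> rational_on m A (\<lambda>x. G x l)" "\<And>z. z \<in> Z \<Longrightarrow> G z = H (0, z)"
  shows "\<exists>F. (\<forall>x\<in>A. F x \<in> B) \<and> (\<forall>l<p. rational_on m A (\<lambda>x. F x l)) \<and> (\<forall>z\<in>Z. F z = H (1, z))"
proof -
  define C where "C = H ` ({0..1} \<times> Z)"
  have IZ: "compact ({0..1::real} \<times> Z)" by (intro compact_Times Z compact_Icc)
  have C: "compact C" "C \<subseteq> B" unfolding C_def using H IZ by (auto intro: compact_continuous_image)
  interpret extension_setting m A Z p B C by unfold_locales (use A Z B C in auto)
  have "\<exists>E. is_chart E \<and> E c \<noteq> 0" if "c \<in> C" for c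
  proof -
    have "c \<in> B" using that C(2) by blast
    from charts[OF this] show ?thesis unfolding is_chart_def by blast
  qed
  then have "\<exists>e>0. \<exists>\<Omega>. (\<forall>s\<in>tube e. \<Omega> s \<in> B) \<and> continuous_on (tube e) \<Omega> \<and>
    (\<forall>s\<in>tube e. fst s \<in> B \<longrightarrow> \<Omega> s = fst s) \<and>
    (\<forall>\<xi> \<phi>. (\<forall>z\<in>Z. (\<xi> z, \<phi> z) \<in> tube e) \<longrightarrow> (\<forall>l<p. rational_on m Z (\<lambda>z. \<xi> z l)) \<longrightarrow> extendable \<phi> \<longrightarrow>
       extendable (\<lambda>z. \<Omega> (\<xi> z, \<phi> z)))"
    by (rule local_projection)
  then obtain e \<Omega> where e: "e > 0" and Om: "continuous_on (tube e) \<Omega>"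
    "\<forall>s\<in>tube e. fst s \<in> B \<longrightarrow> \<Omega> s = fst s"
    and ext0: "\<forall>\<xi> \<phi>. (\<forall>z\<in>Z. (\<xi> z, \<phi> z) \<in> tube e) \<longrightarrow> (\<forall>l<p. rational_on m Z (\<lambda>z. \<xi> z l)) \<longrightarrow> extendable \<phi> \<longrightarrow>
       extendable (\<lambda>z. \<Omega> (\<xi> z, \<phi> z))"
    by (elim exE conjE) (rule that)
  have ext: "extendable (\<lambda>z. \<Omega> (\<xi> z, \<phi> z))"
    if "\<forall>z\<in>Z. (\<xi> z, \<phi> z) \<in> tube e" "\<forall>l<p. rational_on m Z (\<lambda>z. \<xi> z l)" "extendable \<phi>" for \<xi> \<phi>
    using ext0[rule_format, of \<xi> \<phi>] that by simp
  have HC: "H (t, z) \<in> C" if "t \<in> {0..1}" "z \<in> Z" for t z unfolding C_def using that by blast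
  have tubeI: "(x, y) \<in> tube e" if "x \<in> rn p" "y \<in> B" "c \<in> C" "dist x c < e / 4" "dist y c < e / 4" for x y c
  proof -
    have "dist (x, y) (c, c) < e" using dist_Pair_le[of x y c c] that(4,5) e by linarith
    then show ?thesis using that by (auto simp: tube_def)
  qed
  \<comment> \<open>Steps below \<open>e / 8\<close> and an approximation within
    \<open>e / 8\<close> keep the starting map within \<open>e / 4\<close> of the next map, as
    \<open>tubeI\<close> requires.\<close>
  obtain \<delta> where \<delta>: "\<delta> > 0" "\<And>s s'. s \<in> {0..1} \<times> Z \<Longrightarrow> s' \<in> {0..1} \<times> Z \<Longrightarrow> dist s' s < \<delta> \<Longrightarrow> dist (H s') (H s) < e / 8"
    using compact_uniformly_continuous[OF H(1) IZ] e unfolding uniformly_continuous_on_def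
    by (metis zero_less_divide_iff zero_less_numeral)
  obtain N where N: "inverse (real (Suc N)) < \<delta>" using reals_Archimedean[OF \<delta>(1)] by blast
  define n where "n = Suc N"
  define t where "t i = real i / real n" for i
  have n: "n > 0" "1 / real n < \<delta>" using N by (simp_all add: n_def inverse_eq_divide)
  have t01: "t i \<in> {0..1}" if "i \<le> n" for i using that n(1) by (simp add: t_def)
  have step: "dist (H (t i, z)) (H (t (Suc i), z)) < e / 8" if "Suc i \<le> n" "z \<in> Z" for i z
  proof (rule \<delta>(2))
    have "dist (t i, z) (t (Suc i), z) = 1 / real n"
      using n(1) by (simp add: t_def dist_Pair_Pair dist_real_def add_divide_distrib)
    then show "dist (t i, z) (t (Suc i), z) < \<delta>" using n(2) by simp
  qed (use t01[of i] t01[of "Suc i"] that in auto)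
  have close: "\<forall>\<eta>>0. \<exists>\<phi>. extendable \<phi> \<and> (\<forall>z\<in>Z. dist (\<phi> z) (H (t i, z)) < \<eta>)" if "i \<le> n" for i
    using that
  proof (induction i)
    case 0
    have "extendable G" unfolding extendable_def using G(1,2) by blast
    then show ?case using G(3) by (intro allI impI exI[of _ G]) (simp add: t_def)
  next
    case (Suc i)
    show ?case
    proof (intro allI impI)
      fix \<eta> :: real assume \<eta>: "\<eta> > 0"
      have "e / 8 > 0" using e by simp
      then obtain \<phi> where \<phi>: "extendable \<phi>" "\<And>z. z \<in> Z \<Longrightarrow> dist (\<phi> z) (H (t i, z)) < e / 8"
        using Suc.IH Suc.prems by (meson Suc_leD)
      let ?h = "\<lambda>z. H (t (Suc i), z)"
      have hC: "?h z \<in> C" if "z \<in> Z" for z using HC t01[OF Suc.prems] that by blast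
      have hB: "?h z \<in> B" "?h z \<in> rn p" if "z \<in> Z" for z using hC[OF that] C(2) B by blast+
      have near: "dist (\<phi> z) (?h z) < e / 4" if "z \<in> Z" for z
        using dist_triangle[of "\<phi> z" "?h z" "H (t i, z)"] \<phi>(2)[OF that] step[OF Suc.prems that] by linarith
      have h_cont: "continuous_on Z ?h"
      proof -
        have "continuous_on Z (H \<circ> (\<lambda>z. (t (Suc i), z)))"
          using t01[OF Suc.prems]
          by (intro continuous_on_compose continuous_intros continuous_on_subset[OF H(1)]) auto
        then show ?thesis by (simp add: o_def)
      qed
      have \<phi>_cont: "continuous_on Z \<phi>"
      proof (rule continuous_on_coordinatewise_then_product)
        fix l show "continuous_on Z (\<lambda>z. \<phi> z l)"
        proof (cases "l < p")
          case True
          then show ?thesis using rational_on_continuous[OF extendable_rational[OF \<phi>(1)]] by blast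
        next
          case False
          have "\<phi> z l = 0" if "z \<in> Z" for z
            using subsetD[OF B extendable_in[OF \<phi>(1) that]] False by (simp add: rn_iff)
          then show ?thesis using continuous_on_cong[of Z Z "\<lambda>z. \<phi> z l" "\<lambda>_. 0"] by simp
        qed
      qed
      let ?K = "(\<lambda>z. (?h z, \<phi> z)) ` Z"
      have K: "compact ?K" by (intro compact_continuous_image continuous_intros h_cont \<phi>_cont Z(3))
      have KT: "?K \<subseteq> tube e"
      proof clarify
        fix z assume z: "z \<in> Z"
        show "(?h z, \<phi> z) \<in> tube e"
          using e near[OF z] by (intro tubeI[OF hB(2)[OF z] extendable_in[OF \<phi>(1) z] hC[OF z]]) auto
      qed
      \<comment> \<open>\<open>\<Omega>\<close> returns \<open>?h z\<close> at the pairs in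
        \<open>?K\<close>, so targets close to \<open>?h\<close> lead to results close to
        \<open>?h\<close>.\<close>
      obtain d where d: "d > 0" "\<And>k s. k \<in> ?K \<Longrightarrow> s \<in> tube e \<Longrightarrow> dist s k < d \<Longrightarrow> dist (\<Omega> s) (\<Omega> k) < \<eta>"
        using continuous_near_compact[OF Om(1) K KT \<eta>] by blast
      have "min d (e / 4) > 0" using d(1) e by simp
      from polynomial_map_approximation[OF Z(3) subset_trans[OF Z(1) A] h_cont hB(2) this]
      obtain \<xi> where \<xi>: "\<And>l. l < p \<Longrightarrow> polynomial_fun m (\<lambda>z. \<xi> z l)" "\<And>z. \<xi> z \<in> rn p"
        "\<And>z. z \<in> Z \<Longrightarrow> dist (\<xi> z) (?h z) < min d (e / 4)" by blast
      have in_tube: "(\<xi> z, \<phi> z) \<in> tube e" if z: "z \<in> Z" for z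
        using \<xi>(3)[OF z] near[OF z] by (intro tubeI[OF \<xi>(2) extendable_in[OF \<phi>(1) z] hC[OF z]]) auto
      have "extendable (\<lambda>z. \<Omega> (\<xi> z, \<phi> z))"
        by (rule ext) (simp_all add: in_tube \<phi>(1) rational_on_polynomial \<xi>(1))
      moreover have "dist (\<Omega> (\<xi> z, \<phi> z)) (?h z) < \<eta>" if z: "z \<in> Z" for z
      proof -
        have k: "(?h z, \<phi> z) \<in> ?K" using z by blast
        have "dist (\<xi> z, \<phi> z) (?h z, \<phi> z) < d" using \<xi>(3)[OF z] by (simp add: dist_Pair_Pair)
        from d(2)[OF k in_tube[OF z] this] have "dist (\<Omega> (\<xi> z, \<phi> z)) (\<Omega> (?h z, \<phi> z)) < \<eta>" .
        moreover have "\<Omega> (?h z, \<phi> z) = ?h z" using bspec[OF Om(2) subsetD[OF KT k]] hB(1)[OF z] by simp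
        ultimately show ?thesis by simp
      qed
      ultimately show "\<exists>\<phi>. extendable \<phi> \<and> (\<forall>z\<in>Z. dist (\<phi> z) (?h z) < \<eta>)" by blast
    qed
  qed
  have "e / 4 > 0" using e by simp
  from close[OF order_refl, rule_format, OF this]
  have "\<exists>\<phi>. extendable \<phi> \<and> (\<forall>z\<in>Z. dist (\<phi> z) (H (t n, z)) < e / 4)" .
  moreover have tn: "t n = 1" using n(1) by (simp add: t_def)
  ultimately obtain \<phi> where \<phi>: "extendable \<phi>" "\<And>z. z \<in> Z \<Longrightarrow> dist (\<phi> z) (H (1, z)) < e / 4" by auto
  have one: "H (1, z) \<in> C" if "z \<in> Z" for z using HC[of 1 z] that by simp
  have in_tube: "(H (1, z), \<phi> z) \<in> tube e" if z: "z \<in> Z" for z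
    using e \<phi>(2)[OF z] one[OF z] C(2) B by (intro tubeI[OF _ extendable_in[OF \<phi>(1) z] one[OF z]]) auto
  have "extendable (\<lambda>z. \<Omega> (H (1, z), \<phi> z))"
    by (rule ext) (simp_all add: in_tube f \<phi>(1))
  then have "extendable (\<lambda>z. H (1, z))"
  proof (rule extendable_cong)
    fix z assume z: "z \<in> Z"
    show "\<Omega> (H (1, z), \<phi> z) = H (1, z)"
      using bspec[OF Om(2) in_tube[OF z]] subsetD[OF C(2) one[OF z]] by simp
  qed
  then show ?thesis unfolding extendable_def .
qed

section \<open>Regular maps of affine varieties\<close>

lemma openin_affine_set:
  "openin (zariski (affine_set n A)) U \<longleftrightarrow> openin (subtopology (zariski_topology n) A) U"
  by (simp add: affine_set_def)

lemma topspace_affine_set: "A \<subseteq> rn n \<Longrightarrow> topspace (zariski (affine_set n A)) = A"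
  unfolding topspace_zariski_affine_set by blast

text \<open>The i-th coordinate, written as \<open>x i / 1\<close>, is a section over the whole
  target, and its pullback is the required quotient.\<close>

lemma regular_map_rational_on:
  assumes h: "regular_map (affine_set m A) (affine_set n B) h" and A: "A \<subseteq> rn m" and i: "i < n"
  shows "rational_on m A (\<lambda>x. h x i)"
proof -
  let ?Y = "topspace (zariski (affine_set n B))"
  have hXY: "h x \<in> ?Y" if "x \<in> A" for x
    using regular_map_into[OF h] that topspace_affine_set[OF A] by simp
  have sec: "restrict (\<lambda>x. x i / 1) ?Y \<in> sections (affine_set n B) ?Y"
    using openin_topspace[of "zariski (affine_set n B)"] polynomial_fun.coord[OF i] polynomial_fun.const[of n 1]
    unfolding openin_affine_set unfolding affine_set_def function_space.simps mem_Collect_eq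
    by (intro exI[of _ "\<lambda>x. x i"] exI[of _ "\<lambda>x. 1"]) simp
  have pre: "{x \<in> topspace (zariski (affine_set m A)). h x \<in> ?Y} = A"
    using hXY unfolding topspace_affine_set[OF A] by blast
  have "restrict (restrict (\<lambda>x. x i / 1) ?Y \<circ> h) A \<in> sections (affine_set m A) A"
    using regular_map_sections[OF h openin_topspace sec] unfolding pre .
  then obtain P Q where PQ: "polynomial_fun m P" "polynomial_fun m Q" "\<forall>x\<in>A. Q x \<noteq> 0"
    "restrict (restrict (\<lambda>x. x i / 1) ?Y \<circ> h) A = restrict (\<lambda>x. P x / Q x) A"
    unfolding affine_set_def by auto
  show ?thesis
  proof (rule rational_onI[OF PQ(1,2)])
    show "h x i = P x / Q x" if "x \<in> A" for x
      using fun_cong[OF PQ(4), of x] hXY[OF that] that by simp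
  qed (use PQ(3) in blast)
qed

lemma openin_rational_nonzero:
  assumes "rational_on m A f" "A \<subseteq> rn m"
  shows "openin (subtopology (zariski_topology m) A) {x \<in> A. f x \<noteq> 0}"
proof -
  obtain P Q where PQ: "polynomial_fun m P" "polynomial_fun m Q" "\<And>x. x \<in> A \<Longrightarrow> Q x \<noteq> 0"
    "\<And>x. x \<in> A \<Longrightarrow> f x = P x / Q x"
    using assms(1) by (rule rational_onE) (rule that)
  have "{x \<in> A. f x \<noteq> 0} = {x \<in> rn m. P x \<noteq> 0} \<inter> A" using PQ(3,4) assms(2) by auto
  then show ?thesis using openin_zariski_nonzero[OF PQ(1)] by (auto simp: openin_subtopology)
qed

text \<open>Polynomials in the coordinates of \<open>h\<close> are again single quotients. Preimages
  of open sets are thus unions of non-vanishing loci of such quotients, and pulled back sections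
  keep their form.\<close>

lemma regular_mapI_rational:
  assumes A: "A \<subseteq> rn m" and B: "B \<subseteq> rn n" and hB: "\<And>x. x \<in> A \<Longrightarrow> h x \<in> B"
    and rat: "\<And>l. l < n \<Longrightarrow> rational_on m A (\<lambda>x. h x l)"
  shows "regular_map (affine_set m A) (affine_set n B) h"
proof -
  interpret function_algebra A "rational_on m A" by (rule function_algebra_rational)
  let ?TA = "subtopology (zariski_topology m) A" and ?TB = "subtopology (zariski_topology n) B"
  have comp: "rational_on m A (\<lambda>x. P (h x))" if "polynomial_fun n P" for P
    using that rat by (rule polynomial)
  have top: "topspace ?TA = A" using A by auto
  have pre: "openin ?TA {x \<in> A. h x \<in> U}" if U: "openin ?TB U" for U
  proof -
    obtain O' where O': "openin (zariski_topology n) O'" "U = O' \<inter> B"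
      using U by (auto simp: openin_subtopology)
    then obtain S where S: "\<forall>P\<in>S. polynomial_fun n P" "rn n - O' = zero_set n S"
      by (auto simp: openin_zariski_topology)
    have mem: "x \<in> O' \<longleftrightarrow> (\<exists>P\<in>S. P x \<noteq> 0)" if "x \<in> B" for x
    proof -
      have "x \<in> rn n" using that B by blast
      then have "x \<notin> O' \<longleftrightarrow> x \<in> zero_set n S" unfolding S(2)[symmetric] by blast
      then have "x \<notin> O' \<longleftrightarrow> (\<forall>P\<in>S. P x = 0)" using \<open>x \<in> rn n\<close> by (simp add: zero_set_def)
      then show ?thesis by blast
    qed
    have "{x \<in> A. h x \<in> U} = \<Union>((\<lambda>P. {x \<in> A. P (h x) \<noteq> 0}) ` S)"
      unfolding O'(2) using mem hB by auto
    moreover have "openin ?TA {x \<in> A. P (h x) \<noteq> 0}" if "P \<in> S" for P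
      using that S(1) by (intro openin_rational_nonzero comp A) blast
    ultimately show ?thesis by (metis (no_types, lifting) imageE openin_Union)
  qed
  show ?thesis
    unfolding regular_map_def
  proof (intro conjI allI impI)
    show "continuous_map (zariski (affine_set m A)) (zariski (affine_set n B)) h"
      using pre hB top B by (auto simp: continuous_map_def affine_set_def)
    fix U s assume *: "openin (zariski (affine_set n B)) U \<and> s \<in> sections (affine_set n B) U"
    then have U: "openin ?TB U" by (simp add: affine_set_def)
    obtain P Q where PQ: "polynomial_fun n P" "polynomial_fun n Q" "\<forall>x\<in>U. Q x \<noteq> 0"
      "s = restrict (\<lambda>x. P x / Q x) U"
      using * by (auto simp: affine_set_def)
    let ?V = "{x \<in> A. h x \<in> U}"
    interpret V: function_algebra ?V "rational_on m ?V" by (rule function_algebra_rational)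
    have "rational_on m ?V (\<lambda>x. P (h x) / Q (h x))"
    proof (rule V.divide)
      show "rational_on m ?V (\<lambda>x. P (h x))" "rational_on m ?V (\<lambda>x. Q (h x))"
        using comp[OF PQ(1)] comp[OF PQ(2)] by (auto elim: rational_on_subset)
    qed (use PQ(3) in auto)
    then obtain P' Q' where PQ': "polynomial_fun m P'" "polynomial_fun m Q'" "\<And>x. x \<in> ?V \<Longrightarrow> Q' x \<noteq> 0"
      "\<And>x. x \<in> ?V \<Longrightarrow> P (h x) / Q (h x) = P' x / Q' x"
      by (rule rational_onE) (rule that)
    have "restrict (s \<circ> h) ?V = restrict (\<lambda>x. P' x / Q' x) ?V"
      unfolding PQ(4) using PQ'(4) by (intro restrict_ext) simp
    moreover have "\<forall>x\<in>?V. Q' x \<noteq> 0" using PQ'(3) by blast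
    ultimately have "restrict (s \<circ> h) ?V \<in> sections (affine_set m A) ?V"
      unfolding affine_set_def function_space.simps mem_Collect_eq using pre[OF U] PQ'(1,2) by blast
    then show "restrict (s \<circ> h) {x \<in> topspace (zariski (affine_set m A)). h x \<in> U}
        \<in> sections (affine_set m A) {x \<in> topspace (zariski (affine_set m A)). h x \<in> U}"
      unfolding topspace_affine_set[OF A] .
  qed
qed

lemma topspace_induced: "topspace (zariski (induced X T)) = topspace (zariski X) \<inter> T"
  by (simp add: induced_def)

lemma regular_map_induced:
  assumes h: "regular_map X Y h" and into: "\<And>x. x \<in> topspace (zariski X) \<Longrightarrow> x \<in> S \<Longrightarrow> h x \<in> T"
  shows "regular_map (induced X S) (induced Y T) h"
  unfolding regular_map_def
proof (intro conjI allI impI)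
  show "continuous_map (zariski (induced X S)) (zariski (induced Y T)) h"
    using continuous_map_from_subtopology[OF regular_map_continuous[OF h], of S] into
    by (auto simp: induced_def continuous_map_in_subtopology)
  fix U s assume *: "openin (zariski (induced Y T)) U \<and> s \<in> sections (induced Y T) U"
  then obtain s0 U' where s0: "openin (zariski Y) U'" "s0 \<in> sections Y U'" "U = U' \<inter> T" "s = restrict s0 U"
    by (auto simp: induced_def)
  let ?V' = "{x \<in> topspace (zariski X). h x \<in> U'}"
  let ?V = "{x \<in> topspace (zariski (induced X S)). h x \<in> U}"
  have V: "?V = ?V' \<inter> S" unfolding topspace_induced s0(3) using into by blast
  have open_V': "openin (zariski X) ?V'"
    by (rule openin_continuous_map_preimage[OF regular_map_continuous[OF h] s0(1)])
  have "restrict (s0 \<circ> h) ?V' \<in> sections X ?V'" by (rule regular_map_sections[OF h s0(1,2)])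
  moreover have "restrict (s \<circ> h) ?V = restrict (restrict (s0 \<circ> h) ?V') ?V"
    unfolding s0(4) by (rule restrict_ext) (use V in auto)
  ultimately show "restrict (s \<circ> h) ?V \<in> sections (induced X S) ?V"
    unfolding V unfolding induced_def function_space.simps mem_Collect_eq using open_V' by blast
qed

lemma regular_map_from_induced_codomain:
  assumes h: "regular_map X (induced Y T) h"
  shows "regular_map X Y h"
  unfolding regular_map_def
proof (intro conjI allI impI)
  show "continuous_map (zariski X) (zariski Y) h"
    using regular_map_continuous[OF h] by (simp add: induced_def continuous_map_in_subtopology)
  have hT: "h x \<in> T" if "x \<in> topspace (zariski X)" for x
    using regular_map_into[OF h that] by (simp add: topspace_induced)
  fix U s assume *: "openin (zariski Y) U \<and> s \<in> sections Y U"
  let ?W = "U \<inter> T"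
  have o: "openin (zariski (induced Y T)) ?W"
    using * by (auto simp: induced_def openin_subtopology)
  have sec: "restrict s ?W \<in> sections (induced Y T) ?W"
    unfolding induced_def function_space.simps mem_Collect_eq using * by blast
  have V: "{x \<in> topspace (zariski X). h x \<in> ?W} = {x \<in> topspace (zariski X). h x \<in> U}"
    using hT by blast
  have "restrict (restrict s ?W \<circ> h) {x \<in> topspace (zariski X). h x \<in> U} =
      restrict (s \<circ> h) {x \<in> topspace (zariski X). h x \<in> U}"
    by (rule restrict_ext) (use hT in auto)
  with regular_map_sections[OF h o sec]
  show "restrict (s \<circ> h) {x \<in> topspace (zariski X). h x \<in> U} \<in> sections X {x \<in> topspace (zariski X). h x \<in> U}"
    unfolding V by simp
qed

section \<open>Charts from local retract rationality\<close>

lemma openin_zariski_principal_neighbourhood: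
  assumes "openin (zariski_topology n) U" "x \<in> U"
  shows "\<exists>P. polynomial_fun n P \<and> P x \<noteq> 0 \<and> (\<forall>y\<in>rn n. P y \<noteq> 0 \<longrightarrow> y \<in> U)"
proof -
  obtain S where S: "\<forall>P\<in>S. polynomial_fun n P" "rn n - U = zero_set n S" and U: "U \<subseteq> rn n"
    using assms(1) by (auto simp: openin_zariski_topology)
  have "x \<notin> zero_set n S" using assms(2) unfolding S(2)[symmetric] by blast
  moreover have "x \<in> rn n" using U assms(2) by blast
  ultimately obtain P where P: "P \<in> S" "P x \<noteq> 0" by (auto simp: zero_set_def)
  have "y \<in> U" if "y \<in> rn n" "P y \<noteq> 0" for y
  proof (rule ccontr)
    assume "y \<notin> U"
    then have "y \<in> zero_set n S" unfolding S(2)[symmetric] using that(1) by blast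
    then show False using P(1) that(2) by (auto simp: zero_set_def)
  qed
  then show ?thesis using P S(1) by blast
qed

text \<open>The maps \<open>\<iota>\<close> and \<open>\<rho>\<close> have coordinates with common
  denominators, so their formulas make sense beyond \<open>V\<close>. On a suitable Zariski open
  subset of R^p the composite of \<open>\<rho>\<close> with the extension \<open>I\<close> of
  \<open>\<iota>\<close> is a rational map into \<open>B\<close> that fixes the points of
  \<open>V\<close> in it.\<close>

lemma spray_chart_at_point:
  assumes B: "B \<subseteq> rn p" and V: "openin (subtopology (zariski_topology p) B) V" and W: "openin (zariski_topology n) W"
    and \<iota>: "\<And>l. l < n \<Longrightarrow> rational_on p V (\<lambda>y. \<iota> y l)" "\<And>y. y \<in> V \<Longrightarrow> \<iota> y \<in> W"
    and \<rho>: "\<And>l. l < p \<Longrightarrow> rational_on n W (\<lambda>w. \<rho> w l)" "\<And>w. w \<in> W \<Longrightarrow> \<rho> w \<in> B"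
    and inv: "\<And>y. y \<in> V \<Longrightarrow> \<rho> (\<iota> y) = y" and y0: "y0 \<in> V"
  shows "\<exists>E N WE VE WN VN M. spray_chart p B E N WE VE WN VN M \<and> E y0 \<noteq> 0"
proof -
  have Wrn: "W \<subseteq> rn n" using openin_subset[OF W] by simp
  have VB: "V \<subseteq> B" using openin_subset[OF V] by auto
  obtain V' where V': "openin (zariski_topology p) V'" "V = V' \<inter> B" using V by (auto simp: openin_subtopology)
  obtain q where q: "polynomial_fun p q" "q y0 \<noteq> 0" "\<forall>y\<in>rn p. q y \<noteq> 0 \<longrightarrow> y \<in> V'"
    using openin_zariski_principal_neighbourhood[OF V'(1), of y0] y0 V'(2) by blast
  obtain Qw where Qw: "polynomial_fun n Qw" "Qw (\<iota> y0) \<noteq> 0" "\<forall>w\<in>rn n. Qw w \<noteq> 0 \<longrightarrow> w \<in> W"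
    using openin_zariski_principal_neighbourhood[OF W \<iota>(2)[OF y0]] by blast
  obtain a b where ab: "\<forall>l<n. polynomial_fun p (a l)" "polynomial_fun p b"
    "\<forall>x\<in>V. b x \<noteq> 0 \<and> (\<forall>l<n. \<iota> x l = a l x / b x)"
    using rational_on_common_denominator[of n p V "\<lambda>l y. \<iota> y l"] \<iota>(1) by blast
  obtain c d where cd: "\<forall>l<p. polynomial_fun n (c l)" "polynomial_fun n d"
    "\<forall>x\<in>W. d x \<noteq> 0 \<and> (\<forall>l<p. \<rho> x l = c l x / d x)"
    using rational_on_common_denominator[of p n W "\<lambda>l y. \<rho> y l"] \<rho>(1) by blast
  define I where "I x = (\<lambda>l. if l < n then a l x / b x else 0)" for x
  have Irn: "I x \<in> rn n" for x by (simp add: I_def rn_iff)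
  have IV: "I y = \<iota> y" if "y \<in> V" for y
  proof
    fix l show "I y l = \<iota> y l"
    proof (cases "l < n")
      case True
      then show ?thesis using ab(3) that by (simp add: I_def)
    next
      case False
      then show ?thesis using subsetD[OF Wrn \<iota>(2)[OF that]] by (simp add: I_def rn_iff)
    qed
  qed
  let ?D1 = "{x \<in> rn p. b x \<noteq> 0}"
  interpret D1: function_algebra ?D1 "rational_on p ?D1" by (rule function_algebra_rational)
  have Irat: "rational_on p ?D1 (\<lambda>x. I x l)" if "l < n" for l
  proof -
    have "rational_on p ?D1 (\<lambda>x. a l x / b x)"
      by (rule D1.divide; (rule rational_on_polynomial)?) (use ab(1,2) that in auto)
    then show ?thesis using that by (simp add: I_def)
  qed
  have compI: "rational_on p ?D1 (\<lambda>x. P (I x))" if "polynomial_fun n P" for P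
    by (rule D1.polynomial[OF that Irat])
  \<comment> \<open>\<open>A1\<close> is the numerator of \<open>Qw\<close> composed with
    \<open>I\<close>; where it does not vanish, \<open>I x\<close> lies in \<open>W\<close>.\<close>
  obtain A1 B1 where A1: "polynomial_fun p A1" "polynomial_fun p B1" "\<And>x. x \<in> ?D1 \<Longrightarrow> B1 x \<noteq> 0"
    "\<And>x. x \<in> ?D1 \<Longrightarrow> Qw (I x) = A1 x / B1 x"
    using compI[OF Qw(1)] by (rule rational_onE) (rule that)
  let ?D = "{x \<in> rn p. q x \<noteq> 0 \<and> b x \<noteq> 0 \<and> A1 x \<noteq> 0}"
  have DD1: "?D \<subseteq> ?D1" by blast
  have IW: "I x \<in> W" if "x \<in> ?D" for x
  proof -
    have "Qw (I x) \<noteq> 0" using A1(3,4)[of x] that by simp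
    then show ?thesis using Qw(3) Irn by blast
  qed
  interpret D: function_algebra ?D "rational_on p ?D" by (rule function_algebra_rational)
  have "rational_on p ?D (\<lambda>x. \<rho> (I x) l)" if l: "l < p" for l
  proof -
    have "rational_on p ?D (\<lambda>x. c l (I x) / d (I x))"
    proof (rule D.divide)
      show "rational_on p ?D (\<lambda>x. c l (I x))" "rational_on p ?D (\<lambda>x. d (I x))"
        using compI[of "c l"] compI[of d] cd(1,2) l rational_on_subset[OF _ DD1] by blast+
      show "d (I x) \<noteq> 0" if "x \<in> ?D" for x using cd(3) IW[OF that] by blast
    qed
    then show ?thesis by (rule D.cong) (use cd(3) IW l in force)
  qed
  from rational_on_common_denominator[of p p ?D "\<lambda>l x. \<rho> (I x) l", OF this]
  obtain K Q where KQ: "\<forall>l<p. polynomial_fun p (K l)" "polynomial_fun p Q"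
    "\<forall>x\<in>?D. Q x \<noteq> 0 \<and> (\<forall>l<p. \<rho> (I x) l = K l x / Q x)" by blast
  \<comment> \<open>The added factors confine the non-vanishing locus of \<open>e\<close> to
    \<open>?D\<close>. The factor \<open>q\<close> in particular makes points of \<open>B\<close>
    with \<open>e \<noteq> 0\<close> belong to \<open>V\<close>, where the composite is the
    identity.\<close>
  define e where "e x = q x * b x * A1 x * Q x" for x
  define k where "k l x = q x * b x * A1 x * K l x" for l x
  have "polynomial_fun p (\<lambda>x. q x * b x * A1 x * Q x)"
    by (intro polynomial_fun.mult q(1) ab(2) A1(1) KQ(2))
  then have e_poly: "polynomial_fun p e" by (simp add: e_def[abs_def])
  have k_poly: "polynomial_fun p (k l)" if "l < p" for l
  proof -
    have "polynomial_fun p (\<lambda>x. q x * b x * A1 x * K l x)"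
      using KQ(1) that by (intro polynomial_fun.mult q(1) ab(2) A1(1)) blast
    then show ?thesis by (simp add: k_def[abs_def])
  qed
  have eD: "x \<in> ?D" if "x \<in> rn p" "e x \<noteq> 0" for x using that by (simp add: e_def)
  have quot: "k l x / e x = \<rho> (I x) l" if "x \<in> rn p" "e x \<noteq> 0" "l < p" for x l
    using KQ(3) eD[OF that(1,2)] that(2,3) by (simp add: e_def k_def)
  have "\<exists>N WE VE WN VN M. spray_chart p B (\<lambda>x. (e x)\<^sup>2) N WE VE WN VN M"
  proof (rule spray_chart_exists[OF B e_poly k_poly])
    fix x assume x: "x \<in> rn p" "e x \<noteq> 0"
    have r: "\<rho> (I x) \<in> B" by (rule \<rho>(2)[OF IW[OF eD[OF x]]])
    have "(\<lambda>l. if l < p then k l x / e x else 0) = \<rho> (I x)"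
    proof
      fix l show "(if l < p then k l x / e x else 0) = \<rho> (I x) l"
        using quot[OF x] subsetD[OF B r] by (simp add: rn_iff)
    qed
    then show "(\<lambda>l. if l < p then k l x / e x else 0) \<in> B" using r by simp
  next
    fix y l assume y: "y \<in> B" "e y \<noteq> 0" and l: "l < p"
    have yrn: "y \<in> rn p" using y(1) B by blast
    have "y \<in> V" using q(3) eD[OF yrn y(2)] y(1) unfolding V'(2) by blast
    then show "k l y / e y = y l" using quot[OF yrn y(2) l] IV inv by simp
  qed
  moreover have "e y0 \<noteq> 0"
  proof -
    have y0rn: "y0 \<in> rn p" using y0 VB B by blast
    have b0: "b y0 \<noteq> 0" using ab(3) y0 by blast
    have "Qw (I y0) \<noteq> 0" using Qw(2) IV[OF y0] by simp
    then have "A1 y0 \<noteq> 0" using A1(4)[of y0] y0rn b0 by auto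
    then have "y0 \<in> ?D" using y0rn b0 q(2) by simp
    then show ?thesis using KQ(3) unfolding e_def by auto
  qed
  then have "(e y0)\<^sup>2 \<noteq> 0" by simp
  ultimately show ?thesis by (elim exE) (intro exI conjI)
qed

text \<open>The local retraction of \<open>Y\<close> is carried to the closed model:
  \<open>i\<close> is precomposed with \<open>\<psi>\<close> on the preimage of the open piece, and
  \<open>r\<close> is followed by \<open>\<phi>\<close>.\<close>

lemma uniformly_retract_rational_charts:
  assumes Y: "uniformly_retract_rational Y" and B: "B \<subseteq> rn p"
    and \<phi>: "regular_map Y (affine_set p B) \<phi>" and \<psi>: "regular_map (affine_set p B) Y \<psi>"
    and inv: "\<And>b. b \<in> B \<Longrightarrow> \<phi> (\<psi> b) = b" and y: "y \<in> B"
  shows "\<exists>E N WE VE WN VN M. spray_chart p B E N WE VE WN VN M \<and> E y \<noteq> 0"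
proof -
  have top: "topspace (zariski (affine_set p B)) = B" by (rule topspace_affine_set[OF B])
  have "\<psi> y \<in> topspace (zariski Y)" using regular_map_into[OF \<psi>] y top by simp
  then obtain V where V: "openin (zariski Y) V" "\<psi> y \<in> V" "globally_retract_rational (induced Y V)"
    using Y unfolding uniformly_retract_rational_def by blast
  then obtain n W i r where ir: "openin (zariski_topology n) W" "regular_map (induced Y V) (affine_set n W) i"
    "regular_map (affine_set n W) (induced Y V) r" "\<forall>v\<in>topspace (zariski (induced Y V)). r (i v) = v"
    unfolding globally_retract_rational_def by blast
  have Wrn: "W \<subseteq> rn n" using openin_subset[OF ir(1)] by simp
  let ?V = "{b \<in> B. \<psi> b \<in> V}"
  have V_open: "openin (subtopology (zariski_topology p) B) ?V"
    using openin_continuous_map_preimage[OF regular_map_continuous[OF \<psi>] V(1)]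
    unfolding top openin_affine_set .
  have Vrn: "?V \<subseteq> rn p" using B by blast
  have "regular_map (induced (affine_set p B) ?V) (induced Y V) \<psi>"
    by (rule regular_map_induced[OF \<psi>]) blast
  then have "regular_map (affine_set p ?V) (induced Y V) \<psi>"
    by (subst (asm) induced_affine_set) auto
  then have i\<psi>: "regular_map (affine_set p ?V) (affine_set n W) (i \<circ> \<psi>)"
    by (rule regular_map_comp[OF _ ir(2)])
  have \<phi>r: "regular_map (affine_set n W) (affine_set p B) (\<phi> \<circ> r)"
    by (rule regular_map_comp[OF regular_map_from_induced_codomain[OF ir(3)] \<phi>])
  show ?thesis
  proof (rule spray_chart_at_point[OF B V_open ir(1)])
    show "rational_on p ?V (\<lambda>y. (i \<circ> \<psi>) y l)" if "l < n" for l
      by (rule regular_map_rational_on[OF i\<psi> Vrn that])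
    show "rational_on n W (\<lambda>w. (\<phi> \<circ> r) w l)" if "l < p" for l
      by (rule regular_map_rational_on[OF \<phi>r Wrn that])
    show "(i \<circ> \<psi>) y \<in> W" if "y \<in> ?V" for y
      using regular_map_into[OF i\<psi>] that unfolding topspace_affine_set[OF Vrn] topspace_affine_set[OF Wrn] .
    show "(\<phi> \<circ> r) w \<in> B" if "w \<in> W" for w
      using regular_map_into[OF \<phi>r] that unfolding top topspace_affine_set[OF Wrn] .
    show "(\<phi> \<circ> r) ((i \<circ> \<psi>) y) = y" if "y \<in> ?V" for y
    proof -
      have "\<psi> y \<in> topspace (zariski Y)" using openin_subset[OF V(1)] that by blast
      then have "r (i (\<psi> y)) = \<psi> y" using ir(4) that by (simp add: topspace_induced)
      then show ?thesis using inv that by simp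
    qed
    show "y \<in> ?V" using y V(2) by simp
  qed
qed

section \<open>Passing to closed models of the varieties\<close>

text \<open>This turns statements about the abstract space R^n into \<open>compact\<close> and
  \<open>continuous_on\<close> for functions from \<open>nat\<close> to \<open>real\<close>, the
  form in which the extension result is proved.\<close>

lemma Euclidean_space_subtopology: "Euclidean_space n = top_of_set {x. \<forall>i\<ge>n. x i = 0}"
  by (simp only: Euclidean_space_def euclidean_product_topology)

theorem corollary1p6:
  fixes X :: "'a function_space" and Y :: "'b function_space"
    and Z :: "'a set" and f g G :: "'a \<Rightarrow> 'b"
  assumes "real_affine_variety Y" and "uniformly_retract_rational Y"
    and "real_affine_variety X"
    and "closedin (zariski X) Z" and "compactin (euclidean_topology X) Z"
    and "regular_map (induced X Z) Y f" and "regular_map (induced X Z) Y g"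
    and "homotopic_with (\<lambda>_. True) (subtopology (euclidean_topology X) Z)
           (euclidean_topology Y) f g"
    and "regular_map X Y G" and "\<forall>z\<in>Z. G z = g z"
  shows "\<exists>F. regular_map X Y F \<and> (\<forall>z\<in>Z. F z = f z)"
proof -
  let ?X = "topspace (zariski X)" and ?Y = "topspace (zariski Y)"
  obtain m A \<phi> where A: "closedin (zariski_topology m) A" and \<phi>_iso: "regular_isomorphism X (affine_set m A) \<phi>"
    using assms(3) unfolding real_affine_variety_def by blast
  obtain p B \<phi>' where B: "closedin (zariski_topology p) B" and \<phi>'_iso: "regular_isomorphism Y (affine_set p B) \<phi>'"
    using assms(1) unfolding real_affine_variety_def by blast
  have Arn: "A \<subseteq> rn m" and Brn: "B \<subseteq> rn p" using closedin_subset[OF A] closedin_subset[OF B] by simp_all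
  note top = topspace_affine_set[OF Arn] topspace_affine_set[OF Brn]
  obtain \<psi> where \<phi>: "regular_map X (affine_set m A) \<phi>" and \<psi>: "regular_map (affine_set m A) X \<psi>"
    and \<psi>\<phi>: "\<And>x. x \<in> ?X \<Longrightarrow> \<psi> (\<phi> x) = x" and \<phi>\<psi>: "\<And>a. a \<in> A \<Longrightarrow> \<phi> (\<psi> a) = a"
    using \<phi>_iso unfolding regular_isomorphism_def top by blast
  obtain \<psi>' where \<phi>': "regular_map Y (affine_set p B) \<phi>'" and \<psi>': "regular_map (affine_set p B) Y \<psi>'"
    and \<psi>\<phi>': "\<And>y. y \<in> ?Y \<Longrightarrow> \<psi>' (\<phi>' y) = y" and \<phi>\<psi>': "\<And>b. b \<in> B \<Longrightarrow> \<phi>' (\<psi>' b) = b"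
    using \<phi>'_iso unfolding regular_isomorphism_def top by blast
  have TX: "euclidean_topology X = pullback_topology ?X \<phi> (Euclidean_space m)"
    by (rule euclidean_topology_eq[OF A \<phi>_iso])
  have TY: "euclidean_topology Y = pullback_topology ?Y \<phi>' (Euclidean_space p)"
    by (rule euclidean_topology_eq[OF B \<phi>'_iso])
  have ZX: "Z \<subseteq> ?X" by (rule closedin_subset[OF assms(4)])
  have \<phi>A: "\<phi> x \<in> A" if "x \<in> ?X" for x using regular_map_into[OF \<phi> that] unfolding top .
  have \<psi>X: "\<psi> a \<in> ?X" if "a \<in> A" for a using regular_map_into[OF \<psi>] that unfolding top by blast
  have \<phi>B: "\<phi>' y \<in> B" if "y \<in> ?Y" for y using regular_map_into[OF \<phi>' that] unfolding top .
  \<comment> \<open>As a preimage under \<open>\<psi>\<close> the set is Zariski closed; as the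
    image of \<open>Z\<close> under \<open>\<phi>\<close> it is compact.\<close>
  define Z' where "Z' = {a \<in> A. \<psi> a \<in> Z}"
  have Z'_image: "Z' = \<phi> ` Z"
  proof
    show "Z' \<subseteq> \<phi> ` Z" unfolding Z'_def using \<phi>\<psi> by force
    show "\<phi> ` Z \<subseteq> Z'" unfolding Z'_def using ZX \<phi>A \<psi>\<phi> by fastforce
  qed
  have Z'A: "Z' \<subseteq> A" unfolding Z'_def by blast
  have Z'rn: "Z' \<subseteq> rn m" using Z'A Arn by blast
  have "closedin (zariski (affine_set m A)) {a \<in> topspace (zariski (affine_set m A)). \<psi> a \<in> Z}"
    by (rule closedin_continuous_map_preimage[OF regular_map_continuous[OF \<psi>] assms(4)])
  then have "closedin (subtopology (zariski_topology m) A) Z'"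
    unfolding top Z'_def by (simp add: affine_set_def)
  then have Z'_closed: "closedin (zariski_topology m) Z'" by (rule closedin_trans_full[OF _ A])
  have \<phi>_cont: "continuous_map (euclidean_topology X) (Euclidean_space m) \<phi>"
  proof -
    have "continuous_map (euclidean_topology X) (Euclidean_space m) (id \<circ> \<phi>)"
      unfolding TX by (rule continuous_map_pullback[OF continuous_map_id])
    then show ?thesis by simp
  qed
  have \<phi>'_cont: "continuous_map (euclidean_topology Y) (Euclidean_space p) \<phi>'"
  proof -
    have "continuous_map (euclidean_topology Y) (Euclidean_space p) (id \<circ> \<phi>')"
      unfolding TY by (rule continuous_map_pullback[OF continuous_map_id])
    then show ?thesis by simp
  qed
  have "compactin (Euclidean_space m) Z'"
    unfolding Z'_image by (rule image_compactin[OF assms(5) \<phi>_cont])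
  then have Z'_compact: "compact Z'"
    unfolding Euclidean_space_subtopology compactin_subtopology by simp
  obtain h where h: "continuous_map (prod_topology (top_of_set {0..1::real}) (subtopology (euclidean_topology X) Z))
        (euclidean_topology Y) h" "\<And>x. x \<in> Z \<Longrightarrow> h (0, x) = g x" "\<And>x. x \<in> Z \<Longrightarrow> h (1, x) = f x"
  proof -
    have tz: "topspace (subtopology (euclidean_topology X) Z) = Z"
      unfolding topspace_subtopology using compactin_subset_topspace[OF assms(5)] by (rule Int_absorb1)
    \<comment> \<open>The homotopy is reversed, so that time 0 belongs to \<open>g\<close>, the map
      known to extend.\<close>
    have "homotopic_with (\<lambda>_. True) (subtopology (euclidean_topology X) Z) (euclidean_topology Y) g f"
      by (rule homotopic_with_symD[OF assms(8)])
    then show ?thesis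
      unfolding homotopic_with_def by (elim exE conjE) (rule that, assumption, simp_all)
  qed
  have hY: "h (t, x) \<in> ?Y" if "t \<in> {0..1}" "x \<in> Z" for t x
  proof -
    have "(t, x) \<in> topspace (prod_topology (top_of_set {0..1::real}) (subtopology (euclidean_topology X) Z))"
      using that compactin_subset_topspace[OF assms(5)] by auto
    then have "h (t, x) \<in> topspace (euclidean_topology Y)"
      using continuous_map_image_subset_topspace[OF h(1)] by blast
    then show ?thesis unfolding TY topspace_pullback_topology by blast
  qed
  define H where "H s = \<phi>' (h (fst s, \<psi> (snd s)))" for s
  \<comment> \<open>Continuity into the pulled back topology is tested after composing with
    \<open>\<phi>\<close>, and \<open>\<phi> \<circ> \<psi>\<close> is the identity on
    \<open>Z'\<close>.\<close>
  have "continuous_map (top_of_set Z') (euclidean_topology X) \<psi>"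
    unfolding TX
  proof (rule continuous_map_pullback')
    have "continuous_map (top_of_set Z') (Euclidean_space m) id"
      unfolding Euclidean_space_subtopology
      using subsetD[OF Z'rn] by (auto simp: continuous_map_in_subtopology rn_iff)
    then show "continuous_map (top_of_set Z') (Euclidean_space m) (\<phi> \<circ> \<psi>)"
      by (rule continuous_map_eq) (use \<phi>\<psi> Z'A in auto)
    show "topspace (top_of_set Z') \<subseteq> \<psi> -` ?X" using \<psi>X Z'A by auto
  qed
  then have "continuous_map (top_of_set Z') (subtopology (euclidean_topology X) Z) \<psi>"
    by (rule continuous_map_into_subtopology) (auto simp: Z'_def)
  then have "continuous_map (prod_topology (top_of_set {0..1::real}) (top_of_set Z'))
      (prod_topology (top_of_set {0..1::real}) (subtopology (euclidean_topology X) Z)) (\<lambda>(t, a). (t, \<psi> a))"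
    unfolding continuous_map_prod_top by simp
  then have "continuous_map (top_of_set ({0..1::real} \<times> Z'))
      (prod_topology (top_of_set {0..1::real}) (subtopology (euclidean_topology X) Z)) (\<lambda>(t, a). (t, \<psi> a))"
    by (simp add: prod_topology_subtopology_eu)
  from continuous_map_compose[OF continuous_map_compose[OF this h(1)] \<phi>'_cont]
  have "continuous_map (top_of_set ({0..1} \<times> Z')) (Euclidean_space p) (\<phi>' \<circ> (h \<circ> (\<lambda>(t, a). (t, \<psi> a))))"
    .
  moreover have "\<phi>' \<circ> (h \<circ> (\<lambda>(t, a). (t, \<psi> a))) = H" by (auto simp: H_def)
  ultimately have H_cont: "continuous_on ({0..1} \<times> Z') H"
    unfolding Euclidean_space_subtopology by (simp add: continuous_map_in_subtopology)
  have H_in: "H ` ({0..1} \<times> Z') \<subseteq> B" using \<phi>B hY by (auto simp: H_def Z'_def)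
  have "regular_map (induced (affine_set m A) Z') (induced X Z) \<psi>"
    by (rule regular_map_induced[OF \<psi>]) (simp add: Z'_def)
  then have "regular_map (affine_set m Z') (induced X Z) \<psi>" unfolding induced_affine_set[OF Z'A] .
  from regular_map_comp[OF regular_map_comp[OF this assms(6)] \<phi>']
  have "regular_map (affine_set m Z') (affine_set p B) (\<phi>' \<circ> (f \<circ> \<psi>))" .
  then have f_rat: "rational_on m Z' (\<lambda>z. H (1, z) l)" if "l < p" for l
    using function_algebra.cong[OF function_algebra_rational regular_map_rational_on[OF _ Z'rn that],
        of _ _ "\<lambda>z. H (1, z) l"] h(3)
    by (auto simp: H_def Z'_def)
  have G_reg: "regular_map (affine_set m A) (affine_set p B) (\<phi>' \<circ> (G \<circ> \<psi>))"
    by (rule regular_map_comp[OF regular_map_comp[OF \<psi> assms(9)] \<phi>'])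
  obtain F where F: "\<And>x. x \<in> A \<Longrightarrow> F x \<in> B" "\<And>l. l < p \<Longrightarrow> rational_on m A (\<lambda>x. F x l)"
    "\<And>z. z \<in> Z' \<Longrightarrow> F z = H (1, z)"
  proof -
    have "\<exists>F. (\<forall>x\<in>A. F x \<in> B) \<and> (\<forall>l<p. rational_on m A (\<lambda>x. F x l)) \<and> (\<forall>z\<in>Z'. F z = H (1, z))"
    proof (rule homotopy_extension[where G = "\<phi>' \<circ> (G \<circ> \<psi>)"])
      show "A \<subseteq> rn m" "Z' \<subseteq> A" "closedin (zariski_topology m) Z'" "compact Z'" "B \<subseteq> rn p"
        "continuous_on ({0..1} \<times> Z') H" "H ` ({0..1} \<times> Z') \<subseteq> B"
        by (rule Arn Z'A Z'_closed Z'_compact Brn H_cont H_in)+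
      show "rational_on m Z' (\<lambda>z. H (1, z) l)" if "l < p" for l by (rule f_rat[OF that])
      show "\<exists>E N WE VE WN VN M. spray_chart p B E N WE VE WN VN M \<and> E y \<noteq> 0" if "y \<in> B" for y
        by (rule uniformly_retract_rational_charts[OF assms(2) Brn \<phi>' \<psi>' \<phi>\<psi>' that])
      show "(\<phi>' \<circ> (G \<circ> \<psi>)) x \<in> B" if "x \<in> A" for x
        using regular_map_into[OF G_reg] that unfolding top by blast
      show "rational_on m A (\<lambda>x. (\<phi>' \<circ> (G \<circ> \<psi>)) x l)" if "l < p" for l
        by (rule regular_map_rational_on[OF G_reg Arn that])
      show "(\<phi>' \<circ> (G \<circ> \<psi>)) z = H (0, z)" if "z \<in> Z'" for z
        using that assms(10) h(2) by (simp add: H_def Z'_def)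
    qed
    then show ?thesis using that by blast
  qed
  have "regular_map (affine_set m A) (affine_set p B) F"
    by (rule regular_mapI_rational[OF Arn Brn F(1,2)])
  from regular_map_comp[OF regular_map_comp[OF \<phi> this] \<psi>']
  have "regular_map X Y (\<psi>' \<circ> (F \<circ> \<phi>))" .
  moreover have "(\<psi>' \<circ> (F \<circ> \<phi>)) z = f z" if z: "z \<in> Z" for z
  proof -
    have "\<phi> z \<in> Z'" using z Z'_image by blast
    then have "F (\<phi> z) = \<phi>' (f z)" using F(3) \<psi>\<phi> ZX z h(3) by (auto simp: H_def)
    moreover have "f z \<in> ?Y" using regular_map_into[OF assms(6), of z] z ZX by (auto simp: topspace_induced)
    ultimately show ?thesis using \<psi>\<phi>' by simp
  qed
  ultimately show ?thesis by blast
qed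

end
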